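(* Let $X$ be a local dendrite and let $f:X\to X$ be a homeomorphism. Then $h_{\mathrm{pol}}(f)\in\{0,1\}$. Moreover, $h_{\mathrm{pol}}(f)=1$ if and only if $f$ possesses a wandering point.
   Context: A continuum is a nonempty connected compact metric space. A dendrite is a locally connected continuum which contains no simple closed curve. A local dendrite is a continuum such that every point has a neighbourhood which is a dendrite. Polynomial entropy: let $(X,d)$ be a compact metric space and $f:X\to X$ continuous. For $n\geq 1$ put $d_n^f(x,y)=\max_{0\leq k\leq n-1}d(f^k(x),f^k(y))$. For $\varepsilon>0$, a finite set $E\subset X$ is $(n,\varepsilon)$-separated if $d_n^f(x,y)\geq\varepsilon$ for all distinct $x,y\in E$; $\mathrm{sep}(n,\varepsilon)$ denotes the maximal cardinality of an $(n,\varepsilon)$-separated subset of $X$. Then $$h_{\mathrm{pol}}(f)=\lim_{\varepsilon\to 0}\limsup_{n\to\infty}\frac{\log \mathrm{sep}(n,\varepsilon)}{\log n}.$$ A set $A\subset X$ is wandering (for $f$) if $f^n(A)\cap A=\emptyset$ for all $n\geq 1$. A point $p\in X$ is wandering if it has a wandering neighbourhood $U\ni p$. *)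

theory Defs
  imports "HOL-Analysis.Analysis"
begin

text \<open>
  A metric space is represented by a set X in a type of class metric_space, carrying the
  induced metric; maps from X to itself are total functions of which only the values on X matter.
\<close>

definition continuum :: "'a::metric_space set \<Rightarrow> bool" where
  "continuum X \<longleftrightarrow> X \<noteq> {} \<and> connected X \<and> compact X"

definition simple_closed_curve :: "'a::metric_space set \<Rightarrow> bool" where
  "simple_closed_curve C \<longleftrightarrow> C homeomorphic sphere (0::complex) 1"

definition dendrite :: "'a::metric_space set \<Rightarrow> bool" where
  "dendrite X \<longleftrightarrow> continuum X \<and> locally connected X \<and> \<not> (\<exists>C\<subseteq>X. simple_closed_curve C)"

text \<open>Neighbourhoods are relative to X and need not be open.\<close>

definition neighbourhood_in :: "'a::metric_space set \<Rightarrow> 'a \<Rightarrow> 'a set \<Rightarrow> bool" where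
  "neighbourhood_in X p U \<longleftrightarrow>
     U \<subseteq> X \<and> (\<exists>V. openin (top_of_set X) V \<and> p \<in> V \<and> V \<subseteq> U)"

definition local_dendrite :: "'a::metric_space set \<Rightarrow> bool" where
  "local_dendrite X \<longleftrightarrow>
     continuum X \<and> (\<forall>p\<in>X. \<exists>D. neighbourhood_in X p D \<and> dendrite D)"

text \<open>Only meaningful for n at least 1.\<close>

definition dyn_dist :: "('a::metric_space \<Rightarrow> 'a) \<Rightarrow> nat \<Rightarrow> 'a \<Rightarrow> 'a \<Rightarrow> real" where
  "dyn_dist f n x y = Max ((\<lambda>k. dist ((f ^^ k) x) ((f ^^ k) y)) ` {..<n})"

definition dyn_separated ::
    "'a::metric_space set \<Rightarrow> ('a \<Rightarrow> 'a) \<Rightarrow> nat \<Rightarrow> real \<Rightarrow> 'a set \<Rightarrow> bool" where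
  "dyn_separated X f n \<epsilon> E \<longleftrightarrow>
     finite E \<and> E \<subseteq> X \<and> (\<forall>x\<in>E. \<forall>y\<in>E. x \<noteq> y \<longrightarrow> dyn_dist f n x y \<ge> \<epsilon>)"

text \<open>
  The set of cardinalities is finite, so that the maximum is meaningful, whenever X is compact,
  f is a continuous map from X to X, n is at least 1 and \<open>\<epsilon>\<close> is positive.
\<close>

definition sep_num :: "'a::metric_space set \<Rightarrow> ('a \<Rightarrow> 'a) \<Rightarrow> nat \<Rightarrow> real \<Rightarrow> nat" where
  "sep_num X f n \<epsilon> = Max {card E |E. dyn_separated X f n \<epsilon> E}"

text \<open>
  For X compact and f a continuous map from X to X, the upper limit is antitone in \<open>\<epsilon>\<close>, so the limit exists
  in the extended reals. The values at n = 0 and n = 1 do not affect the upper limit.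
\<close>

definition pol_entropy :: "'a::metric_space set \<Rightarrow> ('a \<Rightarrow> 'a) \<Rightarrow> ereal" where
  "pol_entropy X f =
     Lim (at_right 0) (\<lambda>\<epsilon>. limsup (\<lambda>n. ereal (ln (real (sep_num X f n \<epsilon>)) / ln (real n))))"

definition wandering_set :: "('a \<Rightarrow> 'a) \<Rightarrow> 'a set \<Rightarrow> bool" where
  "wandering_set f A \<longleftrightarrow> (\<forall>n\<ge>1. (f ^^ n) ` A \<inter> A = {})"

definition wandering_point :: "'a::metric_space set \<Rightarrow> ('a \<Rightarrow> 'a) \<Rightarrow> 'a \<Rightarrow> bool" where
  "wandering_point X f p \<longleftrightarrow> p \<in> X \<and> (\<exists>U. neighbourhood_in X p U \<and> wandering_set f U)"

end

theory Submission
  imports Defs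
begin

text \<open>
  If a point \<open>p\<close> has a wandering neighbourhood, then the points \<open>g\<^sup>j p\<close> with \<open>j < n\<close> are
  \<open>(n, \<epsilon>)\<close>-separated for a fixed \<open>\<epsilon>\<close>: the later of two such orbits is at \<open>p\<close> at a time when the other one
  has already left the neighbourhood for good. So there are at least \<open>n\<close> separated points
  (\<open>wandering_separated\<close>).

  In the other direction, dendrites are uniquely arcwise connected, so their points have small
  neighbourhoods with finite boundary, and by compactness there is, for every \<open>\<epsilon>\<close>, a finite set \<open>F\<close> such
  that every connected set that misses \<open>F\<close> has diameter at most \<open>\<epsilon>\<close> (\<open>finite_cut_set\<close>). Let \<open>G\<close> be a finite set
  that contains the preimages of \<open>F\<close> under the first \<open>n\<close> iterates. A point \<open>x\<close> outside \<open>G\<close> lies in a component of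
  \<open>X - G\<close> with some \<open>p \<in> G\<close> in its closure, and the first \<open>n\<close> images of that component miss \<open>F\<close>. Hence
  \<open>x\<close> and \<open>p\<close> stay \<open>\<epsilon>\<close>-close for \<open>n\<close> steps, and a \<open>(n, 3\<epsilon>)\<close>-separated set has at most \<open>card G\<close> elements
  (\<open>separated_card_le\<close>). As \<open>G\<close> can be chosen with at most \<open>n * card F + 1\<close> elements, the polynomial entropy is at
  most 1, and it equals 1 when there is a wandering point.

  Suppose now that no point wanders. Then the number of separated points is bounded independently
  of \<open>n\<close>, which makes the entropy 0. The key is \<open>cut_point_periodic\<close>: if a homeomorphism of a connected
  and locally connected space has no wandering points, then all cut points are periodic, because
  otherwise some iterate would map a component of the complement of the cut point strictly into
  itself. Two cases remain.

  If all points have small neighbourhoods whose boundaries are finite sets of periodic points, then \<open>F\<close>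
  consists of periodic points, and the finite union of their orbits serves as \<open>G\<close> for all \<open>n\<close>
  simultaneously.

  Otherwise there is an arc whose interior points are not periodic, as in an irrational rotation of the
  circle. Near it there are arbitrarily small beads: connected open sets with at most two boundary points,
  none of them periodic. The union of a chain of overlapping iterates of a bead has again at most two boundary points
  (boundaries are submodular, and a single boundary point would be a cut point), so the
  limit of all these unions has a finite invariant boundary. If that boundary were not empty, it would be periodic
  and approached along an arc of cut points that the boundaries of the finite unions have to
  meet, in contradiction to \<open>cut_point_periodic\<close>. So finitely many iterates of the closed bead cover \<open>X\<close>
  (\<open>finite_translates_cover\<close>). This also forces some bead to have only small iterates: beads that shrink to
  a point and have large iterates would make finitely many shrinking sets cover \<open>X\<close>
  (\<open>exists_stable_bead\<close>). The covering by finitely many iterates of such a bead bounds the number of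
  separated points.
\<close>

section \<open>Components and boundaries\<close>

text \<open>
  For an open set, the difference of closure and set is the boundary; when the ambient set is closed this
  is also the boundary relative to it.
\<close>

lemma connected_meets_boundary:
  assumes "connected A" "A \<subseteq> X" "openin (top_of_set X) O'" "A \<inter> O' \<noteq> {}" "\<not> A \<subseteq> O'"
  shows "A \<inter> (closure O' - O') \<noteq> {}"
proof
  assume e: "A \<inter> (closure O' - O') = {}"
  have "openin (top_of_set A) (A \<inter> O')"
    using assms(2,3) by (metis inf.absorb_iff2 openin_subtopology_Int2 subtopology_subtopology)
  moreover have "closedin (top_of_set A) (A \<inter> O')"
  proof -
    have "A \<inter> O' = A \<inter> closure O'" using e closure_subset by fastforce
    then show ?thesis by (simp add: closedin_closed_Int)
  qed
  ultimately have "A \<inter> O' = {} \<or> A \<inter> O' = A" using assms(1) connected_clopen by blast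
  then show False using assms(4,5) by blast
qed

lemma boundary_nonempty:
  assumes "connected X" "openin (top_of_set X) O'" "O' \<noteq> {}" "O' \<noteq> X"
  shows "closure O' - O' \<noteq> {}"
  using connected_meets_boundary[of X X O'] assms openin_imp_subset by blast

lemma openin_component:
  assumes "locally connected X" "openin (top_of_set X) U"
  shows "openin (top_of_set X) (connected_component_set U a)"
proof (cases "a \<in> U")
  case True
  then show ?thesis using assms locally_connected_open_connected_component by blast
next
  case False
  then show ?thesis by (simp add: connected_component_eq_empty[THEN iffD2])
qed

lemma closure_component_Int: "closure (connected_component_set U a) \<inter> U = connected_component_set U a"
proof -
  have "closedin (top_of_set U) (connected_component_set U a)" by (rule closedin_connected_component)
  then obtain T where T: "closed T" "connected_component_set U a = U \<inter> T" by (auto simp: closedin_closed)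
  then have "closure (connected_component_set U a) \<subseteq> T" by (simp add: closure_minimal)
  then show ?thesis using T(2) closure_subset[of "connected_component_set U a"] by blast
qed

lemma component_disjoint_or_subset:
  assumes "connected A" "A \<subseteq> U" "A \<inter> connected_component_set U a \<noteq> {}"
  shows "A \<subseteq> connected_component_set U a"
  using assms by (metis Int_emptyI connected_component_eq connected_component_maximal)

lemma connected_insert_closure:
  assumes "connected A" "c \<in> closure A"
  shows "connected (insert c A)"
  using connected_intermediate_closure[OF assms(1), of "insert c A"] assms(2) closure_subset by auto

lemma openin_Diff_point:
  fixes X :: "'a::metric_space set"
  assumes "openin (top_of_set X) U"
  shows "openin (top_of_set X) (U - {c})"
proof -
  have "openin (top_of_set X) (U \<inter> - {c})"
    using openin_Int_open[OF assms, of "- {c}"] by (simp add: open_Compl)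
  then show ?thesis by (simp add: Diff_eq)
qed

lemma openin_self_inter_ball:
  assumes "openin (top_of_set X) U" 
  shows "openin (top_of_set X) (U \<inter> ball x e)"
  using assms openin_Int_open by blast

section \<open>Arcs in locally connected continua\<close>

text \<open>
  Paths are built from finer and finer chains of connected open sets of small diameter. The end point
  of such a chain may be repeated, so that all links of a chain can be refined into the
  same number of smaller links.
\<close>

definition small_link :: "'a::metric_space set \<Rightarrow> 'a set \<Rightarrow> real \<Rightarrow> 'a \<Rightarrow> 'a \<Rightarrow> bool" where
  "small_link X U e u v \<longleftrightarrow> (\<exists>W. openin (top_of_set X) W \<and> connected W \<and> W \<subseteq> U \<and>
      (\<forall>a\<in>W. \<forall>b\<in>W. dist a b \<le> e) \<and> u \<in> W \<and> v \<in> W)"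

lemma small_link_exists:
  assumes lc: "locally connected X" and U: "openin (top_of_set X) U" and "a \<in> U" "e > 0"
  shows "\<exists>W. openin (top_of_set X) W \<and> a \<in> W \<and> W \<subseteq> U \<and> (\<forall>x\<in>W. small_link X U e a x)"
proof -
  have "openin (top_of_set X) (U \<inter> ball a (e/2))" by (rule openin_self_inter_ball[OF U])
  moreover have "a \<in> U \<inter> ball a (e/2)" using assms by auto
  ultimately obtain W where W: "openin (top_of_set X) W" "connected W" "a \<in> W" "W \<subseteq> U \<inter> ball a (e/2)"
    using lc unfolding locally_connected by meson
  have "dist x y \<le> e" if "x \<in> W" "y \<in> W" for x y
    using W(4) that dist_triangle_half_r[of a x e y] by (auto simp: subset_iff intro: less_imp_le)
  then have "\<forall>x\<in>W. small_link X U e a x" unfolding small_link_def using W by blast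
  then show ?thesis using W by blast
qed

lemma small_chain_exists:
  assumes lc: "locally connected X" and U: "openin (top_of_set X) U" "connected U"
    and "a \<in> U" "b \<in> U" "e > 0"
  shows "\<exists>n. (small_link X U e ^^ n) a b"
proof -
  have "(small_link X U e)\<^sup>*\<^sup>* a b"
  proof (rule connected_equivalence_relation[OF U(2) assms(4,5)])
    have sym: "symp (small_link X U e)" by (auto simp: symp_def small_link_def)
    show "(small_link X U e)\<^sup>*\<^sup>* y x" if "(small_link X U e)\<^sup>*\<^sup>* x y" for x y
      using that sym by (metis symp_rtranclp sympE)
    show "(small_link X U e)\<^sup>*\<^sup>* x z" if "(small_link X U e)\<^sup>*\<^sup>* x y" "(small_link X U e)\<^sup>*\<^sup>* y z" for x y z
      using that by simp
    show "\<exists>T. openin (top_of_set U) T \<and> a \<in> T \<and> (\<forall>x\<in>T. (small_link X U e)\<^sup>*\<^sup>* a x)" if a: "a \<in> U" for a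
    proof -
      obtain W where W: "openin (top_of_set X) W" "a \<in> W" "W \<subseteq> U" "\<forall>x\<in>W. small_link X U e a x"
        using small_link_exists[OF lc U(1) a \<open>e > 0\<close>] by blast
      have "openin (top_of_set U) W" using W(1,3) openin_imp_subset[OF U(1)] by (metis openin_subset_trans)
      then show ?thesis using W by blast
    qed
  qed
  then show ?thesis by (simp add: rtranclp_power)
qed

lemma relpowp_pad:
  assumes "R b b" "(R ^^ n) a b" "n \<le> m"
  shows "(R ^^ m) a b"
  using assms(3)
proof (induction m rule: dec_induct)
  case base then show ?case by (rule assms(2))
next
  case (step k) then show ?case using assms(1) by (auto intro: relcomppI)
qed

text \<open>
  There are \<open>k\<close> links and \<open>k + 1\<close> points, each point but the last being the left end of a link.
\<close>

definition link_chain :: "'a::metric_space set \<Rightarrow> real \<Rightarrow> nat \<Rightarrow> (nat \<Rightarrow> 'a) \<Rightarrow> (nat \<Rightarrow> 'a set) \<Rightarrow> bool" where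
  "link_chain X e k c V \<longleftrightarrow> k \<ge> 1 \<and> (\<forall>i<k. openin (top_of_set X) (V i) \<and> connected (V i) \<and>
      (\<forall>a\<in>V i. \<forall>b\<in>V i. dist a b \<le> e) \<and> c i \<in> V i \<and> c (Suc i) \<in> V i)"

lemma link_chain_exists:
  assumes lc: "locally connected X" and U: "openin (top_of_set X) U" "connected U"
    and ab: "a \<in> U" "b \<in> U" and "e > 0"
  shows "\<exists>n. \<forall>m\<ge>n. \<exists>c V. link_chain X e m c V \<and> c 0 = a \<and> c m = b \<and> (\<forall>i<m. V i \<subseteq> U)"
proof -
  obtain n where n: "(small_link X U e ^^ n) a b" using small_chain_exists[OF assms] by blast
  have "small_link X U e b b" using small_link_exists[OF lc U(1) ab(2) \<open>e > 0\<close>] by blast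
  then have *: "(small_link X U e ^^ m) a b" if "m \<ge> n" for m using n relpowp_pad that by metis
  have "\<exists>c V. link_chain X e m c V \<and> c 0 = a \<and> c m = b \<and> (\<forall>i<m. V i \<subseteq> U)" if m: "m \<ge> Suc n" for m
  proof -
    obtain c where c: "c 0 = a" "c m = b" "\<forall>i<m. small_link X U e (c i) (c (Suc i))"
      using *[of m] m unfolding relpowp_fun_conv by auto
    then obtain V where "\<forall>i<m. openin (top_of_set X) (V i) \<and> connected (V i) \<and> V i \<subseteq> U \<and>
      (\<forall>a\<in>V i. \<forall>b\<in>V i. dist a b \<le> e) \<and> c i \<in> V i \<and> c (Suc i) \<in> V i"
      unfolding small_link_def by metis
    then have "link_chain X e m c V \<and> c 0 = a \<and> c m = b \<and> (\<forall>i<m. V i \<subseteq> U)"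
      using c m unfolding link_chain_def by auto
    then show ?thesis by blast
  qed
  then show ?thesis by blast
qed

text \<open>
  The uniform factor \<open>m\<close> lets the refined chain be indexed by integer division, so the step functions of
  successive chains on the unit interval are close to each other.
\<close>

lemma link_chain_refine:
  assumes lc: "locally connected X" and ch: "link_chain X e k c V" and "e' > 0"
  shows "\<exists>m c' V'. m \<ge> 1 \<and> link_chain X e' (k * m) c' V' \<and> (\<forall>i\<le>k. c' (i * m) = c i) \<and>
      (\<forall>j<k * m. V' j \<subseteq> V (j div m))"
proof -
  have "\<exists>n. i < k \<longrightarrow> (\<forall>m\<ge>n. \<exists>d W. link_chain X e' m d W \<and> d 0 = c i \<and> d m = c (Suc i) \<and> (\<forall>j<m. W j \<subseteq> V i))" for i
  proof (cases "i < k")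
    case True
    then show ?thesis
      using link_chain_exists[OF lc, of "V i" "c i" "c (Suc i)" e'] \<open>e' > 0\<close> ch unfolding link_chain_def[of _ e] by blast
  qed auto
  then obtain n where n: "\<And>i m. i < k \<Longrightarrow> m \<ge> n i \<Longrightarrow>
      \<exists>d W. link_chain X e' m d W \<and> d 0 = c i \<and> d m = c (Suc i) \<and> (\<forall>j<m. W j \<subseteq> V i)" by metis
  define m where "m = Suc (\<Sum>i<k. n i)"
  have "n i \<le> m" if "i < k" for i
    unfolding m_def using that by (meson finite_lessThan lessThan_iff le_SucI member_le_sum zero_le)
  with n have "\<forall>i. \<exists>d W. i < k \<longrightarrow> link_chain X e' m d W \<and> d 0 = c i \<and> d m = c (Suc i) \<and> (\<forall>j<m. W j \<subseteq> V i)"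
    by blast
  then obtain d W where dW: "\<And>i. i < k \<Longrightarrow> link_chain X e' m (d i) (W i) \<and> d i 0 = c i \<and> d i m = c (Suc i) \<and> (\<forall>j<m. W i j \<subseteq> V i)"
    by metis
  define c' where "c' j = (if j = k * m then c k else d (j div m) (j mod m))" for j
  define V' where "V' j = W (j div m) (j mod m)" for j
  have m1: "m \<ge> 1" unfolding m_def by simp
  have k1: "k \<ge> 1" using ch unfolding link_chain_def by simp
  have inner: "j div m < k \<and> j mod m < m" if "j < k * m" for j
    using that m1 by (simp add: less_mult_imp_div_less)
  have next_pt: "c' (Suc j) = d (j div m) (Suc (j mod m))" if j: "j < k * m" for j
  proof (cases "Suc (j mod m) = m")
    case True
    have eq: "Suc j = Suc (j div m) * m" using True div_mult_mod_eq[of j m] by (metis add_Suc_right add.commute mult_Suc)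
    show ?thesis
    proof (cases "Suc (j div m) = k")
      case True2: True
      then show ?thesis unfolding c'_def using eq True dW[of "j div m"] inner[OF j] by simp
    next
      case False
      then have lt: "Suc (j div m) < k" using inner[OF j] by linarith
      have ne: "Suc j \<noteq> k * m" using eq lt m1 by (metis mult_right_cancel not_one_le_zero nat_neq_iff)
      have "Suc j div m = Suc (j div m)" "Suc j mod m = 0" using eq m1 by (simp_all only: eq) auto
      then show ?thesis unfolding c'_def using ne True dW[of "j div m"] dW[OF lt] inner[OF j] by simp
    qed
  next
    case False
    then have "Suc j mod m = Suc (j mod m)" "Suc j div m = j div m" by (auto simp: mod_Suc div_Suc)
    moreover have "Suc j \<noteq> k * m" using False \<open>Suc j mod m = Suc (j mod m)\<close> by auto
    ultimately show ?thesis unfolding c'_def by simp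
  qed
  have "link_chain X e' (k * m) c' V'"
    unfolding link_chain_def
  proof (intro conjI allI impI)
    show "1 \<le> k * m" using k1 m1 by (metis mult_le_mono mult_1)
  next
    fix j assume j: "j < k * m"
    note L = dW[of "j div m", unfolded link_chain_def] inner[OF j]
    show "openin (top_of_set X) (V' j)" "connected (V' j)" "\<forall>a\<in>V' j. \<forall>b\<in>V' j. dist a b \<le> e'"
      unfolding V'_def using L by blast+
    show "c' j \<in> V' j" unfolding c'_def V'_def using L j by auto
    show "c' (Suc j) \<in> V' j" unfolding V'_def next_pt[OF j] using L by blast
  qed
  moreover have "c' (i * m) = c i" if "i \<le> k" for i
  proof (cases "i = k")
    case False
    then have "i < k" using that by simp
    then show ?thesis using dW m1 unfolding c'_def by simp
  qed (simp add: c'_def)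
  moreover have "V' j \<subseteq> V (j div m)" if "j < k * m" for j
    unfolding V'_def using dW inner[OF that] by blast
  ultimately show ?thesis using m1 by blast
qed

text \<open>
  The path is the uniform limit of the step functions with value \<open>c n i\<close> on the \<open>i\<close>-th interval of
  length \<open>1 / k n\<close>. It is continuous because neighbouring values at stage \<open>n\<close> lie in a common
  link. Limits exist as \<open>X\<close> is compact, and they may leave \<open>U\<close> only into its closure.
\<close>

lemma path_in_closure:
  fixes X :: "'a::metric_space set"
  assumes cX: "compact X" and lc: "locally connected X" and U: "openin (top_of_set X) U" "connected U"
    and ab: "a \<in> U" "b \<in> U"
  shows "\<exists>p. path p \<and> path_image p \<subseteq> closure U \<and> p 0 = a \<and> p 1 = b"
proof -
  define P where "P n s \<longleftrightarrow> (case s of (k, c, V) \<Rightarrow> link_chain X ((1/2)^n) k c V \<and> c 0 = a \<and> c k = b \<and> (\<forall>i<k. V i \<subseteq> U))"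
    for n and s :: "nat \<times> (nat \<Rightarrow> 'a) \<times> (nat \<Rightarrow> 'a set)"
  define Q where "Q (n::nat) s s' \<longleftrightarrow> (case s of (k, c, V) \<Rightarrow> case s' of (k', c', V') \<Rightarrow>
     \<exists>m\<ge>1. k' = k * m \<and> (\<forall>i\<le>k. c' (i * m) = c i) \<and> (\<forall>j<k * m. V' j \<subseteq> V (j div m)))"
    for n and s s' :: "nat \<times> (nat \<Rightarrow> 'a) \<times> (nat \<Rightarrow> 'a set)"
  obtain m0 where "\<forall>m\<ge>m0. \<exists>c V. link_chain X 1 m c V \<and> c 0 = a \<and> c m = b \<and> (\<forall>i<m. V i \<subseteq> U)"
    using link_chain_exists[OF lc U ab, of 1] by auto
  then obtain c V where "link_chain X 1 m0 c V" "c 0 = a" "c m0 = b" "\<forall>i<m0. V i \<subseteq> U" by blast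
  then have "P 0 (m0, c, V)" unfolding P_def by auto
  then have "\<exists>s. P 0 s" by blast
  moreover have "\<exists>s'. P (Suc n) s' \<and> Q n s s'" if "P n s" for n s
  proof -
    obtain k c V where s: "s = (k, c, V)" by (cases s)
    have P: "link_chain X ((1/2)^n) k c V" "c 0 = a" "c k = b" "\<forall>i<k. V i \<subseteq> U" using that unfolding P_def s by auto
    obtain m c' V' where R: "m \<ge> 1" "link_chain X ((1/2)^Suc n) (k * m) c' V'" "\<forall>i\<le>k. c' (i * m) = c i"
      "\<forall>j<k * m. V' j \<subseteq> V (j div m)"
      using link_chain_refine[OF lc P(1), of "(1/2)^Suc n"] by auto
    have "c' 0 = a" using R(3)[rule_format, of 0] P(2) by simp
    moreover have "c' (k * m) = b" using R(3) P(3) by simp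
    moreover have "V' j \<subseteq> U" if "j < k * m" for j
      using R(4) P(4) that less_mult_imp_div_less[of j k m] by blast
    ultimately have "P (Suc n) (k * m, c', V')" using R(2) unfolding P_def by auto
    moreover have "Q n s (k * m, c', V')" unfolding Q_def s using R by auto
    ultimately show ?thesis by blast
  qed
  ultimately obtain S where S: "\<And>n. P n (S n)" "\<And>n. Q n (S n) (S (Suc n))"
    using dependent_nat_choice[of P Q] by metis
  define k where "k n = fst (S n)" for n
  define c where "c n = fst (snd (S n))" for n
  define V where "V n = snd (snd (S n))" for n
  have SS: "S n = (k n, c n, V n)" for n unfolding k_def c_def V_def by simp
  have ch: "link_chain X ((1/2)^n) (k n) (c n) (V n)" and c0: "c n 0 = a" and ck: "c n (k n) = b"
    and VU: "\<And>i. i < k n \<Longrightarrow> V n i \<subseteq> U" for n using S(1)[of n] unfolding P_def SS by auto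
  have k1: "k n \<ge> 1" for n using ch unfolding link_chain_def by blast
  have VL: "c n i \<in> V n i" "c n (Suc i) \<in> V n i" "\<forall>u\<in>V n i. \<forall>v\<in>V n i. dist u v \<le> (1/2)^n" if "i < k n" for n i
    using ch[of n] that unfolding link_chain_def by auto
  define h where "h n t = c n (nat \<lfloor>t * real (k n)\<rfloor>)" for n and t :: real
  have idx: "nat \<lfloor>t * real (k n)\<rfloor> < k n" if "0 \<le> t" "t < 1" for n t
  proof -
    have "t * real (k n) < real (k n)" using that k1[of n] by simp
    then show ?thesis using that k1[of n] by linarith
  qed
  have h1: "h n 1 = b" and h0: "h n 0 = a" for n unfolding h_def by (simp_all add: ck c0)
  have hU: "h n t \<in> U" if "t \<in> {0..1}" for n t
  proof (cases "t = 1")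
    case False
    then have "nat \<lfloor>t * real (k n)\<rfloor> < k n" using idx that by simp
    then show ?thesis using VL(1) VU unfolding h_def by blast
  qed (simp add: h1 ab)
  have step: "dist (h n t) (h (Suc n) t) \<le> (1/2)^n" if t: "t \<in> {0..1}" for n t
  proof (cases "t = 1")
    case False
    obtain m where m: "m \<ge> 1" "k (Suc n) = k n * m" "\<forall>j<k n * m. V (Suc n) j \<subseteq> V n (j div m)"
      using S(2)[of n] unfolding Q_def SS by auto
    define j where "j = nat \<lfloor>t * real (k (Suc n))\<rfloor>"
    have j: "j < k n * m" using idx[of t "Suc n"] t False m(2) unfolding j_def by auto
    have "\<lfloor>t * real (k n)\<rfloor> = \<lfloor>(t * real (k (Suc n))) / real_of_int (int m)\<rfloor>" using m(1,2) by simp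
    also have "\<dots> = \<lfloor>t * real (k (Suc n))\<rfloor> div int m" by (rule floor_divide_real_eq_div) simp
    finally have "nat \<lfloor>t * real (k n)\<rfloor> = j div m"
      unfolding j_def using t by (simp add: nat_div_distrib)
    then have "h n t = c n (j div m)" "h (Suc n) t = c (Suc n) j" unfolding h_def j_def by simp_all
    moreover have "c (Suc n) j \<in> V n (j div m)" using VL(1)[of j "Suc n"] j m by auto
    moreover have "j div m < k n" using j by (rule less_mult_imp_div_less)
    ultimately show ?thesis using VL[of "j div m" n] by auto
  qed (simp add: h1)
  have osc: "dist (h n s) (h n t) \<le> (1/2)^n" if st: "s \<in> {0..1}" "t \<in> {0..1}" "s \<le> t" "t - s < 1 / real (k n)" for n s t
  proof -
    have "(t - s) * real (k n) < 1" using st(4) k1[of n] by (simp add: field_simps)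
    then have lt: "t * real (k n) < s * real (k n) + 1" by (simp add: algebra_simps)
    have le: "s * real (k n) \<le> t * real (k n)" using st(3) by (simp add: mult_right_mono)
    have s0: "0 \<le> s * real (k n)" using st by simp
    consider "nat \<lfloor>t * real (k n)\<rfloor> = nat \<lfloor>s * real (k n)\<rfloor>" | "nat \<lfloor>t * real (k n)\<rfloor> = Suc (nat \<lfloor>s * real (k n)\<rfloor>)"
      using lt le s0 by linarith
    then show ?thesis
    proof cases
      case 2
      have "s < 1" using 2 st by (cases "s = 1") auto
      then have "nat \<lfloor>s * real (k n)\<rfloor> < k n" using idx st by simp
      from VL[OF this] show ?thesis unfolding h_def 2 by blast
    qed (simp add: h_def)
  qed
  have cau: "dist (h n t) (h (n + p) t) \<le> 2 * (1/2)^n - 2 * (1/2)^(n + p)" if t: "t \<in> {0..1}" for n p t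
  proof (induction p)
    case (Suc p)
    have "dist (h n t) (h (n + Suc p) t) \<le> dist (h n t) (h (n + p) t) + dist (h (n + p) t) (h (Suc (n + p)) t)"
      using dist_triangle[of "h n t" "h (n + Suc p) t" "h (n + p) t"] by simp
    also have "\<dots> \<le> (2 * (1/2)^n - 2 * (1/2)^(n + p)) + (1/2)^(n + p)" using Suc step[OF t] by (intro add_mono) auto
    finally show ?case by simp
  qed simp
  have "\<exists>l. (\<lambda>n. h n t) \<longlonglongrightarrow> l" if t: "t \<in> {0..1}" for t
  proof -
    have "Cauchy (\<lambda>n. h n t)"
    proof (rule metric_CauchyI)
      fix e :: real assume "e > 0"
      then obtain N where N: "(1/2)^N < e / 4" using real_arch_pow_inv[of "e/4" "1/2"] by auto
      have half: "dist (h N t) (h n t) < e / 2" if nN: "n \<ge> N" for n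
      proof -
        obtain p where p: "n = N + p" using nN le_iff_add by blast
        have "(0::real) \<le> (1/2)^(N + p)" by simp
        then show ?thesis using cau[OF t, of N p] N unfolding p by linarith
      qed
      show "\<exists>M. \<forall>m\<ge>M. \<forall>n\<ge>M. dist (h m t) (h n t) < e"
        using half dist_triangle_half_r by blast
    qed
    moreover have "\<forall>n. h n t \<in> X" using hU[OF t] openin_imp_subset[OF U(1)] by blast
    ultimately show ?thesis using compact_imp_complete[OF cX] unfolding complete_def by meson
  qed
  then obtain l where l: "\<And>t. t \<in> {0..1} \<Longrightarrow> (\<lambda>n. h n t) \<longlonglongrightarrow> l t" by metis
  have lim_dist: "dist (h n t) (l t) \<le> 2 * (1/2)^n" if t: "t \<in> {0..1}" for n t
  proof (rule LIMSEQ_le_const2)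
    show "(\<lambda>m. dist (h n t) (h m t)) \<longlonglongrightarrow> dist (h n t) (l t)" by (intro tendsto_intros l t)
    have "dist (h n t) (h m t) \<le> 2 * (1/2)^n" if mn: "m \<ge> n" for m
    proof -
      obtain p where p: "m = n + p" using mn le_iff_add by blast
      have "(0::real) \<le> (1/2)^(n + p)" by simp
      then show ?thesis using cau[OF t, of n p] unfolding p by linarith
    qed
    then show "\<exists>N. \<forall>m\<ge>N. dist (h n t) (h m t) \<le> 2 * (1/2)^n" by blast
  qed
  have close: "dist (l s) (l t) \<le> 5 * (1/2)^n" if st: "s \<in> {0..1}" "t \<in> {0..1}" "s \<le> t" "t - s < 1 / real (k n)" for n s t
  proof -
    have "dist (l s) (l t) \<le> dist (h n s) (l s) + dist (h n s) (h n t) + dist (h n t) (l t)"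
      using dist_triangle[of "l s" "l t" "h n s"] dist_triangle[of "h n s" "l t" "h n t"] by (simp add: dist_commute)
    then show ?thesis using lim_dist[OF st(1), of n] lim_dist[OF st(2), of n] osc[OF st] by linarith
  qed
  have "continuous_on {0..1} l"
  proof (rule continuous_onI)
    fix s e :: real assume s: "s \<in> {0..1}" and "e > 0"
    then obtain n where n: "(1/2)^n < e / 6" using real_arch_pow_inv[of "e/6" "1/2"] by auto
    have en: "5 * (1/2)^n \<le> e" using n zero_le_power[of "1/2::real" n] by linarith
    have "dist (l t) (l s) \<le> e" if t: "t \<in> {0..1}" "dist t s < 1 / real (k n)" for t
    proof (cases "s \<le> t")
      case True
      then show ?thesis using close[OF s t(1) True, of n] t en dist_commute[of "l s" "l t"] by (simp add: dist_real_def)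
    next
      case False
      then show ?thesis using close[OF t(1) s, of n] t en by (simp add: dist_real_def)
    qed
    moreover have "1 / real (k n) > 0" using k1[of n] by simp
    ultimately show "\<exists>d>0. \<forall>t\<in>{0..1}. dist t s < d \<longrightarrow> dist (l t) (l s) \<le> e" by blast
  qed
  then have "path l" by (simp add: path_def)
  moreover have "path_image l \<subseteq> closure U"
  proof
    fix y assume "y \<in> path_image l"
    then obtain t where t: "t \<in> {0..1}" "y = l t" unfolding path_image_def by blast
    then have "(\<forall>n. h n t \<in> U) \<and> (\<lambda>n. h n t) \<longlonglongrightarrow> y" using l hU by blast
    then show "y \<in> closure U" unfolding closure_sequential by (rule exI[of _ "\<lambda>n. h n t"])
  qed
  moreover have "l 0 = a" using LIMSEQ_unique[OF l[of 0]] h0 by simp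
  moreover have "l 1 = b" using LIMSEQ_unique[OF l[of 1]] h1 by simp
  ultimately show ?thesis by blast
qed

lemma openin_closure_inside:
  fixes X :: "'a::metric_space set"
  assumes lc: "locally connected X" and U: "openin (top_of_set X) U" "a \<in> U" and cX: "closed X" and "e > 0"
  shows "\<exists>W. openin (top_of_set X) W \<and> connected W \<and> a \<in> W \<and> closure W \<subseteq> U \<and> W \<subseteq> ball a e"
proof -
  obtain T where T: "open T" "U = X \<inter> T" using U(1) by (auto simp: openin_open)
  then obtain d where d: "d > 0" "cball a d \<subseteq> T" using U(2) open_contains_cball by blast
  define r where "r = min d e"
  have "openin (top_of_set X) (U \<inter> ball a r)" by (rule openin_self_inter_ball[OF U(1)])
  moreover have "a \<in> U \<inter> ball a r" using U d \<open>e > 0\<close> by (simp add: r_def)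
  ultimately obtain W where W: "openin (top_of_set X) W" "connected W" "a \<in> W" "W \<subseteq> U \<inter> ball a r"
    using lc unfolding locally_connected by meson
  have "closure W \<subseteq> X \<inter> cball a d"
    using W(4) T(2) cX by (intro closure_minimal closed_Int) (auto simp: r_def)
  then show ?thesis using W d T by (intro exI[of _ W]) (auto simp: r_def)
qed

text \<open>
  Being joined by a path is an equivalence relation with open classes, so the path can be
  kept inside \<open>M\<close> by using small neighbourhoods with closure in \<open>M\<close>.
\<close>

lemma path_in_open_connected:
  fixes X :: "'a::metric_space set"
  assumes cX: "compact X" and lc: "locally connected X" and M: "openin (top_of_set X) M" "connected M"
    and ab: "a \<in> M" "b \<in> M"
  shows "\<exists>p. path p \<and> path_image p \<subseteq> M \<and> pathstart p = a \<and> pathfinish p = b"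
proof (rule connected_equivalence_relation[OF M(2) ab])
  let ?R = "\<lambda>u v. \<exists>p. path p \<and> path_image p \<subseteq> M \<and> pathstart p = u \<and> pathfinish p = v"
  show "?R y x" if "?R x y" for x y
    using that by (metis path_image_reversepath path_reversepath pathfinish_reversepath pathstart_reversepath)
  show "?R x z" if "?R x y" "?R y z" for x y z
    using that by (metis path_join_imp pathfinish_join pathstart_join subset_path_image_join)
  show "\<exists>T. openin (top_of_set M) T \<and> a \<in> T \<and> (\<forall>x\<in>T. ?R a x)" if a: "a \<in> M" for a
  proof -
    obtain W where W: "openin (top_of_set X) W" "connected W" "a \<in> W" "closure W \<subseteq> M"
      using openin_closure_inside[OF lc M(1) a compact_imp_closed[OF cX], of 1] by auto
    have "openin (top_of_set M) W"
      using W openin_imp_subset[OF M(1)] closure_subset by (meson openin_subset_trans order_trans)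
    moreover have "?R a x" if "x \<in> W" for x
      using path_in_closure[OF cX lc W(1,2,3) that] W(4) unfolding pathstart_def pathfinish_def by blast
    ultimately show ?thesis using W(3) by blast
  qed
qed

text \<open>
  The isometric Kuratowski embedding into a Banach space. It transports the theorem that every path
  contains an arc, which is known in complete normed spaces, to metric spaces.
\<close>

definition kuratowski :: "'a::metric_space \<Rightarrow> 'a \<Rightarrow> 'a \<Rightarrow>\<^sub>C real" where
  "kuratowski x0 x = Bcontfun (\<lambda>z. dist x z - dist x0 z)"

lemma apply_kuratowski: "apply_bcontfun (kuratowski x0 x) = (\<lambda>z. dist x z - dist x0 z)"
proof -
  have "\<bar>dist x z - dist x0 z\<bar> \<le> dist x x0" for z
    by (metis abs_dist_diff_le dist_commute)
  then have "bounded (range (\<lambda>z. dist x z - dist x0 z))"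
    unfolding bounded_iff by auto
  then have "(\<lambda>z. dist x z - dist x0 z) \<in> bcontfun"
    unfolding bcontfun_def by (auto intro!: continuous_intros)
  then show ?thesis unfolding kuratowski_def by (simp add: Bcontfun_inverse)
qed

lemma dist_kuratowski: "dist (kuratowski x0 x) (kuratowski x0 y) = dist x y"
proof (rule antisym)
  show "dist (kuratowski x0 x) (kuratowski x0 y) \<le> dist x y"
    by (rule dist_bound) (simp add: apply_kuratowski dist_real_def, metis abs_dist_diff_le dist_commute)
  have "dist (kuratowski x0 x y) (kuratowski x0 y y) \<le> dist (kuratowski x0 x) (kuratowski x0 y)"
    by (rule dist_bounded)
  then show "dist x y \<le> dist (kuratowski x0 x) (kuratowski x0 y)"
    by (simp add: apply_kuratowski dist_real_def)
qed

lemma path_contains_arc_in_metric_space: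
  fixes p :: "real \<Rightarrow> 'a::metric_space"
  assumes "path p" "pathstart p = a" "pathfinish p = b" "a \<noteq> b"
  shows "\<exists>q. arc q \<and> path_image q \<subseteq> path_image p \<and> pathstart q = a \<and> pathfinish q = b"
proof -
  let ?e = "kuratowski a"
  have inj: "inj ?e" using dist_kuratowski by (metis dist_eq_0_iff injI)
  have cont: "continuous_on UNIV ?e"
    by (auto simp: continuous_on_iff dist_kuratowski)
  have "path (?e \<circ> p)" using assms(1) cont continuous_on_subset path_continuous_image by blast
  then obtain q where q: "arc q" "path_image q \<subseteq> path_image (?e \<circ> p)" "pathstart q = ?e a" "pathfinish q = ?e b"
    using path_contains_arc[of "?e \<circ> p" "?e a" "?e b"] assms(2-4) inj
    by (auto simp: pathstart_compose pathfinish_compose inj_eq)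
  define r where "r t = inv ?e (q t)" for t
  have er: "?e (r t) = q t" if "t \<in> {0..1}" for t
  proof -
    have "q t \<in> path_image q" using that unfolding path_image_def by blast
    then have "q t \<in> path_image (?e \<circ> p)" using q(2) by blast
    then have "q t \<in> range ?e" unfolding path_image_def by auto
    then show ?thesis unfolding r_def by (rule f_inv_into_f)
  qed
  have "dist (r s) (r t) = dist (q s) (q t)" if "s \<in> {0..1}" "t \<in> {0..1}" for s t
    using er[OF that(1)] er[OF that(2)] dist_kuratowski by metis
  then have "continuous_on {0..1} r"
    using q(1) unfolding arc_def path_def continuous_on_iff by simp
  moreover have "inj_on r {0..1}"
    using q(1) er unfolding arc_def inj_on_def by metis
  moreover have "r t \<in> path_image p" if "t \<in> {0..1}" for t
  proof -
    have "?e (r t) \<in> ?e ` path_image p" using er[OF that] q(2) that unfolding path_image_def by fastforce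
    then show ?thesis using inj by (simp add: inj_image_mem_iff)
  qed
  moreover have "r 0 = a" "r 1 = b" using q(3,4) inj unfolding r_def pathstart_def pathfinish_def by simp_all
  ultimately show ?thesis unfolding arc_def path_def path_image_def pathstart_def pathfinish_def by blast
qed

lemma arc_in_open_connected:
  fixes X :: "'a::metric_space set"
  assumes "compact X" "locally connected X" "openin (top_of_set X) M" "connected M" "a \<in> M" "b \<in> M" "a \<noteq> b"
  shows "\<exists>q. arc q \<and> path_image q \<subseteq> M \<and> pathstart q = a \<and> pathfinish q = b"
proof -
  obtain p where p: "path p" "path_image p \<subseteq> M" "pathstart p = a" "pathfinish p = b"
    using path_in_open_connected[OF assms(1-6)] by blast
  obtain q where "arc q" "path_image q \<subseteq> path_image p" "pathstart q = a" "pathfinish q = b"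
    using path_contains_arc_in_metric_space[OF p(1,3,4) assms(7)] by blast
  then show ?thesis using p(2) by blast
qed

section \<open>Dendrites\<close>

text \<open>
  The factor \<open>v - u\<close> may be negative, in which case the piece of the arc is run through backwards.
\<close>

lemma affine_reparametrization_arc:
  fixes g :: "real \<Rightarrow> 'a::metric_space"
  assumes "arc g" "u \<in> {0..1}" "v \<in> {0..1}" "u \<noteq> v"
  shows "arc (\<lambda>x. g (u + (v - u) * x))" 
    and "path_image (\<lambda>x. g (u + (v - u) * x)) = g ` closed_segment u v"
proof -
  have seg: "(\<lambda>x. u + (v - u) * x) ` {0..1} = closed_segment u v"
    by (simp add: closed_segment_real_eq image_def algebra_simps)
  then have sub: "(\<lambda>x. u + (v - u) * x) ` {0..1} \<subseteq> {0..1}"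
    using assms(2,3) closed_segment_subset[OF assms(2,3)] by simp
  have eq: "(\<lambda>x. g (u + (v - u) * x)) = g \<circ> (\<lambda>x. u + (v - u) * x)" by auto
  have "continuous_on {0..1} (g \<circ> (\<lambda>x. u + (v - u) * x))"
    using assms(1) sub unfolding arc_def path_def
    by (intro continuous_on_compose continuous_intros) (auto intro: continuous_on_subset)
  moreover have "inj_on (g \<circ> (\<lambda>x. u + (v - u) * x)) {0..1}"
  proof (rule comp_inj_on)
    show "inj_on (\<lambda>x. u + (v - u) * x) {0..1}" using assms(4) by (intro inj_onI) simp
    show "inj_on g ((\<lambda>x. u + (v - u) * x) ` {0..1})"
      using assms(1) sub unfolding arc_def by (blast intro: inj_on_subset)
  qed
  ultimately show "arc (\<lambda>x. g (u + (v - u) * x))" unfolding arc_def path_def eq by blast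
  show "path_image (\<lambda>x. g (u + (v - u) * x)) = g ` closed_segment u v"
    unfolding path_image_def seg[symmetric] image_image ..
qed

text \<open>
  The piece of the first arc around \<open>z\<close> between its nearest points on the second arc meets
  the second arc only in its ends; it is closed up by the piece of the second arc between these ends.
\<close>

lemma two_arcs_simple_closed_curve:
  fixes \<alpha> \<beta> :: "real \<Rightarrow> 'a::metric_space"
  assumes a: "arc \<alpha>" and b: "arc \<beta>" and ends: "pathstart \<alpha> = pathstart \<beta>" "pathfinish \<alpha> = pathfinish \<beta>"
    and z: "z \<in> path_image \<alpha>" "z \<notin> path_image \<beta>"
  shows "\<exists>C. C \<subseteq> path_image \<alpha> \<union> path_image \<beta> \<and> simple_closed_curve C"
proof -
  define S where "S = {t \<in> {0..1}. \<alpha> t \<in> path_image \<beta>}"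
  have cont: "continuous_on {0..1} \<alpha>" using a by (simp add: arc_def path_def)
  have cb: "closed (path_image \<beta>)" using b by (simp add: arc_imp_path closed_path_image)
  have "closed ({0..1} \<inter> \<alpha> -` path_image \<beta>)"
    using continuous_on_closed_vimage[of "{0..1}" \<alpha>] cont cb by (metis Int_commute closed_real_atLeastAtMost)
  then have clS: "closed S" unfolding S_def by (simp add: vimage_def Int_def)
  have injA: "inj_on \<alpha> {0..1}" using a by (simp add: arc_def)
  obtain t0 where t0: "t0 \<in> {0..1}" "\<alpha> t0 = z" using z(1) unfolding path_image_def by blast
  have "0 \<in> S" "1 \<in> S" unfolding S_def using ends
    by (simp_all add: pathstart_def pathfinish_def path_image_def)
  have t0S: "t0 \<notin> S" unfolding S_def using t0 z by auto
  define A where "A = S \<inter> {..t0}" 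
  define B where "B = S \<inter> {t0..}"
  have "closed A" "closed B" unfolding A_def B_def using clS by auto
  have A0: "0 \<in> A" and B1: "1 \<in> B" using \<open>0 \<in> S\<close> \<open>1 \<in> S\<close> t0 unfolding A_def B_def by auto
  have bA: "bdd_above A" and bB: "bdd_below B" unfolding A_def B_def by auto
  define t1 where "t1 = Sup A"
  define t2 where "t2 = Inf B"
  have t1: "t1 \<in> A" unfolding t1_def using closed_contains_Sup[OF _ bA \<open>closed A\<close>] A0 by blast
  have t2: "t2 \<in> B" unfolding t2_def using closed_contains_Inf[OF _ bB \<open>closed B\<close>] B1 by blast
  have t12: "t1 < t0" "t0 < t2" using t1 t2 t0S unfolding A_def B_def by (auto simp: less_le)
  have t01: "t1 \<in> {0..1}" "t2 \<in> {0..1}" using t1 t2 unfolding A_def B_def S_def by auto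
  have gap: "t = t1 \<or> t = t2" if "t \<in> S" "t1 \<le> t" "t \<le> t2" for t
  proof (cases "t \<le> t0")
    case True
    then have "t \<le> t1" unfolding t1_def using that bA by (intro cSup_upper) (auto simp: A_def)
    then show ?thesis using that by simp
  next
    case False
    then have "t2 \<le> t" unfolding t2_def using that bB by (intro cInf_lower) (auto simp: B_def)
    then show ?thesis using that by simp
  qed
  have "\<alpha> t1 \<in> path_image \<beta>" "\<alpha> t2 \<in> path_image \<beta>" using t1 t2 unfolding A_def B_def S_def by auto
  then obtain s1 s2 where s: "s1 \<in> {0..1}" "\<beta> s1 = \<alpha> t1" "s2 \<in> {0..1}" "\<beta> s2 = \<alpha> t2"
    unfolding path_image_def by force
  have "\<alpha> t1 \<noteq> \<alpha> t2" using injA t01 t12 by (auto dest: inj_onD)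
  then have s12: "s2 \<noteq> s1" using s by auto
  have t12': "t1 \<noteq> t2" using t12 by simp
  define \<alpha>' where "\<alpha>' = (\<lambda>x. \<alpha> (t1 + (t2 - t1) * x))"
  define \<beta>' where "\<beta>' = (\<lambda>x. \<beta> (s2 + (s1 - s2) * x))"
  note A' = affine_reparametrization_arc[OF a t01 t12', folded \<alpha>'_def]
  note B' = affine_reparametrization_arc[OF b s(3,1) s12, folded \<beta>'_def]
  have e: "pathstart \<alpha>' = \<alpha> t1" "pathfinish \<alpha>' = \<alpha> t2" "pathstart \<beta>' = \<alpha> t2" "pathfinish \<beta>' = \<alpha> t1"
    unfolding pathstart_def pathfinish_def \<alpha>'_def \<beta>'_def using s by simp_all
  have subB: "path_image \<beta>' \<subseteq> path_image \<beta>" 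
    unfolding B'(2) unfolding path_image_def using s(1,3) closed_segment_subset[of s2 "{0..1}" s1] by auto
  have subA: "path_image \<alpha>' \<subseteq> path_image \<alpha>" 
    unfolding A'(2) unfolding path_image_def using t01 closed_segment_subset[of t1 "{0..1}" t2] by auto
  have "path_image \<alpha>' \<inter> path_image \<beta>' \<subseteq> {pathstart \<alpha>', pathstart \<beta>'}"
  proof
    fix y assume y: "y \<in> path_image \<alpha>' \<inter> path_image \<beta>'"
    then obtain t where t: "t \<in> closed_segment t1 t2" "y = \<alpha> t" using A'(2) by blast
    then have tt: "t1 \<le> t" "t \<le> t2" using t12 by (auto simp: closed_segment_eq_real_ivl)
    moreover have "t \<in> S" unfolding S_def using y t tt t01 subB by auto
    ultimately have "t = t1 \<or> t = t2" by (intro gap)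
    then show "y \<in> {pathstart \<alpha>', pathstart \<beta>'}" using t(2) e by auto
  qed
  then have "simple_path (\<alpha>' +++ \<beta>')"
    using A'(1) B'(1) e by (intro simple_path_join_loop) auto
  then have "path_image (\<alpha>' +++ \<beta>') homeomorphic sphere (0::complex) 1"
    using e by (intro homeomorphic_simple_path_image_circle) auto
  moreover have "path_image (\<alpha>' +++ \<beta>') \<subseteq> path_image \<alpha> \<union> path_image \<beta>"
    using subA subB path_image_join_subset by blast
  ultimately show ?thesis unfolding simple_closed_curve_def by blast
qed

text \<open>
  This is the only place where the absence of simple closed curves enters. If a connected set
  joined \<open>x\<close> and \<open>y\<close> without containing the point \<open>z\<close> of the arc, then \<open>x\<close> and \<open>y\<close> would lie in one component of
  \<open>D - {z}\<close>, which contains a second arc between them.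
\<close>

lemma dendrite_least_connected_arc:
  assumes D: "dendrite D" and xy: "x \<in> D" "y \<in> D" "x \<noteq> y"
  shows "\<exists>\<gamma>. arc \<gamma> \<and> path_image \<gamma> \<subseteq> D \<and> pathstart \<gamma> = x \<and> pathfinish \<gamma> = y \<and>
     (\<forall>A. connected A \<and> A \<subseteq> D \<and> x \<in> A \<and> y \<in> A \<longrightarrow> path_image \<gamma> \<subseteq> A)"
proof -
  have cD: "compact D" "connected D" "locally connected D" and noC: "\<not> (\<exists>C\<subseteq>D. simple_closed_curve C)"
    using D unfolding dendrite_def continuum_def by auto
  obtain \<gamma> where g: "arc \<gamma>" "path_image \<gamma> \<subseteq> D" "pathstart \<gamma> = x" "pathfinish \<gamma> = y"
    using arc_in_open_connected[OF cD(1,3) _ cD(2) xy] by auto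
  have "path_image \<gamma> \<subseteq> A" if A: "connected A" "A \<subseteq> D" "x \<in> A" "y \<in> A" for A
  proof
    fix z assume z: "z \<in> path_image \<gamma>"
    show "z \<in> A"
    proof (rule ccontr)
      assume zA: "z \<notin> A"
      define U where "U = connected_component_set (D - {z}) x"
      have oU: "openin (top_of_set D) U"
        unfolding U_def by (intro openin_component cD openin_Diff_point) auto
      have "A \<subseteq> U" unfolding U_def using A zA by (intro connected_component_maximal) auto
      then have "x \<in> U" "y \<in> U" using A by auto
      then obtain \<delta> where d: "arc \<delta>" "path_image \<delta> \<subseteq> U" "pathstart \<delta> = x" "pathfinish \<delta> = y"
        using arc_in_open_connected[OF cD(1,3) oU _ _ _ xy(3)] unfolding U_def by auto
      have UD: "U \<subseteq> D - {z}" unfolding U_def by (rule connected_component_subset)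
      then have "\<exists>C. C \<subseteq> path_image \<gamma> \<union> path_image \<delta> \<and> simple_closed_curve C"
        using d g z by (intro two_arcs_simple_closed_curve[OF g(1) d(1)]) auto
      then show False using noC g(2) d(2) UD by blast
    qed
  qed
  then show ?thesis using g by blast
qed

text \<open>
  With two points, both sets contain the least arc between them, hence so does the intersection.
\<close>

lemma dendrite_connected_Int:
  assumes D: "dendrite D" and A: "connected A" "A \<subseteq> D" and B: "connected B" "B \<subseteq> D"
  shows "connected (A \<inter> B)"
proof -
  have "connected_component (A \<inter> B) x y" if xy: "x \<in> A \<inter> B" "y \<in> A \<inter> B" for x y
  proof (cases "x = y")
    case False
    obtain \<gamma> where g: "arc \<gamma>" "pathstart \<gamma> = x" "pathfinish \<gamma> = y"
      "\<forall>A. connected A \<and> A \<subseteq> D \<and> x \<in> A \<and> y \<in> A \<longrightarrow> path_image \<gamma> \<subseteq> A"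
      using dendrite_least_connected_arc[OF D _ _ False] xy A B by auto
    have "path_image \<gamma> \<subseteq> A \<inter> B" using g(4) A B xy by blast
    moreover have "connected (path_image \<gamma>)" using g(1) by (simp add: arc_imp_path connected_path_image)
    moreover have "x \<in> path_image \<gamma>" "y \<in> path_image \<gamma>" using g(2,3) by auto
    ultimately show ?thesis unfolding connected_component_def by blast
  qed (use xy in simp)
  then show ?thesis by (simp add: connected_iff_connected_component)
qed

section \<open>Small neighbourhoods with finite boundary\<close>

abbreviation bdry :: "'a::metric_space set \<Rightarrow> 'a set" where
  "bdry U \<equiv> closure U - U"

definition side :: "'a::metric_space set \<Rightarrow> 'a \<Rightarrow> 'a \<Rightarrow> 'a set" where
  "side D c a = connected_component_set (D - {c}) a"

lemma side_subset: "side D c a \<subseteq> D - {c}"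
  unfolding side_def by (rule connected_component_subset)

lemma connected_side: "connected (side D c a)"
  unfolding side_def by (rule connected_connected_component)

lemma side_self: "a \<in> D \<Longrightarrow> a \<noteq> c \<Longrightarrow> a \<in> side D c a"
  unfolding side_def by simp

lemma side_maximal: "connected A \<Longrightarrow> A \<subseteq> D \<Longrightarrow> c \<notin> A \<Longrightarrow> a \<in> A \<Longrightarrow> A \<subseteq> side D c a"
  unfolding side_def by (intro connected_component_maximal) auto

lemma side_eq: "b \<in> side D c a \<Longrightarrow> side D c b = side D c a"
  unfolding side_def by (metis connected_component_eq)

lemma side_subset_side: "connected A \<Longrightarrow> A \<subseteq> D \<Longrightarrow> c \<notin> A \<Longrightarrow> A \<inter> side D c a \<noteq> {} \<Longrightarrow> A \<subseteq> side D c a"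
  unfolding side_def by (intro component_disjoint_or_subset) auto

lemma openin_side: "locally connected D \<Longrightarrow> openin (top_of_set D) (side D c a)"
  unfolding side_def by (intro openin_component openin_Diff_point) auto

lemma closure_side: 
  assumes "closed D" shows "closure (side D c a) \<subseteq> insert c (side D c a)"
proof -
  have "closure (side D c a) \<subseteq> D" using side_subset[of D c a] assms by (intro closure_minimal) auto
  then show ?thesis using closure_component_Int[of "D - {c}" a] unfolding side_def by blast
qed

lemma apex_in_closure_side:
  assumes "connected D" "locally connected D" "c \<in> D" "a \<in> D" "a \<noteq> c"
  shows "c \<in> closure (side D c a)"
proof -
  have "D \<inter> bdry (side D c a) \<noteq> {}"
    using assms side_self[of a D c] side_subset[of D c a]
    by (intro connected_meets_boundary[of D D] openin_side) auto
  then show ?thesis using closure_component_Int[of "D - {c}" a] unfolding side_def by blast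
qed

lemma dendriteD:
  assumes "dendrite D"
  shows "compact D" "connected D" "locally connected D" "D \<noteq> {}" "closed D"
  using assms unfolding dendrite_def continuum_def by (auto simp: compact_imp_closed)

text \<open>
  Finitely many separating points \<open>z\<close> suffice, by compactness, to split \<open>x\<close> from everything at distance at least
  \<open>e\<close>; the intersection of the sides of \<open>x\<close> has its boundary among these points. The set \<open>Z\<close> keeps track
  of which points are used: all points for the linear bound, the periodic ones for the uniform bound.
\<close>

lemma dendrite_small_neighbourhood:
  assumes D: "dendrite D" and x: "x \<in> D" and "e > 0"
    and sep: "\<And>y. y \<in> D \<Longrightarrow> y \<noteq> x \<Longrightarrow> \<exists>z\<in>Z. z \<in> D \<and> z \<noteq> x \<and> z \<noteq> y \<and> y \<notin> side D z x"
  shows "\<exists>V. openin (top_of_set D) V \<and> x \<in> V \<and> V \<subseteq> ball x e \<and> finite (bdry V) \<and> bdry V \<subseteq> Z"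
proof -
  note d = dendriteD[OF D]
  have "\<forall>y\<in>D - ball x e. \<exists>z\<in>Z. z \<in> D \<and> z \<noteq> x \<and> z \<noteq> y \<and> y \<notin> side D z x"
    using sep \<open>e > 0\<close> by (metis DiffE centre_in_ball)
  then obtain z where z: "\<And>y. y \<in> D - ball x e \<Longrightarrow> z y \<in> Z \<and> z y \<in> D \<and> z y \<noteq> x \<and> z y \<noteq> y \<and> y \<notin> side D (z y) x"
    by metis
  have "\<forall>y. \<exists>T. open T \<and> side D (z y) y = D \<inter> T" using openin_side[OF d(3)] by (auto simp: openin_open)
  then obtain T where T: "\<And>y. open (T y)" "\<And>y. side D (z y) y = D \<inter> T y" by metis
  have "compact (D - ball x e)" using d(1) by (simp add: compact_diff)
  moreover have "y \<in> T y" if y: "y \<in> D - ball x e" for y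
  proof -
    have "y \<in> D" "z y \<noteq> y" using z[OF y] y by blast+
    then have "y \<in> side D (z y) y" by (intro side_self) auto
    then show ?thesis unfolding T(2) by blast
  qed
  then have "D - ball x e \<subseteq> (\<Union>y\<in>D - ball x e. T y)" by blast
  ultimately obtain K where K: "K \<subseteq> D - ball x e" "finite K" "D - ball x e \<subseteq> (\<Union>y\<in>K. T y)"
    using compactE_image[of "D - ball x e" "D - ball x e" T] T(1) by metis
  define V where "V = (\<Inter>y\<in>K. side D (z y) x) \<inter> D"
  have "openin (top_of_set D) V"
    unfolding V_def using openin_INT[OF K(2), of "top_of_set D" "\<lambda>y. side D (z y) x"] openin_side[OF d(3)] by simp
  moreover have "x \<in> V"
  proof -
    have "x \<in> side D (z y) x" if "y \<in> K" for y using z[of y] K(1) that x by (intro side_self) auto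
    then show ?thesis unfolding V_def using x by blast
  qed
  moreover have "V \<subseteq> ball x e"
  proof (rule ccontr)
    assume "\<not> V \<subseteq> ball x e"
    then obtain w where w: "w \<in> V" "w \<notin> ball x e" by blast
    then have "w \<in> D - ball x e" unfolding V_def by blast
    then obtain y where y: "y \<in> K" "w \<in> side D (z y) y" using K(3) T(2) by blast
    then have "w \<in> side D (z y) x" using w unfolding V_def by blast
    then have eq: "side D (z y) x = side D (z y) y" using side_eq y(2) by metis
    have yD: "y \<in> D - ball x e" using y(1) K(1) by blast
    then have "y \<in> D" "z y \<noteq> y" using z by blast+
    then have "y \<in> side D (z y) y" by (intro side_self) auto
    then show False using z[OF yD] eq by simp
  qed
  moreover have "bdry V \<subseteq> z ` K"
  proof
    fix w assume w: "w \<in> bdry V"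
    then have "w \<in> D" using closure_minimal[of V D] d(5) unfolding V_def by blast
    then obtain y where y: "y \<in> K" "w \<notin> side D (z y) x" using w unfolding V_def by blast
    have "w \<in> closure (side D (z y) x)"
      using w y(1) closure_mono[of V "side D (z y) x"] unfolding V_def by blast
    then show "w \<in> z ` K" using closure_side[OF d(5)] y by blast
  qed
  moreover have "z ` K \<subseteq> Z" using z K(1) by blast
  ultimately show ?thesis using K(2) by (meson finite_imageI finite_subset order_trans)
qed

lemma arc_interior_separates:
  assumes "\<forall>A. connected A \<and> A \<subseteq> D \<and> x \<in> A \<and> y \<in> A \<longrightarrow> path_image \<gamma> \<subseteq> A"
    and "z \<in> path_image \<gamma>" "z \<noteq> x" "x \<in> D"
  shows "y \<notin> side D z x"
  using assms connected_side[of D z x] side_subset[of D z x] side_self[of x D z] by blast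

lemma local_small_neighbourhood:
  assumes D: "dendrite D" "D \<subseteq> X" and O': "openin (top_of_set X) O'" "x \<in> O'" "O' \<subseteq> D" and "e > 0"
    and sep: "\<And>y. y \<in> D \<Longrightarrow> y \<noteq> x \<Longrightarrow> \<exists>z\<in>Z. z \<in> D \<and> z \<noteq> x \<and> z \<noteq> y \<and> y \<notin> side D z x"
  shows "\<exists>V. openin (top_of_set X) V \<and> x \<in> V \<and> closure V \<subseteq> O' \<and> V \<subseteq> ball x e \<and> finite (bdry V) \<and> bdry V \<subseteq> Z"
proof -
  obtain T where T: "open T" "O' = X \<inter> T" using O'(1) by (auto simp: openin_open)
  then obtain d where d: "d > 0" "cball x d \<subseteq> T" using O'(2) open_contains_cball by blast
  define r where "r = min d e"
  have "r > 0" unfolding r_def using d \<open>e > 0\<close> by simp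
  obtain V where V: "openin (top_of_set D) V" "x \<in> V" "V \<subseteq> ball x r" "finite (bdry V)" "bdry V \<subseteq> Z"
    using dendrite_small_neighbourhood[OF D(1) _ \<open>r > 0\<close> sep] O' by blast
  have VD: "V \<subseteq> D" using V(1) openin_imp_subset by blast
  have "V \<subseteq> cball x d" using V(3) unfolding r_def by auto
  then have "closure V \<subseteq> D \<inter> cball x d" 
    using dendriteD(5)[OF D(1)] VD by (intro closure_minimal closed_Int) auto
  then have cV: "closure V \<subseteq> O'" using d(2) D(2) T(2) by blast
  then have "V \<subseteq> O'" using closure_subset by blast
  then have "openin (top_of_set O') V" using V(1) O'(3) by (blast intro: openin_subset_trans)
  then have "openin (top_of_set X) V" using O'(1) openin_trans by blast
  then show ?thesis using V cV unfolding r_def by (intro exI[of _ V]) auto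
qed

lemma local_dendrite_chart:
  assumes "local_dendrite X" "x \<in> X"
  shows "\<exists>D O'. dendrite D \<and> D \<subseteq> X \<and> openin (top_of_set X) O' \<and> x \<in> O' \<and> O' \<subseteq> D"
  using assms unfolding local_dendrite_def neighbourhood_in_def by blast

lemma local_dendriteD:
  assumes "local_dendrite X"
  shows "compact X" "connected X" "X \<noteq> {}" "closed X" "locally connected X"
proof -
  show "compact X" "connected X" "X \<noteq> {}" "closed X"
    using assms unfolding local_dendrite_def continuum_def by (auto simp: compact_imp_closed)
  show "locally connected X"
    unfolding locally_connected
  proof (intro allI impI)
    fix v x assume vx: "openin (top_of_set X) v \<and> x \<in> v"
    then have "x \<in> X" using openin_imp_subset by blast
    then obtain D O' where D: "dendrite D" "D \<subseteq> X" "openin (top_of_set X) O'" "x \<in> O'" "O' \<subseteq> D"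
      using local_dendrite_chart[OF assms] by blast
    have o: "openin (top_of_set X) (v \<inter> O')" using vx D(3) by blast
    then have "openin (top_of_set D) (v \<inter> O')" using D(2,5) by (blast intro: openin_subset_trans)
    then obtain u where u: "openin (top_of_set D) u" "connected u" "x \<in> u" "u \<subseteq> v \<inter> O'"
      using dendriteD(3)[OF D(1)] vx D(4) unfolding locally_connected by (meson IntI)
    have "openin (top_of_set (v \<inter> O')) u" using u(1,4) D(5) by (blast intro: openin_subset_trans)
    then have "openin (top_of_set X) u" using o openin_trans by blast
    then show "\<exists>u. openin (top_of_set X) u \<and> connected u \<and> x \<in> u \<and> u \<subseteq> v" using u by blast
  qed
qed

lemma diam_closure_bound:
  assumes "\<And>x y. x \<in> A \<Longrightarrow> y \<in> A \<Longrightarrow> dist x y \<le> e" "x \<in> closure A" "y \<in> closure A"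
  shows "dist x y \<le> (e::real)"
proof -
  have "closure A \<subseteq> cball a e" if "a \<in> A" for a using assms(1)[OF that] by (intro closure_minimal) auto
  then have "A \<subseteq> cball x e" using assms(2) by (auto simp: dist_commute subset_iff)
  then have "closure A \<subseteq> cball x e" by (intro closure_minimal) auto
  then show ?thesis using assms(3) by auto
qed

text \<open>
  The set \<open>F\<close> consists of the boundaries of finitely many small neighbourhoods that cover \<open>X\<close>: a connected
  set that avoids these boundaries stays inside one neighbourhood.
\<close>

lemma finite_cut_set:
  assumes X: "local_dendrite X"
    and nb: "\<And>x. x \<in> X \<Longrightarrow> \<exists>V. openin (top_of_set X) V \<and> x \<in> V \<and> V \<subseteq> ball x (e/2) \<and> finite (bdry V) \<and> bdry V \<subseteq> Z"
  shows "\<exists>F. finite F \<and> F \<subseteq> Z \<and> F \<subseteq> X \<and>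
     (\<forall>A x y. connected A \<and> A \<subseteq> X - F \<and> x \<in> A \<and> y \<in> A \<longrightarrow> dist x y \<le> e)"
proof -
  note X' = local_dendriteD[OF X]
  obtain V where DV: "\<And>x. x \<in> X \<Longrightarrow> openin (top_of_set X) (V x) \<and> x \<in> V x \<and>
       V x \<subseteq> ball x (e/2) \<and> finite (bdry (V x)) \<and> bdry (V x) \<subseteq> Z" using nb by metis
  have "\<forall>x\<in>X. \<exists>T. open T \<and> V x = X \<inter> T" using DV by (metis openin_open)
  then obtain T where T: "\<And>x. x \<in> X \<Longrightarrow> open (T x) \<and> V x = X \<inter> T x" by metis
  have "X \<subseteq> (\<Union>x\<in>X. T x)" using DV T by blast
  then obtain K where K: "K \<subseteq> X" "finite K" "X \<subseteq> (\<Union>x\<in>K. T x)"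
    using compactE_image[OF X'(1), of X T] T by blast
  have cov: "\<exists>i\<in>K. x \<in> V i" if "x \<in> X" for x using K T that by blast
  define F where "F = (\<Union>x\<in>K. bdry (V x))"
  have VX: "V x \<subseteq> X" "closure (V x) \<subseteq> X" if "x \<in> X" for x
    using T[OF that] X'(4) closure_minimal[of "V x" X] by blast+
  have "finite F" unfolding F_def using K(1,2) DV by (intro finite_UN_I) blast+
  moreover have "F \<subseteq> Z" unfolding F_def using K(1) DV by (intro UN_least) blast
  moreover have "F \<subseteq> X" unfolding F_def
  proof (rule UN_least)
    fix x assume "x \<in> K"
    then have "closure (V x) \<subseteq> X" using VX(2) K(1) by blast
    then show "bdry (V x) \<subseteq> X" by blast
  qed
  ultimately have fF: "finite F" "F \<subseteq> Z" "F \<subseteq> X" .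
  have "dist x y \<le> e" if A: "connected A" "A \<subseteq> X - F" "x \<in> A" "y \<in> A" for A x y
  proof -
    obtain i where i: "i \<in> K" "A \<inter> V i \<noteq> {}" using cov A(2,3) by blast
    have "A \<inter> bdry (V i) = {}" using A(2) i(1) unfolding F_def by blast
    then have "A \<subseteq> V i" using connected_meets_boundary[OF A(1), of X "V i"] A(2) DV i K(1) by blast
    then have "A \<subseteq> ball i (e/2)" using DV K(1) i(1) by blast
    then have "dist i x < e/2" "dist i y < e/2" using A(3,4) by auto
    then show ?thesis using dist_triangle_half_r by (metis less_imp_le)
  qed
  then show ?thesis using fF by (intro exI[of _ F] conjI) blast+
qed

text \<open>
  Points of a component of \<open>X - G\<close> are thus represented by points of \<open>G\<close>, however many components there are.
\<close>

lemma component_touches_finite_set: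
  fixes X :: "'a::metric_space set"
  assumes "connected X" "locally connected X" "closed X" and G: "finite G" "G \<subseteq> X" "G \<noteq> {}" and x: "x \<in> X"
  shows "\<exists>p\<in>G. x = p \<or> (\<exists>A. connected A \<and> A \<subseteq> X - G \<and> x \<in> closure A \<and> p \<in> closure A)"
proof (cases "x \<in> G")
  case False
  define C where "C = connected_component_set (X - G) x"
  have "openin (top_of_set X) (X \<inter> - G)"
    using G(1) by (intro openin_open_Int) (simp add: finite_imp_closed open_Compl)
  then have "openin (top_of_set X) C" unfolding C_def using assms(2) by (intro openin_component) (simp_all add: Diff_eq)
  moreover have xC: "x \<in> C" unfolding C_def using x False by simp
  moreover have CG: "C \<subseteq> X - G" unfolding C_def by (rule connected_component_subset)
  ultimately have "bdry C \<noteq> {}" using G by (intro boundary_nonempty[OF assms(1)]) auto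
  moreover have "closure C \<subseteq> X" using CG assms(3) by (intro closure_minimal) auto
  ultimately obtain p where "p \<in> G" "p \<in> closure C"
    using closure_component_Int[of "X - G" x] unfolding C_def by blast
  moreover have "connected C" unfolding C_def by simp
  ultimately show ?thesis using xC CG closure_subset by blast
qed blast

section \<open>Cut points of nonwandering homeomorphisms\<close>

text \<open>
  The factor \<open>m\<close> makes the property pass to powers of \<open>f\<close>; \<open>nonwanderingI\<close> shows that for a homeomorphism the case
  \<open>m = 1\<close> implies all others.
\<close>

definition nonwandering :: "'a::metric_space set \<Rightarrow> ('a \<Rightarrow> 'a) \<Rightarrow> bool" where
  "nonwandering Y f \<longleftrightarrow> (\<forall>O' m. openin (top_of_set Y) O' \<and> O' \<noteq> {} \<and> m \<ge> 1 \<longrightarrow> (\<exists>n\<ge>1. (f ^^ (m * n)) ` O' \<inter> O' \<noteq> {}))"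

lemma nonwanderingE:
  assumes "nonwandering Y f" "openin (top_of_set Y) O'" "O' \<noteq> {}" "(m::nat) \<ge> 1"
  obtains n where "n \<ge> 1" "(f ^^ (m * n)) ` O' \<inter> O' \<noteq> {}"
  using assms unfolding nonwandering_def by blast

lemma homeomorphism_funpow:
  assumes "homeomorphism Y Y f g"
  shows "homeomorphism Y Y (f ^^ n) (g ^^ n)"
proof (induction n)
  case 0 then show ?case by (auto simp: homeomorphism_def continuous_on_id)
next
  case (Suc n)
  have "homeomorphism Y Y (f \<circ> (f ^^ n)) ((g ^^ n) \<circ> g)" by (rule homeomorphism_compose[OF Suc assms])
  then show ?case by (simp add: funpow_Suc_right o_def funpow_swap1)
qed

lemma nonwandering_funpow:
  assumes "nonwandering Y f" "k \<ge> 1"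
  shows "nonwandering Y (f ^^ k)"
  unfolding nonwandering_def
proof (intro allI impI)
  fix O' :: "'a set" and m :: nat assume a: "openin (top_of_set Y) O' \<and> O' \<noteq> {} \<and> m \<ge> 1"
  then obtain n where "n \<ge> 1" "(f ^^ ((k * m) * n)) ` O' \<inter> O' \<noteq> {}"
    using nonwanderingE[OF assms(1), of O' "k * m"] assms(2) by (metis mult_le_mono nat_mult_1)
  then show "\<exists>n\<ge>1. ((f ^^ k) ^^ (m * n)) ` O' \<inter> O' \<noteq> {}" by (auto simp: funpow_mult mult.assoc)
qed

lemma nonwandering_inverse:
  assumes "homeomorphism Y Y f g" "nonwandering Y f"
  shows "nonwandering Y g"
  unfolding nonwandering_def
proof (intro allI impI)
  fix O' :: "'a set" and m :: nat assume a: "openin (top_of_set Y) O' \<and> O' \<noteq> {} \<and> m \<ge> 1"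
  then obtain n where n: "n \<ge> 1" "(f ^^ (m * n)) ` O' \<inter> O' \<noteq> {}" using nonwanderingE[OF assms(2)] by metis
  then obtain x where x: "x \<in> O'" "(f ^^ (m * n)) x \<in> O'" by blast
  have "x \<in> Y" using x(1) a openin_imp_subset by blast
  then have "(g ^^ (m * n)) ((f ^^ (m * n)) x) = x"
    using homeomorphism_apply1[OF homeomorphism_funpow[OF assms(1)]] by blast
  then have "x \<in> (g ^^ (m * n)) ` O' \<inter> O'" using x by (metis IntI imageI)
  then show "\<exists>n\<ge>1. (g ^^ (m * n)) ` O' \<inter> O' \<noteq> {}" using n by blast
qed

lemma nonwandering_open_subset:
  assumes "nonwandering X f" "openin (top_of_set X) Y"
  shows "nonwandering Y f"
  using assms unfolding nonwandering_def by (meson openin_trans)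

text \<open>
  A return of \<open>O' \<inter> f\<^sup>-\<^sup>n O'\<close> yields a point with one more visit to \<open>O'\<close>.
\<close>

lemma return_times:
  assumes homeo: "homeomorphism X X f g"
    and nw: "\<And>O'. openin (top_of_set X) O' \<Longrightarrow> O' \<noteq> {} \<Longrightarrow> \<exists>n\<ge>1. (f ^^ n) ` O' \<inter> O' \<noteq> {}"
    and O': "openin (top_of_set X) O'" "O' \<noteq> {}"
  shows "\<exists>x\<in>X. \<exists>T. finite T \<and> card T = Suc N \<and> (\<forall>t\<in>T. (f ^^ t) x \<in> O')"
  using O'
proof (induction N arbitrary: O')
  case 0
  then obtain x where "x \<in> O'" by blast
  then show ?case using openin_imp_subset[OF 0(1)] by (intro bexI[of _ x] exI[of _ "{0}"]) auto
next
  case (Suc N)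
  obtain n where n: "n \<ge> 1" "(f ^^ n) ` O' \<inter> O' \<noteq> {}" using nw[OF Suc.prems] by blast
  define P where "P = O' \<inter> (X \<inter> (f ^^ n) -` O')"
  have "continuous_on X (f ^^ n)" "(f ^^ n) \<in> X \<rightarrow> X"
    using homeomorphism_funpow[OF homeo, of n] unfolding homeomorphism_def by auto
  then have "openin (top_of_set X) (X \<inter> (f ^^ n) -` O')"
    using Suc.prems(1) continuous_openin_preimage by blast
  then have "openin (top_of_set X) P" unfolding P_def using Suc.prems(1) by blast
  moreover have "P \<noteq> {}" using n(2) openin_imp_subset[OF Suc.prems(1)] unfolding P_def by blast
  ultimately obtain x T where xT: "x \<in> X" "finite T" "card T = Suc N" "\<forall>t\<in>T. (f ^^ t) x \<in> P"
    using Suc.IH by blast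
  have T: "T \<noteq> {}" using xT(3) by auto
  define s where "s = n + Max T"
  have "s \<notin> T" using n(1) xT(2) Max_ge[of T s] unfolding s_def by auto
  moreover have "(f ^^ s) x \<in> O'" using xT(4) Max_in[OF xT(2) T] unfolding s_def P_def by (auto simp: funpow_add)
  ultimately show ?case using xT unfolding P_def by (intro bexI[of _ x] exI[of _ "insert s T"]) auto
qed

text \<open>
  Among \<open>m + 1\<close> visits to \<open>O'\<close> two have times that agree modulo \<open>m\<close>.
\<close>

lemma nonwanderingI:
  assumes homeo: "homeomorphism X X f g"
    and nw: "\<And>O'. openin (top_of_set X) O' \<Longrightarrow> O' \<noteq> {} \<Longrightarrow> \<exists>n\<ge>1. (f ^^ n) ` O' \<inter> O' \<noteq> {}"
  shows "nonwandering X f"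
  unfolding nonwandering_def
proof (intro allI impI)
  fix O' m assume a: "openin (top_of_set X) O' \<and> O' \<noteq> {} \<and> (m::nat) \<ge> 1"
  obtain x T where xT: "x \<in> X" "finite T" "card T = Suc m" "\<forall>t\<in>T. (f ^^ t) x \<in> O'"
    using return_times[OF homeo nw, of O' m] a by blast
  have "card ((\<lambda>t. t mod m) ` T) \<le> card {..<m}" using a by (intro card_mono) auto
  then have "\<not> inj_on (\<lambda>t. t mod m) T" using xT(2,3) card_image by fastforce
  then obtain s t where st: "s \<in> T" "t \<in> T" "s < t" "s mod m = t mod m"
    unfolding inj_on_def by (metis nat_neq_iff)
  then obtain n where n: "t - s = m * n" using mod_eq_dvd_iff_nat[of s t m] by (auto simp: dvd_def)
  then have "n \<ge> 1" using st(3) by (cases n) auto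
  have "t = m * n + s" using n st(3) by simp
  then have "(f ^^ (m * n)) ((f ^^ s) x) = (f ^^ t) x" by (simp add: funpow_add)
  then have "(f ^^ t) x \<in> (f ^^ (m * n)) ` O' \<inter> O'" using xT(4) st by (metis IntI imageI)
  then show "\<exists>n\<ge>1. (f ^^ (m * n)) ` O' \<inter> O' \<noteq> {}" using \<open>n \<ge> 1\<close> by blast
qed

lemma homeomorphism_side:
  assumes h: "homeomorphism Y Y h k" and "c \<in> Y" "a \<in> Y" "a \<noteq> c"
  shows "h ` side Y c a = side Y (h c) (h a)"
proof -
  have sub: "h ` side Y c a \<subseteq> side Y (h c) (h a)" if h: "homeomorphism Y Y h k" and ca: "c \<in> Y" "a \<in> Y" "a \<noteq> c" for h k c a
  proof (rule side_maximal)
    have sY: "side Y c a \<subseteq> Y" using side_subset by blast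
    show "connected (h ` side Y c a)"
      using h sY by (intro connected_continuous_image connected_side) (auto simp: homeomorphism_def intro: continuous_on_subset)
    show "h ` side Y c a \<subseteq> Y" using h sY unfolding homeomorphism_def by blast
    show "h c \<notin> h ` side Y c a"
      using h ca(1) sY side_subset[of Y c a] by (auto simp: image_iff) (metis Diff_iff homeomorphism_apply1 singletonI subsetD)
    show "h a \<in> h ` side Y c a" using ca side_self by blast
  qed
  have hk: "homeomorphism Y Y k h" using h homeomorphism_symD by blast
  have ca': "h c \<in> Y" "h a \<in> Y" using assms unfolding homeomorphism_def by auto
  have khc: "k (h c) = c" "k (h a) = a" using assms homeomorphism_apply1[OF h] by auto
  have "k ` side Y (h c) (h a) \<subseteq> side Y c a"
    using sub[OF hk ca'] khc assms(4) by metis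
  then have "h ` k ` side Y (h c) (h a) \<subseteq> h ` side Y c a" by blast
  moreover have "h ` k ` side Y (h c) (h a) = side Y (h c) (h a)"
    using homeomorphism_apply2[OF h] side_subset[of Y "h c" "h a"] by (force simp: image_image image_iff)
  ultimately show ?thesis using sub[OF h assms(2-4)] by blast
qed

lemma closedin_insert_side: "closedin (top_of_set Y) (Y \<inter> insert c (side Y c a))"
proof -
  have "Y \<inter> closure (side Y c a) \<subseteq> Y \<inter> insert c (side Y c a)"
    using closure_component_Int[of "Y - {c}" a] unfolding side_def by blast
  then have "Y \<inter> insert c (side Y c a) = Y \<inter> (insert c (closure (side Y c a)))"
    using closure_subset[of "side Y c a"] by blast
  then show ?thesis by (simp add: closedin_closed_Int)
qed

text \<open>
  If an iterate mapped a side of \<open>p\<close> into itself and moved \<open>p\<close> inside, the part of the side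
  that is outside the image and its apex would wander under that iterate; it is not empty since \<open>p\<close> is in its
  closure.
\<close>

lemma no_nested_side:
  assumes homeo: "homeomorphism Y Y f g" and Y: "connected Y" "locally connected Y" and nw: "nonwandering Y f"
    and p: "p \<in> Y" "a \<in> Y" "a \<noteq> p" and n: "n \<ge> 1"
    and nest: "(f ^^ n) ` side Y p a \<subseteq> side Y p a" "(f ^^ n) p \<in> side Y p a"
  shows False
proof -
  define h where "h = f ^^ n"
  define B where "B = side Y p a"
  have h: "homeomorphism Y Y h (g ^^ n)" unfolding h_def by (rule homeomorphism_funpow[OF homeo])
  have BY: "B \<subseteq> Y" "p \<notin> B" unfolding B_def using side_subset by blast+
  have pB: "Y \<inter> insert p B = insert p B" using BY p by blast
  have "closedin (top_of_set Y) (insert p B)"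
    using closedin_insert_side[of Y p a] pB unfolding B_def by simp
  then have cl: "closedin (top_of_set Y) (h ` insert p B)" using homeomorphism_imp_closed_map[OF h] by blast
  define O' where "O' = B - h ` insert p B"
  have hB: "h ` insert p B \<subseteq> B" using nest unfolding h_def B_def by blast
  have "openin (top_of_set Y) O'"
    unfolding O'_def using openin_side[OF Y(2), of p a] cl unfolding B_def by (rule openin_diff)
  moreover have "O' \<noteq> {}"
  proof
    assume "O' = {}"
    then have "B \<subseteq> h ` insert p B" unfolding O'_def by blast
    moreover have "p \<in> closure B" unfolding B_def using Y p by (intro apex_in_closure_side) auto
    moreover obtain T where T: "closed T" "h ` insert p B = Y \<inter> T" using cl by (auto simp: closedin_closed)
    ultimately have "p \<in> T" using closure_minimal[of B T] by blast
    then show False using T p hB BY by blast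
  qed
  ultimately obtain i where i: "i \<ge> 1" "(f ^^ (n * i)) ` O' \<inter> O' \<noteq> {}" using nonwanderingE[OF nw _ _ n] by metis
  have "(h ^^ Suc j) ` B \<subseteq> h ` B" for j
  proof (induction j)
    case (Suc j)
    have "(h ^^ Suc (Suc j)) ` B = h ` ((h ^^ Suc j) ` B)" by (simp add: image_comp)
    also have "\<dots> \<subseteq> h ` B" using Suc hB by blast
    finally show ?case .
  qed simp
  then have "(f ^^ (n * i)) ` B \<subseteq> h ` B"
    using i(1) unfolding h_def funpow_mult[symmetric] by (metis Suc_le_D One_nat_def)
  then show False using i(2) unfolding O'_def by blast
qed

text \<open>
  Let \<open>h\<close> be an iterate for which the side of \<open>b\<close> meets its image. Since neither of the two is
  contained in the other, \<open>p\<close> lies in the image and \<open>h p\<close> in the side. The image of every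
  other side at \<open>p\<close> is a side of \<open>h p\<close> away from \<open>p\<close>, so it lies entirely in the side of \<open>b\<close>.
\<close>

lemma side_into_side:
  assumes homeo: "homeomorphism Y Y f g" and Y: "connected Y" "locally connected Y" and nw: "nonwandering Y f"
    and p: "p \<in> Y" and nper: "\<And>n. n \<ge> 1 \<Longrightarrow> (f ^^ n) p \<noteq> p"
    and ab: "a \<in> Y" "a \<noteq> p" "b \<in> Y" "b \<noteq> p" "side Y p a \<inter> side Y p b = {}"
  shows "\<exists>n\<ge>1. (f ^^ n) ` side Y p a \<subseteq> side Y p b \<and> (f ^^ n) p \<in> side Y p b"
proof -
  have "side Y p b \<noteq> {}" using side_self ab by blast
  then obtain n where n: "n \<ge> 1" "(f ^^ n) ` side Y p b \<inter> side Y p b \<noteq> {}"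
    using nonwanderingE[OF nw openin_side[OF Y(2)], of p b 1] by auto
  define h where "h = f ^^ n"
  have h: "homeomorphism Y Y h (g ^^ n)" unfolding h_def by (rule homeomorphism_funpow[OF homeo])
  have hY: "h p \<in> Y" "h a \<in> Y" "h b \<in> Y" using h p ab unfolding homeomorphism_def by auto
  have hp: "h p \<noteq> p" unfolding h_def using nper n(1) by blast
  have inj: "inj_on h Y" using homeomorphism_apply1[OF h] by (metis inj_on_inverseI)
  have hne: "h a \<noteq> h p" "h b \<noteq> h p" using inj ab p by (auto dest: inj_onD)
  have ima: "h ` side Y p a = side Y (h p) (h a)" and imb: "h ` side Y p b = side Y (h p) (h b)"
    using homeomorphism_side[OF h p] ab by auto
  have sY: "side Y c x \<subseteq> Y" for c x using side_subset by blast
  have p_in: "p \<in> h ` side Y p b"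
  proof (rule ccontr)
    assume np: "p \<notin> h ` side Y p b"
    have sub: "h ` side Y p b \<subseteq> side Y p b"
      using n(2) np sY unfolding imb h_def[symmetric] by (intro side_subset_side connected_side) auto
    have "h p \<in> closure (h ` side Y p b)"
      unfolding imb using Y hY hne by (intro apex_in_closure_side) auto
    then have "h p \<in> closure (side Y p b)" using closure_mono[OF sub] by blast
    then have "h p \<in> side Y p b"
      using closure_component_Int[of "Y - {p}" b] hY(1) hp unfolding side_def by blast
    then show False using no_nested_side[OF homeo Y nw p ab(3,4) n(1)] sub unfolding h_def by blast
  qed
  have hp_in: "h p \<in> side Y p b"
  proof (rule ccontr)
    assume np: "h p \<notin> side Y p b"
    have sub: "side Y p b \<subseteq> h ` side Y p b"
      using n(2) np sY unfolding imb h_def[symmetric] by (intro side_subset_side connected_side) auto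
    have gh: "(g ^^ n) (h x) = x" if "x \<in> Y" for x using homeomorphism_apply1[OF h that] .
    have "(g ^^ n) ` side Y p b \<subseteq> side Y p b" using sub gh sY by (auto simp: subset_iff image_iff)
    moreover have "(g ^^ n) p \<in> side Y p b" using p_in gh sY by (auto simp: subset_iff image_iff)
    ultimately show False
      using no_nested_side[OF homeomorphism_symD[OF homeo] Y nonwandering_inverse[OF homeo nw] p ab(3,4) n(1)] by blast
  qed
  have "h ` side Y p a \<inter> h ` side Y p b = {}"
    using inj ab(5) sY by (metis image_empty inj_on_image_Int)
  then have "p \<notin> side Y (h p) (h a)" using p_in ima by blast
  moreover have "connected (insert (h p) (side Y (h p) (h a)))"
    using Y hY hne by (intro connected_insert_closure connected_side apex_in_closure_side) auto
  ultimately have "insert (h p) (side Y (h p) (h a)) \<subseteq> side Y p b"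
    using hp_in hp hY sY by (intro side_subset_side) auto
  then show ?thesis using n(1) hp_in ima unfolding h_def by blast
qed

text \<open>
  If \<open>p\<close> is not periodic, then some iterate maps a first side into a second side, and another one
  maps the second side into the first. Their composition maps the second side into
  itself, which \<open>no_nested_side\<close> excludes.
\<close>

lemma cut_point_periodic:
  assumes homeo: "homeomorphism Y Y f g" and Y: "connected Y" "locally connected Y" and nw: "nonwandering Y f"
    and p: "p \<in> Y" "\<not> connected (Y - {p})"
  shows "\<exists>n\<ge>1. (f ^^ n) p = p"
proof (rule ccontr)
  assume "\<not> ?thesis"
  then have nper: "\<And>n. n \<ge> 1 \<Longrightarrow> (f ^^ n) p \<noteq> p" by blast
  obtain a b where ab: "a \<in> Y - {p}" "b \<in> Y - {p}" "b \<notin> side Y p a"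
    using p(2) unfolding connected_iff_connected_component side_def by blast
  then have dis: "side Y p a \<inter> side Y p b = {}"
    unfolding side_def using connected_component_disjoint by blast
  have dis': "side Y p b \<inter> side Y p a = {}" using dis by blast
  obtain n where n: "n \<ge> 1" "(f ^^ n) ` side Y p a \<subseteq> side Y p b"
    using side_into_side[OF homeo Y nw p(1) nper _ _ _ _ dis] ab by auto
  obtain m where m: "m \<ge> 1" "(f ^^ m) ` side Y p b \<subseteq> side Y p a" "(f ^^ m) p \<in> side Y p a"
    using side_into_side[OF homeo Y nw p(1) nper _ _ _ _ dis'] ab by auto
  have "(f ^^ (n + m)) ` side Y p b \<subseteq> side Y p b" "(f ^^ (n + m)) p \<in> side Y p b"
    using n(2) m(2,3) by (auto simp: funpow_add)
  then show False using no_nested_side[OF homeo Y nw p(1), of b "n + m"] ab n(1) by auto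
qed

section \<open>Beads\<close>

lemma homeomorphism_closure_image:
  fixes X :: "'a::metric_space set"
  assumes h: "homeomorphism X X h k" and X: "compact X" and B: "B \<subseteq> X"
  shows "closure (h ` B) = h ` closure B"
proof
  have cB: "closure B \<subseteq> X" using B X by (simp add: closure_minimal compact_imp_closed)
  have con: "continuous_on (closure B) h" using h cB by (auto simp: homeomorphism_def intro: continuous_on_subset)
  have "compact (closure B)" using X cB by (metis closed_closure closed_Int_compact inf.absorb_iff1)
  then have "closed (h ` closure B)" using con compact_continuous_image compact_imp_closed by blast
  then show "closure (h ` B) \<subseteq> h ` closure B" by (intro closure_minimal) (auto intro: closure_subset[THEN subsetD])
  show "h ` closure B \<subseteq> closure (h ` B)" using con by (rule image_closure_subset) (auto intro: closure_subset[THEN subsetD])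
qed

lemma bdry_homeomorphism_image:
  fixes X :: "'a::metric_space set"
  assumes h: "homeomorphism X X h k" and X: "compact X" and B: "B \<subseteq> X"
  shows "bdry (h ` B) = h ` bdry B"
proof -
  have cB: "closure B \<subseteq> X" using B X by (simp add: closure_minimal compact_imp_closed)
  have "inj_on h X" using homeomorphism_apply1[OF h] by (metis inj_on_inverseI)
  then have "h ` (closure B - B) = h ` closure B - h ` B" using cB B by (intro inj_on_image_set_diff) auto
  then show ?thesis using homeomorphism_closure_image[OF assms] by simp
qed

text \<open>
  The size of the boundary is a submodular function of the set.
\<close>

lemma bdry_Un_Int:
  fixes K L :: "'a::metric_space set"
  assumes "finite (bdry K)" "finite (bdry L)"
  shows "card (bdry (K \<union> L)) + card (bdry (K \<inter> L)) \<le> card (bdry K) + card (bdry L)"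
    and "bdry (K \<union> L) \<union> bdry (K \<inter> L) \<subseteq> bdry K \<union> bdry L"
proof -
  have cl: "closure (K \<inter> L) \<subseteq> closure K \<inter> closure L" by (intro Int_greatest closure_mono) auto
  show sub: "bdry (K \<union> L) \<union> bdry (K \<inter> L) \<subseteq> bdry K \<union> bdry L" using cl by (auto simp: closure_Un)
  have sub2: "bdry (K \<union> L) \<inter> bdry (K \<inter> L) \<subseteq> bdry K \<inter> bdry L" using cl by (auto simp: closure_Un)
  have fin: "finite (bdry (K \<union> L))" "finite (bdry (K \<inter> L))" using sub assms by (auto intro: finite_subset)
  have "card (bdry (K \<union> L)) + card (bdry (K \<inter> L)) =
      card (bdry (K \<union> L) \<union> bdry (K \<inter> L)) + card (bdry (K \<union> L) \<inter> bdry (K \<inter> L))"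
    by (rule card_Un_Int[OF fin])
  also have "\<dots> \<le> card (bdry K \<union> bdry L) + card (bdry K \<inter> bdry L)"
    using sub sub2 assms by (intro add_mono card_mono) auto
  also have "\<dots> = card (bdry K) + card (bdry L)" using card_Un_Int[OF assms] by simp
  finally show "card (bdry (K \<union> L)) + card (bdry (K \<inter> L)) \<le> card (bdry K) + card (bdry L)" .
qed

lemma finite_separating_radius:
  fixes S :: "'a::metric_space set"
  assumes "finite S"
  shows "\<exists>r>0. \<forall>s\<in>S. \<forall>t\<in>S. s \<noteq> t \<longrightarrow> ball s r \<inter> ball t r = {}"
proof (cases "S = {}")
  case False
  have "\<forall>a. \<exists>d>0. \<forall>x\<in>S. x \<noteq> a \<longrightarrow> d \<le> dist a x" using finite_set_avoid[OF assms] by blast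
  then obtain d where d: "\<And>a. d a > 0" "\<And>a x. x \<in> S \<Longrightarrow> x \<noteq> a \<Longrightarrow> d a \<le> dist a x" by metis
  define r where "r = Min (d ` S) / 2"
  have "r > 0" unfolding r_def using d(1) assms False by simp
  moreover have "ball s r \<inter> ball t r = {}" if "s \<in> S" "t \<in> S" "s \<noteq> t" for s t
  proof -
    have "2 * r \<le> d s" unfolding r_def using assms that by simp
    then have "2 * r \<le> dist s t" using d(2)[of t s] that by auto
    then show ?thesis using disjoint_ballI[of r r s t] by simp
  qed
  ultimately show ?thesis by blast
qed (auto intro: exI[of _ 1])

locale local_dendrite_homeo =
  fixes X :: "'a::metric_space set" and f g :: "'a \<Rightarrow> 'a"
  assumes ld: "local_dendrite X" and homeo: "homeomorphism X X f g"
begin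

lemmas Xprops = local_dendriteD[OF ld]

lemma funpow_homeo: "homeomorphism X X (f ^^ n) (g ^^ n)"
  by (rule homeomorphism_funpow[OF homeo])

lemma funpow_in: "x \<in> X \<Longrightarrow> (f ^^ n) x \<in> X"
  using funpow_homeo[of n] unfolding homeomorphism_def by auto

lemma funpow_inj: "x \<in> X \<Longrightarrow> y \<in> X \<Longrightarrow> (f ^^ n) x = (f ^^ n) y \<Longrightarrow> x = y"
  using homeomorphism_apply1[OF funpow_homeo[of n]] by metis

lemma funpow_cont: "continuous_on X (f ^^ n)"
  using funpow_homeo[of n] unfolding homeomorphism_def by auto

lemma funpow_open: "openin (top_of_set X) U \<Longrightarrow> openin (top_of_set X) ((f ^^ n) ` U)"
  using homeomorphism_imp_open_map[OF funpow_homeo] by blast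

lemma closure_in_X: "U \<subseteq> X \<Longrightarrow> closure U \<subseteq> X"
  using Xprops(4) by (intro closure_minimal) auto

lemma funpow_closure: "U \<subseteq> X \<Longrightarrow> closure ((f ^^ n) ` U) = (f ^^ n) ` closure U"
  by (rule homeomorphism_closure_image[OF funpow_homeo Xprops(1)])

lemma funpow_bdry: "U \<subseteq> X \<Longrightarrow> bdry ((f ^^ n) ` U) = (f ^^ n) ` bdry U"
  by (rule bdry_homeomorphism_image[OF funpow_homeo Xprops(1)])

definition periodic :: "'a \<Rightarrow> bool" where "periodic x \<longleftrightarrow> (\<exists>n\<ge>1. (f ^^ n) x = x)"

text \<open>
  It is enough to follow the orbit at the multiples of \<open>m\<close>, since the iterates are injective.
\<close>

lemma periodic_if_finite_orbit:
  assumes "finite S" "a \<in> X" "m \<ge> 1" "\<And>n. (f ^^ (m * n)) a \<in> S"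
  shows "periodic a"
proof -
  have "\<not> inj (\<lambda>n. (f ^^ (m * n)) a)"
    using assms(1,4) by (metis finite_subset image_subsetI infinite_UNIV_nat finite_imageD)
  then obtain i j where ij: "i < j" "(f ^^ (m * i)) a = (f ^^ (m * j)) a"
    unfolding inj_def by (metis nat_neq_iff)
  then obtain d where d: "j = i + d" "d \<ge> 1" by (metis less_imp_add_positive One_nat_def Suc_leI)
  have "(f ^^ (m * i)) ((f ^^ (m * d)) a) = (f ^^ (m * i)) a"
    using ij(2) d(1) by (simp add: funpow_add distrib_left)
  then have "(f ^^ (m * d)) a = a" using funpow_inj funpow_in assms(2) by blast
  moreover have "m * d \<ge> 1" using assms(3) d(2) by (metis mult_le_mono nat_mult_1)
  ultimately show ?thesis unfolding periodic_def by blast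
qed

lemma periodic_if_image_periodic: 
  assumes "x \<in> X" "periodic ((f ^^ n) x)" shows "periodic x"
proof -
  obtain k where k: "k \<ge> 1" "(f ^^ k) ((f ^^ n) x) = (f ^^ n) x" using assms(2) unfolding periodic_def by blast
  have "(f ^^ n) ((f ^^ k) x) = (f ^^ k) ((f ^^ n) x)" by (metis add.commute comp_apply funpow_add)
  then have "(f ^^ k) x = x" using k(2) funpow_inj funpow_in assms(1) by metis
  then show ?thesis using k(1) unfolding periodic_def by blast
qed

lemma periodic_orbit_finite: "periodic c \<Longrightarrow> finite (range (\<lambda>j. (f ^^ j) c))"
proof -
  assume "periodic c"
  then obtain n where n: "n \<ge> 1" "(f ^^ n) c = c" unfolding periodic_def by blast
  have "(f ^^ j) c = (f ^^ (j mod n)) c" for j using funpow_mod_eq[OF n(2)] by metis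
  moreover have "j mod n \<in> {..<n}" for j using n(1) by simp
  ultimately have "range (\<lambda>j. (f ^^ j) c) \<subseteq> (\<lambda>j. (f ^^ j) c) ` {..<n}" by blast
  then show ?thesis using finite_subset by blast
qed

lemma periodic_preimage_in_orbit:
  assumes "periodic c" "c \<in> X" "y \<in> X" "(f ^^ n) y = c"
  shows "\<exists>j. y = (f ^^ j) c"
proof -
  obtain m where m: "m \<ge> 1" "(f ^^ m) c = c" using assms(1) unfolding periodic_def by blast
  have "(f ^^ (m * n)) c = c" by (induction n) (auto simp: funpow_add m)
  moreover have "m * n = n + n * (m - 1)" using m(1) by (cases m) (auto simp: algebra_simps)
  ultimately have "(f ^^ n) ((f ^^ (n * (m - 1))) c) = (f ^^ n) y" using assms(4) by (simp add: funpow_add)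
  then show ?thesis using funpow_inj funpow_in assms(2,3) by blast
qed

text \<open>
  The model is an open subarc of an arc together with all that branches off from its interior.
\<close>

definition bead :: "'a set \<Rightarrow> bool" where
  "bead B \<longleftrightarrow> openin (top_of_set X) B \<and> connected B \<and> B \<noteq> {} \<and> closure B \<noteq> X \<and>
     finite (bdry B) \<and> card (bdry B) \<le> 2 \<and> (\<forall>c\<in>bdry B. \<not> periodic c)"

lemma bead_subset: "bead B \<Longrightarrow> B \<subseteq> X"
  unfolding bead_def using openin_imp_subset by blast

lemma bead_image:
  assumes "bead B" shows "bead ((f ^^ n) ` B)"
proof -
  note b = assms[unfolded bead_def]
  have BX: "B \<subseteq> X" using assms by (rule bead_subset)
  have bX: "bdry B \<subseteq> X" using closure_in_X[OF BX] by blast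
  have "connected ((f ^^ n) ` B)"
    using b BX funpow_cont by (intro connected_continuous_image) (auto intro: continuous_on_subset)
  moreover have "closure ((f ^^ n) ` B) \<noteq> X"
  proof
    assume "closure ((f ^^ n) ` B) = X"
    then have "X \<subseteq> (f ^^ n) ` closure B" using funpow_closure[OF BX] by simp
    moreover have "x \<in> closure B" if "x \<in> X" "(f ^^ n) x \<in> (f ^^ n) ` closure B" for x
      using that funpow_inj[OF that(1)] closure_in_X[OF BX] by blast
    ultimately have "X \<subseteq> closure B" using funpow_in by blast
    then show False using b closure_in_X[OF BX] by blast
  qed
  moreover have "card (bdry ((f ^^ n) ` B)) \<le> 2"
    using funpow_bdry[OF BX, of n] b card_image_le[of "bdry B" "f ^^ n"] by auto
  moreover have "\<forall>c\<in>bdry ((f ^^ n) ` B). \<not> periodic c"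
    using funpow_bdry[OF BX, of n] b periodic_if_image_periodic bX by (metis (no_types, lifting) image_iff subset_iff)
  ultimately show ?thesis
    using b funpow_open funpow_bdry[OF BX, of n] unfolding bead_def by (auto simp del: Diff_iff)
qed

text \<open>
  With nonnegative iterates, the union of all these sets is mapped into itself by some iterate, and
  the absence of wandering points turns this into invariance.
\<close>

inductive_set chain :: "'a set \<Rightarrow> 'a set set" for B where
  base: "B \<in> chain B"
| step: "K \<in> chain B \<Longrightarrow> (f ^^ n) ` B \<inter> K \<noteq> {} \<Longrightarrow> K \<union> (f ^^ n) ` B \<in> chain B"

lemma chain_connected_open:
  assumes "bead B" "K \<in> chain B"
  shows "openin (top_of_set X) K \<and> connected K \<and> B \<subseteq> K \<and> (\<exists>N. K \<subseteq> (\<Union>n\<le>N. (f ^^ n) ` B))"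
  using assms(2)
proof induction
  case base
  have "B \<subseteq> (\<Union>n\<le>0. (f ^^ n) ` B)" by simp
  then show ?case using assms(1) unfolding bead_def by blast
next
  case (step K n)
  obtain N where N: "K \<subseteq> (\<Union>n\<le>N. (f ^^ n) ` B)" using step by blast
  have "K \<union> (f ^^ n) ` B \<subseteq> (\<Union>i\<le>max n N. (f ^^ i) ` B)"
  proof -
    have "{..N} \<subseteq> {..max n N}" by auto
    then have "(\<Union>i\<le>N. (f ^^ i) ` B) \<subseteq> (\<Union>i\<le>max n N. (f ^^ i) ` B)" by (intro UN_mono) auto
    moreover have "(f ^^ n) ` B \<subseteq> (\<Union>i\<le>max n N. (f ^^ i) ` B)" by (intro UN_upper) simp
    ultimately show ?thesis using order_trans[OF N] by (simp only: Un_least)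
  qed
  moreover have "connected (K \<union> (f ^^ n) ` B)"
    using step bead_image[OF assms(1), of n] unfolding bead_def by (intro connected_Un) auto
  moreover have "openin (top_of_set X) (K \<union> (f ^^ n) ` B)"
    using step bead_image[OF assms(1), of n] unfolding bead_def by auto
  ultimately show ?case using step by blast
qed

lemma chain_Un:
  assumes "bead B" "K \<in> chain B" "L \<in> chain B"
  shows "K \<union> L \<in> chain B"
  using assms(3)
proof induction
  case base
  then show ?case using chain_connected_open[OF assms(1,2)] assms(2) by (simp add: Un_absorb2)
next
  case (step L n)
  then show ?case using chain.step[of "K \<union> L" B n] by (auto simp: Un_assoc)
qed

lemma chain_finite_Un:
  assumes "bead B" "finite \<K>" "\<K> \<subseteq> chain B"
  shows "\<exists>K\<in>chain B. \<Union>\<K> \<subseteq> K"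
  using assms(2,3)
proof (induction)
  case empty
  then show ?case using chain.base by auto
next
  case (insert L \<K>)
  then obtain K where K: "K \<in> chain B" "\<Union>\<K> \<subseteq> K" by auto
  have "K \<union> L \<in> chain B" using chain_Un[OF assms(1) K(1)] insert by auto
  then show ?case using K(2) by (intro bexI[of _ "K \<union> L"]) auto
qed

lemma chain_shift:
  assumes B: "bead B" and m: "(f ^^ m) ` B \<inter> B \<noteq> {}" and K: "K \<in> chain B"
  shows "K \<union> (f ^^ m) ` K \<in> chain B"
  using K
proof induction
  case base
  show ?case using chain.step[OF chain.base, of m B] m by blast
next
  case (step K n)
  have 1: "(K \<union> (f ^^ m) ` K) \<union> (f ^^ n) ` B \<in> chain B"
    using step by (intro chain.step) auto
  have e: "(f ^^ m) ` (f ^^ n) ` B = (f ^^ (m + n)) ` B" by (simp add: funpow_add image_comp)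
  have "(f ^^ m) ` ((f ^^ n) ` B \<inter> K) \<noteq> {}" using step by blast
  then have "(f ^^ (m + n)) ` B \<inter> (f ^^ m) ` K \<noteq> {}" unfolding e[symmetric] by blast
  then have "((K \<union> (f ^^ m) ` K) \<union> (f ^^ n) ` B) \<union> (f ^^ (m + n)) ` B \<in> chain B"
    by (intro chain.step[OF 1]) blast
  moreover have "((K \<union> (f ^^ m) ` K) \<union> (f ^^ n) ` B) \<union> (f ^^ (m + n)) ` B =
    (K \<union> (f ^^ n) ` B) \<union> (f ^^ m) ` (K \<union> (f ^^ n) ` B)" unfolding image_Un e by blast
  ultimately show ?case by simp
qed

text \<open>
  Small connected neighbourhoods with finite boundary whose closure sits in the interior of a dendrite.
\<close>

lemma connected_chart:
  assumes "x \<in> X" "openin (top_of_set X) W" "x \<in> W" "e > 0"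
  shows "\<exists>D U O'. dendrite D \<and> D \<subseteq> X \<and> openin (top_of_set X) O' \<and> O' \<subseteq> D \<and> openin (top_of_set X) U \<and> connected U \<and> x \<in> U \<and>
     closure U \<subseteq> O' \<and> closure U \<subseteq> W \<and> U \<subseteq> ball x e \<and> finite (bdry U)"
proof -
  obtain D O' where D: "dendrite D" "D \<subseteq> X" "openin (top_of_set X) O'" "x \<in> O'" "O' \<subseteq> D"
    using local_dendrite_chart[OF ld assms(1)] by blast
  have "\<exists>z\<in>UNIV. z \<in> D \<and> z \<noteq> x \<and> z \<noteq> y \<and> y \<notin> side D z x" if y: "y \<in> D" "y \<noteq> x" for y
  proof -
    obtain \<gamma> where g: "arc \<gamma>" "path_image \<gamma> \<subseteq> D" "pathstart \<gamma> = x" "pathfinish \<gamma> = y"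
     "\<forall>A. connected A \<and> A \<subseteq> D \<and> x \<in> A \<and> y \<in> A \<longrightarrow> path_image \<gamma> \<subseteq> A"
      using dendrite_least_connected_arc[OF D(1), of x y] D(4,5) y by auto
    have inj: "inj_on \<gamma> {0..1}" using g(1) by (simp add: arc_def)
    have "\<gamma> (1/2) \<noteq> \<gamma> 0" "\<gamma> (1/2) \<noteq> \<gamma> 1" using inj by (auto dest: inj_onD)
    then have "\<gamma> (1/2) \<noteq> x" "\<gamma> (1/2) \<noteq> y" using g(3,4) by (auto simp: pathstart_def pathfinish_def)
    moreover have "\<gamma> (1/2) \<in> path_image \<gamma>" by (auto simp: path_image_def)
    ultimately show ?thesis using arc_interior_separates[OF g(5)] D(4,5) g(2) by blast
  qed
  then obtain V where V: "openin (top_of_set X) V" "x \<in> V" "closure V \<subseteq> O' \<inter> W" "V \<subseteq> ball x e" "finite (bdry V)"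
    using local_small_neighbourhood[OF D(1,2), of "O' \<inter> W" x e UNIV] D assms by (metis IntI inf.coboundedI1 openin_Int)
  define U where "U = connected_component_set V x"
  have UV: "U \<subseteq> V" unfolding U_def by (rule connected_component_subset)
  have "bdry U \<subseteq> bdry V" using closure_mono[OF UV] closure_component_Int[of V x] unfolding U_def by blast
  then have "finite (bdry U)" using V(5) finite_subset by blast
  moreover have "openin (top_of_set X) U" unfolding U_def by (rule openin_component[OF Xprops(5) V(1)])
  moreover have "connected U" "x \<in> U" unfolding U_def using V(2) by auto
  moreover have "closure U \<subseteq> closure V" using UV by (rule closure_mono)
  moreover have "closure U \<subseteq> O'" "closure U \<subseteq> W" "U \<subseteq> ball x e" using V(3,4) UV \<open>closure U \<subseteq> closure V\<close> by blast+
  ultimately show ?thesis using D(1,2,3,5) by (intro exI[of _ D] exI[of _ U] exI[of _ O'] conjI)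
qed

text \<open>
  A boundary point \<open>a\<close> that is isolated in the boundary of \<open>Y\<close> can be reached from inside by an arc
  whose points cut \<open>Y\<close> near \<open>a\<close>. Let \<open>U\<close> be a small neighbourhood of \<open>a\<close> in a dendrite, \<open>C\<close> a component of
  \<open>U - {a}\<close> in \<open>Y\<close> and \<open>\<gamma>\<close> an arc in \<open>C\<close> to \<open>a\<close>. A point \<open>c\<close> of \<open>\<gamma>\<close> separates the start from \<open>a\<close> in the dendrite; the
  part of \<open>C\<close> on the side of \<open>a\<close> could be connected to the rest of \<open>Y\<close> only through one of the finitely
  many exits \<open>u\<close> of \<open>C\<close> on the boundary of \<open>U\<close>, and these lie on the other side of \<open>c\<close> once \<open>c\<close> is close to \<open>a\<close>.
\<close>

lemma cut_arc_to_boundary: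
  assumes Y: "openin (top_of_set X) Y" "connected Y" "finite (bdry Y)" and a: "a \<in> bdry Y"
  shows "\<exists>\<gamma> t0. path \<gamma> \<and> 0 \<le> t0 \<and> t0 < 1 \<and> \<gamma> 1 = a \<and> (\<forall>t\<in>{t0..<1}. \<gamma> t \<in> Y \<and> \<not> connected (Y - {\<gamma> t}))"
proof -
  have YX: "Y \<subseteq> X" using Y(1) openin_imp_subset by blast
  have aX: "a \<in> X" using a closure_in_X[OF YX] by blast
  have "openin (top_of_set X) (X \<inter> - (bdry Y - {a}))"
    by (rule openin_open_Int, rule open_Compl, rule finite_imp_closed) (use Y(3) in blast)
  then obtain D U O' where D: "dendrite D" "D \<subseteq> X" "openin (top_of_set X) O'" "O' \<subseteq> D" and U: "openin (top_of_set X) U" "connected U"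
     "a \<in> U" "closure U \<subseteq> O'" "closure U \<subseteq> X \<inter> - (bdry Y - {a})" "finite (bdry U)"
    using connected_chart[OF aX, of "X \<inter> - (bdry Y - {a})" 1] aX by auto
  have UX: "U \<subseteq> X" using U(1) openin_imp_subset by blast
  obtain T where T: "open T" "U = X \<inter> T" using U(1) by (auto simp: openin_open)
  have "T \<inter> Y \<noteq> {}" using T U(3) a by (metis DiffD1 IntD2 closure_iff_nhds_not_empty inf_commute order_refl)
  then obtain z0 where z0: "z0 \<in> U" "z0 \<in> Y" using T(2) YX by blast
  have aY: "a \<notin> Y" using a by blast
  define C where "C = connected_component_set (U - {a}) z0"
  have C: "connected C" "z0 \<in> C" "C \<subseteq> U - {a}" unfolding C_def using z0 aY by (auto dest: connected_component_in)
  have Cop: "openin (top_of_set X) C" unfolding C_def by (intro openin_component Xprops openin_Diff_point U)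
  have CY: "C \<subseteq> Y"
  proof (rule ccontr)
    assume "\<not> C \<subseteq> Y"
    then have "C \<inter> bdry Y \<noteq> {}" using C z0 UX Y(1) by (intro connected_meets_boundary[of C X]) auto
    then show False using C(3) U(5) closure_subset[of U] by blast
  qed
  have clC: "closure C \<subseteq> closure U" using C(3) by (intro closure_mono) auto
  have clCU: "closure C \<inter> U \<subseteq> insert a C" using closure_component_Int[of "U - {a}" z0] unfolding C_def by blast
  have aC: "a \<in> closure C"
  proof -
    have "U \<inter> bdry C \<noteq> {}" using C U Cop UX z0 by (intro connected_meets_boundary[of U X]) auto
    then show ?thesis using clCU by blast
  qed
  have za: "z0 \<noteq> a" using z0 aY by blast
  have UD: "closure U \<subseteq> D" using U(4) D(4) by blast
  have zD: "z0 \<in> D" "a \<in> D" using z0 U(3) UD closure_subset[of U] by blast+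
  obtain \<gamma> where g: "arc \<gamma>" "path_image \<gamma> \<subseteq> D" "pathstart \<gamma> = z0" "pathfinish \<gamma> = a"
     "\<forall>A. connected A \<and> A \<subseteq> D \<and> z0 \<in> A \<and> a \<in> A \<longrightarrow> path_image \<gamma> \<subseteq> A"
    using dendrite_least_connected_arc[OF D(1) zD za] by blast
  have g01: "\<gamma> 0 = z0" "\<gamma> 1 = a" using g(3,4) by (auto simp: pathstart_def pathfinish_def)
  have inj: "inj_on \<gamma> {0..1}" using g(1) by (simp add: arc_def)
  have CD: "C \<subseteq> D" using C(3) UD closure_subset[of U] by blast
  have gC: "path_image \<gamma> \<subseteq> insert a C"
  proof -
    have "connected (insert a C)" using C(1) aC by (rule connected_insert_closure)
    then show ?thesis using g(5) C(2) CD zD by blast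
  qed
  define E where "E = closure C - insert a C"
  have EU: "E \<subseteq> bdry U" unfolding E_def using clC clCU by blast
  then have fE: "finite E" using U(6) finite_subset by blast
  \<comment> \<open>The set P is the arc from the start of the path to the exit u; it avoids a because it runs in C.\<close>
  have "\<exists>P. closed P \<and> a \<notin> P \<and> (\<forall>c. c \<notin> P \<longrightarrow> (\<exists>A. connected A \<and> A \<subseteq> D \<and> c \<notin> A \<and> u \<in> A \<and> z0 \<in> A))" if u: "u \<in> E" for u
  proof -
    have uz: "z0 \<noteq> u" "u \<noteq> a" using u C(2) unfolding E_def by auto
    have uD: "u \<in> D" using u clC UD unfolding E_def by blast
    obtain \<delta> where d: "arc \<delta>" "path_image \<delta> \<subseteq> D" "pathstart \<delta> = z0" "pathfinish \<delta> = u"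
       "\<forall>A. connected A \<and> A \<subseteq> D \<and> z0 \<in> A \<and> u \<in> A \<longrightarrow> path_image \<delta> \<subseteq> A"
      using dendrite_least_connected_arc[OF D(1) zD(1) uD uz(1)] by blast
    have "connected (insert u C)" using C(1) u unfolding E_def by (intro connected_insert_closure) auto
    then have "path_image \<delta> \<subseteq> insert u C" using d(5) C(2) CD uD by blast
    then have "a \<notin> path_image \<delta>" using C(3) uz by blast
    moreover have "closed (path_image \<delta>)" "connected (path_image \<delta>)"
      using d(1) by (simp_all add: arc_imp_path closed_path_image connected_path_image)
    moreover have "z0 \<in> path_image \<delta>" "u \<in> path_image \<delta>" using d(3,4) by auto
    ultimately show ?thesis using d(2) by (intro exI[of _ "path_image \<delta>"]) blast
  qed
  then obtain P where P: "\<And>u. u \<in> E \<Longrightarrow> closed (P u) \<and> a \<notin> P u \<and>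
     (\<forall>c. c \<notin> P u \<longrightarrow> (\<exists>A. connected A \<and> A \<subseteq> D \<and> c \<notin> A \<and> u \<in> A \<and> z0 \<in> A))" by metis
  have "closed (\<Union>u\<in>E. P u)" using fE P by (intro closed_UN) auto
  moreover have "a \<notin> (\<Union>u\<in>E. P u)" using P by blast
  ultimately have "open (- (\<Union>u\<in>E. P u))" "\<gamma> 1 \<in> - (\<Union>u\<in>E. P u)" unfolding g01 by (simp_all only: open_Compl Compl_iff not_False_eq_True)
  then obtain e where e: "e > 0" "ball (\<gamma> 1) e \<subseteq> - (\<Union>u\<in>E. P u)" by (meson openE)
  have "continuous_on {0..1} \<gamma>" using g(1) by (simp add: arc_def path_def)
  then obtain d where d: "d > 0" "\<And>t. t \<in> {0..1} \<Longrightarrow> dist t 1 < d \<Longrightarrow> dist (\<gamma> t) (\<gamma> 1) < e"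
    using e(1) unfolding continuous_on_iff by (metis atLeastAtMost_iff order_refl zero_le_one)
  define t0 where "t0 = max (1/2) (1 - d/2)"
  have t0: "0 < t0" "t0 < 1" unfolding t0_def using d(1) by auto
  have "\<gamma> t \<in> Y \<and> \<not> connected (Y - {\<gamma> t})" if t: "t \<in> {t0..<1}" for t
  proof -
    define c where "c = \<gamma> t"
    have t': "t \<in> {0..1}" "dist t 1 < d" "0 < t" "t < 1" using t t0 d(1) unfolding t0_def by (auto simp: dist_real_def)
    have "c \<in> ball (\<gamma> 1) e" using d(2)[OF t'(1,2)] unfolding c_def by (simp add: dist_commute)
    then have cP: "c \<notin> P u" if "u \<in> E" for u using e(2) that by blast
    have cne: "c \<noteq> a" "c \<noteq> z0" using inj t' unfolding c_def g01[symmetric] by (auto dest: inj_onD)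
    have cim: "c \<in> path_image \<gamma>" unfolding c_def path_image_def using t' by blast
    then have cC: "c \<in> C" using gC cne by blast
    define S where "S = side D c a"
    have zS: "z0 \<notin> S" unfolding S_def
      using arc_interior_separates[of D a z0 \<gamma> c] g(5) cim cne(1) zD by (simp add: conj_ac)
    have uS: "u \<notin> S" if u: "u \<in> E" for u
    proof
      assume uS: "u \<in> S"
      obtain A where A: "connected A" "A \<subseteq> D" "c \<notin> A" "u \<in> A" "z0 \<in> A" using P[OF u] cP[OF u] by blast
      have "A \<subseteq> S" unfolding S_def using A uS by (intro side_subset_side) (auto simp: S_def)
      then show False using A zS by blast
    qed
    define Q where "Q = S \<inter> C"
    have clS: "closure S \<subseteq> insert c S" unfolding S_def by (rule closure_side[OF dendriteD(5)[OF D(1)]])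
    have "openin (top_of_set D) S" unfolding S_def by (rule openin_side[OF dendriteD(3)[OF D(1)]])
    then obtain T1 where T1: "open T1" "S = D \<inter> T1" by (auto simp: openin_open)
    have QT: "Q = C \<inter> T1" unfolding Q_def T1(2) using CD by blast
    have Qop: "openin (top_of_set X) Q" unfolding QT by (rule openin_Int_open[OF Cop T1(1)])
    have "a \<in> S" unfolding S_def using zD cne by (intro side_self) auto
    then have "T1 \<inter> C \<noteq> {}" using T1 aC by (metis IntD2 closure_iff_nhds_not_empty inf_commute order_refl)
    then have "Q \<noteq> {}" unfolding QT by blast
    have "\<not> connected (Y - {c})"
    proof
      assume con: "connected (Y - {c})"
      have "c \<notin> Q" unfolding Q_def S_def using side_subset by blast
      then have "(Y - {c}) \<inter> bdry Q \<noteq> {}"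
        using con \<open>Q \<noteq> {}\<close> Qop YX CY cne zS z0(2) unfolding Q_def
        by (intro connected_meets_boundary[of _ X]) blast+
      then obtain y where y: "y \<in> Y" "y \<noteq> c" "y \<in> closure Q" "y \<notin> Q" by blast
      have "y \<in> closure S" "y \<in> closure C" using y(3) closure_mono[of Q S] closure_mono[of Q C] unfolding Q_def by blast+
      then have "y \<in> S" using clS y(2) by blast
      then have "y \<notin> C" using y(4) unfolding Q_def by blast
      then have "y \<in> E" unfolding E_def using \<open>y \<in> closure C\<close> y(1) aY by blast
      then show False using uS \<open>y \<in> S\<close> by blast
    qed
    then show ?thesis using cC CY unfolding c_def by blast
  qed
  then show ?thesis using t0 g01 arc_imp_path[OF g(1)] by (intro exI[of _ \<gamma>] exI[of _ t0]) auto
qed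

end

locale nonwandering_local_dendrite = local_dendrite_homeo +
  assumes nw: "nonwandering X f"
begin

text \<open>
  A set with a single boundary point \<open>c\<close> would make \<open>c\<close> a cut point, hence periodic.
\<close>

lemma two_boundary_points:
  assumes O': "openin (top_of_set X) O'" "O' \<noteq> {}" "closure O' \<noteq> X" and fin: "finite (bdry O')"
    and nper: "\<forall>c\<in>bdry O'. \<not> periodic c"
  shows "card (bdry O') \<ge> 2"
proof (rule ccontr)
  assume "\<not> ?thesis"
  then have "card (bdry O') = 0 \<or> card (bdry O') = 1" by linarith
  then obtain c where c: "bdry O' \<subseteq> {c}" "c \<in> X"
    using fin Xprops(3) card_1_singletonE[of "bdry O'"] closure_in_X[OF openin_imp_subset[OF O'(1)]]
    by (metis all_not_in_conv card_0_eq empty_subsetI insert_subset order_refl Diff_subset subset_trans)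
  have OX: "O' \<subseteq> X" using O'(1) openin_imp_subset by blast
  obtain y where y: "y \<in> X" "y \<notin> closure O'" using O'(3) closure_in_X[OF OX] by blast
  have "bdry O' \<noteq> {}" using O' y closure_subset[of O'] by (intro boundary_nonempty[OF Xprops(2)]) auto
  then have cb: "bdry O' = {c}" using c(1) by blast
  have "\<not> connected (X - {c})"
  proof
    assume "connected (X - {c})"
    then have "(X - {c}) \<inter> bdry O' \<noteq> {}"
      using O'(1,2) OX y cb closure_subset[of O'] by (intro connected_meets_boundary[of _ X]) blast+
    then show False using cb by blast
  qed
  then have "periodic c" using cut_point_periodic[OF homeo Xprops(2,5) nw c(2)] unfolding periodic_def by blast
  then show False using nper cb by blast
qed

text \<open>
  By submodularity, adding a bead that overlaps the union does not enlarge the boundary, because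
  the overlap uses up at least two of the four boundary points.
\<close>

lemma chain_boundary:
  assumes B: "bead B" and ne: "\<And>K. K \<in> chain B \<Longrightarrow> closure K \<noteq> X" and K: "K \<in> chain B"
  shows "finite (bdry K) \<and> card (bdry K) \<le> 2 \<and> (\<forall>c\<in>bdry K. \<not> periodic c)"
  using K
proof induction
  case base
  then show ?case using B unfolding bead_def by blast
next
  case (step K n)
  define L where "L = (f ^^ n) ` B"
  note L = bead_image[OF B, of n, folded L_def, unfolded bead_def]
  note K = chain_connected_open[OF B step(1)]
  have fin: "finite (bdry K)" "finite (bdry L)" using step L by auto
  note ui = bdry_Un_Int[OF fin]
  have nper: "\<forall>c\<in>bdry (K \<union> L) \<union> bdry (K \<inter> L). \<not> periodic c" using ui(2) step L by blast
  have fin2: "finite (bdry (K \<union> L))" "finite (bdry (K \<inter> L))" using ui(2) fin by (auto intro: finite_subset)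
  have "closure (K \<inter> L) \<subseteq> closure L" by (intro closure_mono) auto
  then have "closure (K \<inter> L) \<noteq> X" using L closure_in_X[OF bead_subset[OF bead_image[OF B, of n]]] unfolding L_def by blast
  then have "card (bdry (K \<inter> L)) \<ge> 2"
    using K L step(2) nper fin2 unfolding L_def[symmetric] by (intro two_boundary_points) auto
  then have "card (bdry (K \<union> L)) \<le> 2" using ui(1) step(3) L by linarith
  then show ?case using nper fin2 unfolding L_def by blast
qed

text \<open>
  If no finite chain is dense, let \<open>Y\<close> be the union of all chains. Three boundary points of \<open>Y\<close> would force
  three boundary points on a single chain, so the boundary of \<open>Y\<close> is finite. It is invariant under an
  iterate \<open>h\<close>, hence periodic. An arc of cut points of \<open>Y\<close> that tends to a boundary point has to leave every chain
  that contains its beginning; it does so at a boundary point of the chain, which is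
  not periodic although it is a cut point of \<open>Y\<close>.
\<close>

lemma finite_translates_cover:
  assumes B: "bead B"
  shows "\<exists>N. X \<subseteq> (\<Union>n\<le>N. (f ^^ n) ` closure B)"
proof (cases "\<exists>K\<in>chain B. closure K = X")
  case True
  then obtain K where K: "K \<in> chain B" "closure K = X" by blast
  obtain N where N: "K \<subseteq> (\<Union>n\<le>N. (f ^^ n) ` B)" using chain_connected_open[OF B K(1)] by blast
  have "closed (\<Union>n\<le>N. closure ((f ^^ n) ` B))" by (intro closed_UN) auto
  moreover have "(\<Union>n\<le>N. (f ^^ n) ` B) \<subseteq> (\<Union>n\<le>N. closure ((f ^^ n) ` B))" by (intro UN_mono closure_subset order_refl)
  then have "K \<subseteq> (\<Union>n\<le>N. closure ((f ^^ n) ` B))" using N by (rule order_trans[rotated])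
  ultimately have "closure K \<subseteq> (\<Union>n\<le>N. closure ((f ^^ n) ` B))" by (rule closure_minimal[rotated])
  then show ?thesis using K(2) funpow_closure[OF bead_subset[OF B]] by auto
next
  case False
  then have ne: "\<And>K. K \<in> chain B \<Longrightarrow> closure K \<noteq> X" by blast
  have cb: "finite (bdry K) \<and> card (bdry K) \<le> 2 \<and> (\<forall>c\<in>bdry K. \<not> periodic c)" if "K \<in> chain B" for K
    using chain_boundary[OF B _ that] ne by blast
  note basic = chain_connected_open[OF B]
  note b = B[unfolded bead_def]
  define Y where "Y = \<Union>(chain B)"
  have Yop: "openin (top_of_set X) Y" unfolding Y_def using basic by (intro openin_Union) blast
  have YX: "Y \<subseteq> X" using Yop openin_imp_subset by blast
  have BY: "B \<subseteq> Y" unfolding Y_def using chain.base by blast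
  have Ycon: "connected Y" unfolding Y_def
  proof (rule connected_Union)
    show "\<Inter> (chain B) \<noteq> {}" using b basic by blast
  qed (use basic in blast)
  have YneX: "Y \<noteq> X"
  proof
    assume e: "Y = X"
    have "\<forall>K\<in>chain B. \<exists>T. open T \<and> K = X \<inter> T" using basic by (metis openin_open)
    then obtain T where T: "\<And>K. K \<in> chain B \<Longrightarrow> open (T K) \<and> K = X \<inter> T K" by metis
    have "X \<subseteq> (\<Union>K\<in>chain B. T K)"
    proof
      fix x assume "x \<in> X"
      then obtain K where "K \<in> chain B" "x \<in> K" using e unfolding Y_def by blast
      then show "x \<in> (\<Union>K\<in>chain B. T K)" using T by blast
    qed
    then obtain \<K> where \<K>: "\<K> \<subseteq> chain B" "finite \<K>" "X \<subseteq> (\<Union>K\<in>\<K>. T K)"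
      using compactE_image[OF Xprops(1), of "chain B" T] T by metis
    have "X \<subseteq> \<Union>\<K>"
    proof
      fix x assume x: "x \<in> X"
      then obtain K where "K \<in> \<K>" "x \<in> T K" using \<K>(3) by blast
      then have "K = X \<inter> T K" using T \<K>(1) by (metis subsetD)
      then have "x \<in> K" using \<open>x \<in> T K\<close> x by blast
      then show "x \<in> \<Union>\<K>" using \<open>K \<in> \<K>\<close> by blast
    qed
    moreover obtain K where K: "K \<in> chain B" "\<Union>\<K> \<subseteq> K" using chain_finite_Un[OF B \<K>(2,1)] by (elim bexE)
    ultimately have "X \<subseteq> closure K" by (meson closure_subset order_trans)
    moreover have "closure K \<subseteq> X" using basic[OF K(1)] by (intro closure_in_X openin_imp_subset) blast
    ultimately show False using ne K(1) by blast
  qed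
  have bX: "bdry Y \<subseteq> X" using closure_in_X[OF YX] by blast
  \<comment> \<open>Disjoint connected neighbourhoods of points of S all meet one large chain but are not inside it.\<close>
  have card2: "card S \<le> 2" if S: "finite S" "S \<subseteq> bdry Y" for S
  proof -
    obtain r where r: "r > 0" "\<forall>s\<in>S. \<forall>t\<in>S. s \<noteq> t \<longrightarrow> ball s r \<inter> ball t r = {}"
      using finite_separating_radius[OF S(1)] by blast
    have "\<exists>N K. openin (top_of_set X) N \<and> connected N \<and> s \<in> N \<and> N \<subseteq> ball s r \<and> K \<in> chain B \<and> N \<inter> K \<noteq> {}" if s: "s \<in> S" for s
    proof -
      have sX: "s \<in> X" using s S(2) bX by blast
      obtain N where N: "openin (top_of_set X) N" "connected N" "s \<in> N" "N \<subseteq> ball s r"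
        using openin_closure_inside[OF Xprops(5) openin_subtopology_self sX Xprops(4) r(1)] by blast
      obtain T where T: "open T" "N = X \<inter> T" using N(1) by (auto simp: openin_open)
      have "s \<in> closure Y" using s S(2) by blast
      then have "T \<inter> Y \<noteq> {}" using T N(3) by (metis IntD2 closure_iff_nhds_not_empty inf_commute order_refl)
      then have "N \<inter> Y \<noteq> {}" using T(2) YX by blast
      then show ?thesis using N unfolding Y_def by blast
    qed
    then obtain N K where NK: "\<And>s. s \<in> S \<Longrightarrow> openin (top_of_set X) (N s) \<and> connected (N s) \<and> s \<in> N s \<and> N s \<subseteq> ball s r \<and>
        K s \<in> chain B \<and> N s \<inter> K s \<noteq> {}" by metis
    have "finite (K ` S)" "K ` S \<subseteq> chain B" using S(1) NK by auto
    then obtain L where L: "L \<in> chain B" "\<Union>(K ` S) \<subseteq> L" using chain_finite_Un[OF B] by blast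
    have "\<exists>c. c \<in> N s \<and> c \<in> bdry L" if s: "s \<in> S" for s
    proof -
      have "s \<notin> L" using s S(2) L(1) unfolding Y_def by blast
      moreover have "N s \<inter> L \<noteq> {}" using NK[OF s] L(2) s by blast
      moreover have "N s \<subseteq> X" using NK[OF s] openin_imp_subset by blast
      ultimately have "N s \<inter> bdry L \<noteq> {}" using NK[OF s] basic[OF L(1)] by (intro connected_meets_boundary[of _ X]) blast+
      then show ?thesis by blast
    qed
    then obtain c where c: "\<And>s. s \<in> S \<Longrightarrow> c s \<in> N s \<and> c s \<in> bdry L" by metis
    have "inj_on c S"
    proof (rule inj_onI, rule ccontr)
      fix s t assume st: "s \<in> S" "t \<in> S" "c s = c t" "s \<noteq> t"
      then have "c s \<in> ball s r \<inter> ball t r" using c NK by (metis IntI subsetD)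
      then show False using r(2) st by blast
    qed
    moreover have "c ` S \<subseteq> bdry L" using c by blast
    ultimately have "card S \<le> card (bdry L)" using cb[OF L(1)] card_inj_on_le by blast
    then show ?thesis using cb[OF L(1)] by linarith
  qed
  have finY: "finite (bdry Y)"
  proof (rule ccontr)
    assume "infinite (bdry Y)"
    then obtain S where "S \<subseteq> bdry Y" "finite S" "card S = 3" using infinite_arbitrarily_large by blast
    then show False using card2[of S] by simp
  qed
  obtain a where a: "a \<in> bdry Y" using boundary_nonempty[OF Xprops(2) Yop _ YneX] b BY by blast
  obtain m where m: "m \<ge> 1" "(f ^^ m) ` B \<inter> B \<noteq> {}" using nonwanderingE[OF nw, of B 1] b by auto
  define h where "h = f ^^ m"
  have h: "homeomorphism X X h (g ^^ m)" unfolding h_def by (rule funpow_homeo)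
  have hY: "h ` Y \<subseteq> Y"
  proof -
    have "h ` K \<subseteq> Y" if "K \<in> chain B" for K
      using chain_shift[OF B m(2) that] unfolding Y_def h_def by blast
    then show ?thesis unfolding Y_def by blast
  qed
  have hcl: "closure (h ` Y) = h ` closure Y" unfolding h_def by (rule funpow_closure[OF YX])
  \<comment> \<open>Otherwise the part of Y outside the closure of its image would wander under h.\<close>
  have "Y \<subseteq> h ` closure Y"
  proof (rule ccontr)
    assume nsub: "\<not> Y \<subseteq> h ` closure Y"
    define W where "W = Y - closure (h ` Y)"
    have "openin (top_of_set X) (Y \<inter> - closure (h ` Y))" by (rule openin_Int_open[OF Yop]) (rule open_Compl[OF closed_closure])
    then have "openin (top_of_set X) W" unfolding W_def by (simp add: Diff_eq)
    moreover have "W \<noteq> {}" unfolding W_def hcl using nsub by blast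
    ultimately obtain n where n: "n \<ge> 1" "(f ^^ (m * n)) ` W \<inter> W \<noteq> {}" using nonwanderingE[OF nw _ _ m(1)] by metis
    have "(h ^^ Suc j) ` Y \<subseteq> h ` Y" for j
    proof (induction j)
      case (Suc j)
      have "(h ^^ Suc (Suc j)) ` Y = h ` ((h ^^ Suc j) ` Y)" by (simp add: image_comp)
      also have "\<dots> \<subseteq> h ` Y" using Suc hY by blast
      finally show ?case .
    qed simp
    then have "(f ^^ (m * n)) ` Y \<subseteq> h ` Y"
      using n(1) unfolding h_def funpow_mult[symmetric] by (metis Suc_le_D One_nat_def)
    then show False using n(2) closure_subset[of "h ` Y"] unfolding W_def by blast
  qed
  then have "closure Y \<subseteq> h ` closure Y" unfolding hcl[symmetric] by (intro closure_minimal) auto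
  then have "bdry Y \<subseteq> h ` bdry Y" using hY by blast
  then have hb: "h ` bdry Y = bdry Y" using finY card_image_le[OF finY, of h] by (metis card_seteq finite_imageI)
  then have hYeq: "h ` Y = Y" using hY \<open>Y \<subseteq> h ` closure Y\<close> by blast
  have "(f ^^ (m * n)) a \<in> bdry Y" for n
  proof (induction n)
    case (Suc n)
    then have "h ((f ^^ (m * n)) a) \<in> bdry Y" using hb by blast
    then show ?case unfolding h_def by (simp add: funpow_add)
  qed (use a in simp)
  then have aper: "periodic a" using periodic_if_finite_orbit[OF finY _ m(1)] a bX by blast
  obtain \<gamma> t0 where g: "path \<gamma>" "0 \<le> t0" "t0 < 1" "\<gamma> 1 = a" "\<forall>t\<in>{t0..<1}. \<gamma> t \<in> Y \<and> \<not> connected (Y - {\<gamma> t})"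
    using cut_arc_to_boundary[OF Yop Ycon finY a] by blast
  have "\<gamma> t0 \<in> Y" using g by auto
  then obtain K where K: "K \<in> chain B" "\<gamma> t0 \<in> K" unfolding Y_def by blast
  have "a \<notin> K" using a K(1) unfolding Y_def by blast
  define A where "A = \<gamma> ` {t0..1}"
  have "connected A" unfolding A_def
    using g(1,2) by (intro connected_continuous_image connected_Icc) (auto simp: path_def intro: continuous_on_subset)
  moreover have "A \<subseteq> X"
  proof -
    have "\<gamma> t \<in> X" if "t \<in> {t0..1}" for t
      using that g(4,5) a bX YX by (cases "t = 1") (auto simp: subset_iff)
    then show ?thesis unfolding A_def by blast
  qed
  moreover have "\<gamma> t0 \<in> A" "\<gamma> 1 \<in> A" unfolding A_def using g(3) by auto
  then have "A \<inter> K \<noteq> {}" "\<not> A \<subseteq> K" using K(2) \<open>a \<notin> K\<close> g(4) by blast+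
  ultimately have "A \<inter> bdry K \<noteq> {}" using basic[OF K(1)] by (intro connected_meets_boundary[of _ X]) blast+
  then obtain t where t: "t \<in> {t0..1}" "\<gamma> t \<in> bdry K" unfolding A_def by blast
  have np: "\<not> periodic (\<gamma> t)" using cb[OF K(1)] t(2) by blast
  then have "t \<noteq> 1" using aper g(4) by auto
  then have c: "\<gamma> t \<in> Y" "\<not> connected (Y - {\<gamma> t})" using g(5) t by auto
  have hY': "homeomorphism Y Y h (g ^^ m)" 
    using homeomorphism_of_subsets[OF h, of Y Y] YX hYeq by blast
  have nwY: "nonwandering Y h" unfolding h_def
    by (rule nonwandering_open_subset[OF nonwandering_funpow[OF nw m(1)] Yop])
  have lcY: "locally connected Y" using locally_open_subset[OF Xprops(5) Yop] .
  obtain n where n: "n \<ge> 1" "(h ^^ n) (\<gamma> t) = \<gamma> t"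
    using cut_point_periodic[OF hY' Ycon lcY nwY c] by blast
  then have "(f ^^ (m * n)) (\<gamma> t) = \<gamma> t" unfolding h_def by (simp add: funpow_mult)
  moreover have "m * n \<ge> 1" using m(1) n(1) by (metis mult_le_mono nat_mult_1)
  ultimately have "periodic (\<gamma> t)" unfolding periodic_def by blast
  then show ?thesis using np by blast
qed

text \<open>
  The condition on connected sets says that every interior point of the arc separates its ends in \<open>D\<close>. The open set \<open>O'\<close>
  is where neighbourhoods in \<open>D\<close> are neighbourhoods in \<open>X\<close>; the arc itself may leave it.
\<close>

definition free_arc :: "'a set \<Rightarrow> 'a set \<Rightarrow> (real \<Rightarrow> 'a) \<Rightarrow> bool" where
  "free_arc D O' \<gamma> \<longleftrightarrow> dendrite D \<and> D \<subseteq> X \<and> openin (top_of_set X) O' \<and> O' \<subseteq> D \<and> arc \<gamma> \<and> path_image \<gamma> \<subseteq> D \<and>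
     (\<forall>A. connected A \<and> A \<subseteq> D \<and> \<gamma> 0 \<in> A \<and> \<gamma> 1 \<in> A \<longrightarrow> path_image \<gamma> \<subseteq> A) \<and>
     (\<forall>t. 0 < t \<and> t < 1 \<longrightarrow> \<not> periodic (\<gamma> t))"

text \<open>
  A bead is cut out by two points \<open>\<gamma> s\<close> and \<open>\<gamma> s'\<close> of the arc: the part of \<open>D\<close> that is behind the first and before
  the second. Branches of this part might leave a given neighbourhood \<open>U\<close>, but only through
  its finitely many boundary points, and each of those is between two consecutive cuts for at most one pair
  of neighbours in an increasing sequence of parameters. So more pairs than boundary points are tried.
\<close>

lemma bead_near_free_arc:
  assumes fa: "free_arc D O' \<gamma>" and t: "0 < t" "t < 1" "\<gamma> t \<in> O'" and W: "openin (top_of_set X) W" "\<gamma> t \<in> W"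
  shows "\<exists>V. bead V \<and> V \<subseteq> W \<and> V \<inter> path_image \<gamma> \<noteq> {}"
proof -
  have D: "dendrite D" "D \<subseteq> X" and O': "openin (top_of_set X) O'" "O' \<subseteq> D" and g: "arc \<gamma>" "path_image \<gamma> \<subseteq> D"
    and least: "\<And>A. connected A \<Longrightarrow> A \<subseteq> D \<Longrightarrow> \<gamma> 0 \<in> A \<Longrightarrow> \<gamma> 1 \<in> A \<Longrightarrow> path_image \<gamma> \<subseteq> A"
    and nper: "\<And>t. 0 < t \<Longrightarrow> t < 1 \<Longrightarrow> \<not> periodic (\<gamma> t)" using fa unfolding free_arc_def by auto
  note d = dendriteD[OF D(1)]
  have inj: "inj_on \<gamma> {0..1}" and cont: "continuous_on {0..1} \<gamma>" using g(1) by (simp_all add: arc_def path_def)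
  have im: "\<gamma> r \<in> path_image \<gamma>" if "0 \<le> r" "r \<le> 1" for r using that by (auto simp: path_image_def)
  have gD: "\<gamma> r \<in> D" if "0 \<le> r" "r \<le> 1" for r using im[OF that] g(2) by blast
  have tX: "\<gamma> t \<in> X" using gD[of t] t D(2) by auto
  obtain U where U: "openin (top_of_set X) U" "\<gamma> t \<in> U" "closure U \<subseteq> O' \<inter> W" "finite (bdry U)"
  proof -
    obtain D1 U O1 where "openin (top_of_set X) U" "\<gamma> t \<in> U" "closure U \<subseteq> O' \<inter> W" "finite (bdry U)"
      using connected_chart[OF tX openin_Int[OF O'(1) W(1)], of 1] t W by auto
    then show ?thesis using that by blast
  qed
  obtain T where T: "open T" "U = X \<inter> T" using U(1) by (auto simp: openin_open)
  then obtain e where e: "e > 0" "ball (\<gamma> t) e \<subseteq> T" using U(2) by (meson IntD2 openE)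
  obtain \<eta> where \<eta>: "\<eta> > 0" "\<And>r. r \<in> {0..1} \<Longrightarrow> dist r t < \<eta> \<Longrightarrow> dist (\<gamma> r) (\<gamma> t) < e"
    using cont e(1) t unfolding continuous_on_iff by (metis atLeastAtMost_iff less_imp_le)
  have nearU: "\<gamma> r \<in> U" if "0 \<le> r" "r \<le> 1" "\<bar>r - t\<bar> < \<eta>" for r
    using \<eta>(2)[of r] e(2) T gD[of r] D(2) that by (auto simp: dist_real_def dist_commute subset_iff)
  \<comment> \<open>There are k + 2 parameters, hence k + 1 pairs of neighbours, one more than boundary points.\<close>
  define k where "k = card (bdry U)"
  define \<delta> where "\<delta> = min \<eta> (1 - t)"
  have \<delta>: "\<delta> > 0" "\<delta> \<le> \<eta>" "t + \<delta> \<le> 1" unfolding \<delta>_def using \<eta> t by auto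
  define r where "r j = t + \<delta> * (real (Suc j) / real (k + 3))" for j :: nat
  have r_mono: "r i < r j" if "i < j" for i j
    unfolding r_def using that \<delta>(1) by (simp add: divide_strict_right_mono)
  have r_bds: "t < r j" "r j < t + \<delta>" if "j \<le> Suc k" for j
  proof -
    have "real (Suc j) / real (k + 3) < 1" using that by simp
    then have "\<delta> * (real (Suc j) / real (k + 3)) < \<delta> * 1" using \<delta>(1) by (intro mult_strict_left_mono)
    then show "r j < t + \<delta>" unfolding r_def by simp
    show "t < r j" unfolding r_def using \<delta>(1) by simp
  qed
  define L where "L s = side D (\<gamma> s) (\<gamma> 0)" for s
  define R where "R s = side D (\<gamma> s) (\<gamma> 1)" for s
  have ne: "\<gamma> s \<noteq> \<gamma> s'" if "0 \<le> s" "s < s'" "s' \<le> 1" for s s'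
    using inj that by (auto dest: inj_onD)
  have ends: "\<gamma> 0 \<in> L s" "\<gamma> 1 \<in> R s" if "0 < s" "s < 1" for s
    unfolding L_def R_def using that gD ne[of 0 s] ne[of s 1] by (auto intro!: side_self)
  have dis: "L s \<inter> R s = {}" if s: "0 < s" "s < 1" for s
  proof (rule ccontr)
    assume "L s \<inter> R s \<noteq> {}"
    then have "L s = R s" unfolding L_def R_def using side_eq by (metis disjoint_iff)
    then have "path_image \<gamma> \<subseteq> L s"
      using ends[OF s] connected_side side_subset unfolding L_def by (intro least) blast+
    then show False using im[of s] s side_subset[of D "\<gamma> s" "\<gamma> 0"] unfolding L_def by auto
  qed
  have in_L: "\<gamma> q \<in> L s" if q: "0 \<le> q" "q < s" "s < 1" for q s
  proof -
    have "connected (\<gamma> ` {0..q})"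
      using cont q by (intro connected_continuous_image connected_Icc) (auto intro: continuous_on_subset)
    moreover have "\<gamma> s \<notin> \<gamma> ` {0..q}"
    proof
      assume "\<gamma> s \<in> \<gamma> ` {0..q}"
      then obtain x where "0 \<le> x" "x \<le> q" "\<gamma> x = \<gamma> s" by auto
      then show False using ne[of x s] q by simp
    qed
    moreover have "\<gamma> ` {0..q} \<subseteq> D" using gD q by auto
    ultimately have "\<gamma> ` {0..q} \<subseteq> L s" unfolding L_def using q by (intro side_maximal) auto
    then show ?thesis using q by auto
  qed
  have in_R: "\<gamma> q \<in> R s" if q: "0 < s" "s < q" "q \<le> 1" for q s
  proof -
    have "connected (\<gamma> ` {q..1})"
      using cont q by (intro connected_continuous_image connected_Icc) (auto intro: continuous_on_subset)
    moreover have "\<gamma> s \<notin> \<gamma> ` {q..1}"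
    proof
      assume "\<gamma> s \<in> \<gamma> ` {q..1}"
      then obtain x where "q \<le> x" "x \<le> 1" "\<gamma> x = \<gamma> s" by auto
      then show False using ne[of s x] q by simp
    qed
    moreover have "\<gamma> ` {q..1} \<subseteq> D" using gD q by auto
    ultimately have "\<gamma> ` {q..1} \<subseteq> R s" unfolding R_def using q by (intro side_maximal) auto
    then show ?thesis using q by auto
  qed
  have L_mono: "L s \<subseteq> L s'" if s: "0 < s" "s \<le> s'" "s' < 1" for s s'
  proof (cases "s = s'")
    case False
    then have "\<gamma> s' \<in> R s" using in_R s by simp
    then have "\<gamma> s' \<notin> L s" using dis[of s] s by auto
    moreover have "L s \<subseteq> D" "connected (L s)" unfolding L_def using side_subset connected_side by blast+
    moreover have "\<gamma> 0 \<in> L s" using ends s by simp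
    ultimately show ?thesis unfolding L_def[of s'] by (intro side_maximal)
  qed simp
  have rI: "0 < r j" "r j < 1" if "j \<le> Suc k" for j using r_bds[OF that] t(1) \<delta>(3) by auto
  have "\<exists>j\<le>k. bdry U \<inter> R (r j) \<inter> L (r (Suc j)) = {}"
  proof (rule ccontr)
    assume "\<not> ?thesis"
    then have "\<forall>j. \<exists>u. j \<le> k \<longrightarrow> u \<in> bdry U \<inter> R (r j) \<inter> L (r (Suc j))" by blast
    then obtain u where u: "\<And>j. j \<le> k \<Longrightarrow> u j \<in> bdry U \<inter> R (r j) \<inter> L (r (Suc j))" by metis
    have neq: "u i \<noteq> u j" if ij: "i < j" "j \<le> k" for i j
    proof -
      have "r (Suc i) \<le> r j" using r_mono[of "Suc i" j] ij by (cases "Suc i = j") auto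
      then have "L (r (Suc i)) \<subseteq> L (r j)" using L_mono rI ij by auto
      then have "u i \<in> L (r j)" using u[of i] ij by auto
      moreover have "u j \<in> R (r j)" using u ij by auto
      ultimately show ?thesis using dis[of "r j"] rI[of j] ij by auto
    qed
    have "inj_on u {..k}"
    proof (rule inj_onI, rule ccontr)
      fix i j assume "i \<in> {..k}" "j \<in> {..k}" "u i = u j" "i \<noteq> j"
      then show False using neq[of i j] neq[of j i] by (cases "i < j") auto
    qed
    moreover have "u ` {..k} \<subseteq> bdry U" using u by blast
    ultimately have "card {..k} \<le> card (bdry U)" using U(4) card_inj_on_le by blast
    then show False unfolding k_def by simp
  qed
  then obtain j where j: "j \<le> k" "bdry U \<inter> R (r j) \<inter> L (r (Suc j)) = {}" by blast
  define s where "s = r j"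
  define s' where "s' = r (Suc j)"
  have s: "t < s" "s < s'" "s' < t + \<delta>" "0 < s" "s' < 1" "0 < s'" "s < 1"
    unfolding s_def s'_def using r_bds rI r_mono[of j "Suc j"] j(1) by auto
  define V where "V = R s \<inter> L s'"
  define q where "q = (s + s') / 2"
  have q: "s < q" "q < s'" unfolding q_def using s by auto
  have qV: "\<gamma> q \<in> V" unfolding V_def using in_R[of s q] in_L[of q s'] s q by auto
  have qU: "\<gamma> q \<in> U" using s q \<delta> t by (intro nearU) auto
  have RD: "R s \<subseteq> D - {\<gamma> s}" and LD: "L s' \<subseteq> D - {\<gamma> s'}" unfolding R_def L_def by (rule side_subset)+
  have "connected V" unfolding V_def
    using RD LD by (intro dendrite_connected_Int[OF D(1)]) (auto simp: R_def L_def connected_side)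
  moreover have VU: "V \<subseteq> U"
  proof (rule ccontr)
    assume "\<not> V \<subseteq> U"
    then have "V \<inter> bdry U \<noteq> {}"
      using \<open>connected V\<close> RD D(2) qV qU U(1) unfolding V_def by (intro connected_meets_boundary[of _ X]) blast+
    then show False using j(2) unfolding V_def s_def s'_def by blast
  qed
  moreover have "openin (top_of_set X) V"
  proof -
    have "openin (top_of_set D) V" unfolding V_def R_def L_def using openin_side[OF d(3)] by blast
    moreover have UD: "U \<subseteq> D" using U(3) O'(2) closure_subset[of U] by blast
    ultimately have "openin (top_of_set U) V" using VU by (blast intro: openin_subset_trans)
    then show ?thesis using U(1) openin_trans by blast
  qed
  moreover have bV: "bdry V \<subseteq> {\<gamma> s, \<gamma> s'}" and clR: "closure V \<subseteq> insert (\<gamma> s) (R s)"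
  proof -
    have "closure V \<subseteq> closure (R s)" "closure V \<subseteq> closure (L s')" unfolding V_def by (rule closure_mono, blast)+
    moreover have "closure (R s) \<subseteq> insert (\<gamma> s) (R s)" "closure (L s') \<subseteq> insert (\<gamma> s') (L s')"
      unfolding R_def L_def by (rule closure_side[OF d(5)])+
    ultimately show "bdry V \<subseteq> {\<gamma> s, \<gamma> s'}" "closure V \<subseteq> insert (\<gamma> s) (R s)" unfolding V_def by blast+
  qed
  moreover have "closure V \<noteq> X"
  proof
    assume "closure V = X"
    then have "\<gamma> 0 \<in> insert (\<gamma> s) (R s)" using clR gD[of 0] D(2) by auto
    then show False using ne[of 0 s] ends(1)[of s] dis[of s] s by auto
  qed
  moreover have "finite (bdry V)" using bV finite_subset by blast
  moreover have "card (bdry V) \<le> 2"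
  proof -
    have "card (bdry V) \<le> card {\<gamma> s, \<gamma> s'}" using bV by (intro card_mono) auto
    then show ?thesis using card_insert_le_m1[of 2 "{\<gamma> s'}" "\<gamma> s"] by simp
  qed
  moreover have "\<forall>c\<in>bdry V. \<not> periodic c" using bV nper[of s] nper[of s'] s by auto
  ultimately have "bead V" unfolding bead_def using qV by blast
  moreover have "V \<subseteq> W" using VU U(3) closure_subset[of U] by blast
  moreover have "\<gamma> q \<in> path_image \<gamma>" using im[of q] q s by auto
  ultimately show ?thesis using qV by blast
qed

end

context nonwandering_local_dendrite
begin

text \<open>
  The component of \<open>a\<close> in the part of the iterate inside \<open>U\<close> touches the boundary of \<open>U\<close>. If the closure of \<open>U\<close> is in a
  dendrite, the iterate therefore contains the least arc from \<open>a\<close> to a point of that boundary.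
\<close>

lemma bead_image_reaches_boundary:
  assumes B: "bead B" and U: "openin (top_of_set X) U"
    and a: "a \<in> U" "a \<in> (f ^^ n) ` B" and nsub: "\<not> (f ^^ n) ` B \<subseteq> U"
  shows "\<exists>b\<in>bdry U. \<exists>H. connected (insert b H) \<and> H \<subseteq> U \<and> a \<in> H \<and> insert b H \<subseteq> (f ^^ n) ` B"
proof -
  define G where "G = (f ^^ n) ` B"
  note G = bead_image[OF B, of n, folded G_def, unfolded bead_def]
  have GX: "G \<subseteq> X" using G openin_imp_subset by blast
  define H where "H = connected_component_set (G \<inter> U) a"
  have H: "connected H" "a \<in> H" "H \<subseteq> G \<inter> U" unfolding H_def using a by (auto simp: G_def dest: connected_component_in)
  have "openin (top_of_set X) H" unfolding H_def using G U by (intro openin_component Xprops) auto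
  then have "G \<inter> bdry H \<noteq> {}"
    using G GX H nsub unfolding G_def[symmetric] by (intro connected_meets_boundary[of G X]) blast+
  then obtain b where b: "b \<in> G" "b \<in> closure H" "b \<notin> H" by blast
  have "b \<notin> U" using b closure_component_Int[of "G \<inter> U" a] unfolding H_def by blast
  moreover have "b \<in> closure U" using b(2) closure_mono[of H U] H(3) by blast
  moreover have "connected (insert b H)" using H(1) b(2) by (rule connected_insert_closure)
  ultimately show ?thesis using b H unfolding G_def by blast
qed

text \<open>
  The two boundary points of \<open>G\<close> are in at most two of the three sets.
\<close>

lemma one_of_three_disjoint_beads_inside:
  assumes G: "bead G" and V: "\<And>i. i < 3 \<Longrightarrow> bead (V i) \<and> V i \<inter> G \<noteq> {}"
    and disj: "\<And>i j. i < 3 \<Longrightarrow> j < (3::nat) \<Longrightarrow> i \<noteq> j \<Longrightarrow> V i \<inter> V j = {}"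
  shows "\<exists>i<3. V i \<subseteq> G"
proof (rule ccontr)
  assume none: "\<not> ?thesis"
  have "\<exists>c. i < 3 \<longrightarrow> c \<in> V i \<inter> bdry G" for i
  proof (cases "i < 3")
    case True
    then have "V i \<inter> bdry G \<noteq> {}"
      using V[OF True] G none bead_subset[of "V i"] unfolding bead_def
      by (intro connected_meets_boundary[of _ X]) auto
    then show ?thesis by blast
  qed blast
  then obtain c where c: "\<And>i. i < 3 \<Longrightarrow> c i \<in> V i \<inter> bdry G" by metis
  have "inj_on c {..<3}" using c disj by (intro inj_onI) (metis IntE IntI emptyE lessThan_iff)
  moreover have "c ` {..<3} \<subseteq> bdry G" using c by blast
  ultimately have "card {..<3::nat} \<le> card (bdry G)" using G card_inj_on_le unfolding bead_def by blast
  then show False using G unfolding bead_def by simp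
qed

text \<open>
  Letting \<open>\<delta>\<close> tend to 0 shows that the points \<open>f\<^sup>j w\<close> with \<open>j \<le> N\<close> exhaust \<open>X\<close>, so \<open>w\<close> would have a finite
  orbit.
\<close>

lemma no_cover_by_shrinking_translates:
  assumes w: "w \<in> X" "\<not> periodic w"
    and cov: "\<And>\<delta>. \<delta> > 0 \<Longrightarrow> X \<subseteq> (\<Union>j\<le>N. (f ^^ j) ` (X \<inter> cball w \<delta>))"
  shows False
proof -
  have "x \<in> (\<lambda>j. (f ^^ j) w) ` {..N}" if x: "x \<in> X" for x
  proof (rule ccontr)
    assume nx: "x \<notin> (\<lambda>j. (f ^^ j) w) ` {..N}"
    have "\<exists>d>0. \<forall>y\<in>X. dist y w < d \<longrightarrow> (f ^^ j) y \<noteq> x" if j: "j \<le> N" for j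
    proof -
      have "dist x ((f ^^ j) w) > 0" using nx j by auto
      then obtain d where "d > 0" "\<forall>y\<in>X. dist y w < d \<longrightarrow> dist ((f ^^ j) y) ((f ^^ j) w) < dist x ((f ^^ j) w)"
        using funpow_cont[of j] w(1) unfolding continuous_on_iff by blast
      then show ?thesis by blast
    qed
    then obtain d where d: "\<And>j. j \<le> N \<Longrightarrow> d j > 0 \<and> (\<forall>y\<in>X. dist y w < d j \<longrightarrow> (f ^^ j) y \<noteq> x)" by metis
    define \<delta> where "\<delta> = Min (d ` {..N}) / 2"
    have mn: "Min (d ` {..N}) > 0" using d by (subst Min_gr_iff) auto
    then have "\<delta> > 0" unfolding \<delta>_def by simp
    then obtain j y where jy: "j \<le> N" "y \<in> X" "dist w y \<le> \<delta>" "x = (f ^^ j) y" using cov x by fastforce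
    have "Min (d ` {..N}) \<le> d j" using jy(1) by (intro Min_le) auto
    moreover have "\<delta> < Min (d ` {..N})" unfolding \<delta>_def using mn by linarith
    ultimately have "dist y w < d j" using jy(3) dist_commute[of y w] by linarith
    then show False using d[OF jy(1)] jy(2,4) by blast
  qed
  then have "X \<subseteq> (\<lambda>j. (f ^^ j) w) ` {..N}" by (rule subsetI)
  then have "finite X" by (rule finite_subset) simp
  then have "periodic w" using periodic_if_finite_orbit[of X w 1] w funpow_in by simp
  then show False using w(2) by blast
qed

text \<open>
  Suppose that all beads have a large iterate, in particular those in a small ball about a point \<open>w\<close> of the
  arc. Large iterates meet a finite set \<open>F\<close> and therefore contain one of finitely many arcs
  \<open>\<beta>\<close>, the same one for balls of arbitrarily small radius. A periodic point on \<open>\<beta>\<close> would have points of its finite orbit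
  arbitrarily close to \<open>w\<close>, so \<open>\<beta>\<close> is a free arc. Three disjoint beads are placed on it, and one of them
  lies in the large iterate. Finitely many iterates of that one cover \<open>X\<close>; moving back along the
  orbit, the same number of iterates of the bead in the small ball cover \<open>X\<close>.
\<close>

lemma exists_stable_bead:
  assumes fa: "free_arc D O' \<gamma>" and t: "0 < t" "t < 1" "\<gamma> t \<in> O'" and "e > 0"
  shows "\<exists>B. bead B \<and> (\<forall>n. \<forall>x\<in>(f ^^ n) ` B. \<forall>y\<in>(f ^^ n) ` B. dist x y \<le> e)"
proof (rule ccontr)
  assume "\<not> ?thesis"
  then have big: "\<And>B. bead B \<Longrightarrow> \<exists>n. \<exists>x\<in>(f ^^ n) ` B. \<exists>y\<in>(f ^^ n) ` B. dist x y > e" by (meson not_le)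
  define w where "w = \<gamma> t"
  have wX: "w \<in> X" and wper: "\<not> periodic w" using fa t unfolding free_arc_def w_def by blast+
  have "\<exists>D U Op. dendrite D \<and> D \<subseteq> X \<and> openin (top_of_set X) Op \<and> Op \<subseteq> D \<and> openin (top_of_set X) U \<and> connected U \<and> x \<in> U \<and>
     closure U \<subseteq> Op \<and> U \<subseteq> ball x (e/2) \<and> finite (bdry U)" if "x \<in> X" for x
    using connected_chart[OF that openin_subtopology_self that, of "e/2"] \<open>e > 0\<close> by auto
  then obtain Dx Ux Ox where ch: "\<And>x. x \<in> X \<Longrightarrow> dendrite (Dx x) \<and> Dx x \<subseteq> X \<and> openin (top_of_set X) (Ox x) \<and> Ox x \<subseteq> Dx x \<and>
     openin (top_of_set X) (Ux x) \<and> connected (Ux x) \<and> x \<in> Ux x \<and>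
     closure (Ux x) \<subseteq> Ox x \<and> Ux x \<subseteq> ball x (e/2) \<and> finite (bdry (Ux x))" by metis
  obtain F where F: "finite F" "F \<subseteq> X" and Fsmall: "\<And>A x y. connected A \<Longrightarrow> A \<subseteq> X - F \<Longrightarrow> x \<in> A \<Longrightarrow> y \<in> A \<Longrightarrow> dist x y \<le> e"
    using finite_cut_set[OF ld, of e UNIV] ch by (metis subset_UNIV)
  define PP where "PP = (SIGMA a:F. bdry (Ux a))"
  have finPP: "finite PP" unfolding PP_def using F ch by (intro finite_SigmaI) auto
  have abX: "a \<in> X \<and> b \<in> closure (Ux a) \<and> b \<notin> Ux a \<and> a \<in> Ux a" if "(a, b) \<in> PP" for a b
    using that F(2) ch unfolding PP_def by blast
  have UD: "closure (Ux a) \<subseteq> Dx a" if "a \<in> X" for a using ch[OF that] by blast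
  have "\<exists>\<alpha>. arc \<alpha> \<and> path_image \<alpha> \<subseteq> Dx (fst p) \<and> \<alpha> 0 = fst p \<and> \<alpha> 1 = snd p \<and>
     (\<forall>A. connected A \<and> A \<subseteq> Dx (fst p) \<and> fst p \<in> A \<and> snd p \<in> A \<longrightarrow> path_image \<alpha> \<subseteq> A)" if "p \<in> PP" for p
  proof -
    obtain a b where p: "p = (a, b)" by (cases p)
    note ab = abX[OF that[unfolded p]]
    have "a \<in> Dx a" "b \<in> Dx a" "a \<noteq> b" using ab UD[of a] closure_subset[of "Ux a"] by blast+
    then show ?thesis using dendrite_least_connected_arc[of "Dx a" a b] ch[of a] ab
      unfolding p pathstart_def pathfinish_def by auto
  qed
  then obtain \<alpha> where \<alpha>: "\<And>p. p \<in> PP \<Longrightarrow> arc (\<alpha> p) \<and> path_image (\<alpha> p) \<subseteq> Dx (fst p) \<and> \<alpha> p 0 = fst p \<and> \<alpha> p 1 = snd p \<and>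
     (\<forall>A. connected A \<and> A \<subseteq> Dx (fst p) \<and> fst p \<in> A \<and> snd p \<in> A \<longrightarrow> path_image (\<alpha> p) \<subseteq> A)" by metis
  define Q where "Q p \<delta> \<longleftrightarrow> (\<exists>B n. bead B \<and> B \<subseteq> ball w \<delta> \<and> path_image (\<alpha> p) \<subseteq> (f ^^ n) ` B \<and>
      path_image (\<alpha> p) \<subseteq> insert (snd p) (Ux (fst p)))" for p \<delta>
  have exQ: "\<exists>p\<in>PP. Q p \<delta>" if "\<delta> > 0" for \<delta>
  proof -
    have "openin (top_of_set X) (X \<inter> ball w \<delta>)" by (intro openin_open_Int) auto
    then obtain B where B: "bead B" "B \<subseteq> X \<inter> ball w \<delta>"
      using bead_near_free_arc[OF fa t, of "X \<inter> ball w \<delta>"] wX \<open>\<delta> > 0\<close> unfolding w_def by auto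
    obtain n x y where n: "x \<in> (f ^^ n) ` B" "y \<in> (f ^^ n) ` B" "dist x y > e" using big[OF B(1)] by blast
    define G where "G = (f ^^ n) ` B"
    note G = bead_image[OF B(1), of n, folded G_def, unfolded bead_def]
    have "\<not> G \<subseteq> X - F"
    proof
      assume "G \<subseteq> X - F"
      then have "dist x y \<le> e" using Fsmall[of G x y] G n unfolding G_def by blast
      then show False using n(3) by simp
    qed
    moreover have "G \<subseteq> X" using G openin_imp_subset by blast
    ultimately obtain a where a: "a \<in> F" "a \<in> G" by blast
    have aX: "a \<in> X" using a F by blast
    have "\<not> G \<subseteq> Ux a"
    proof
      assume "G \<subseteq> Ux a"
      then have "G \<subseteq> ball a (e/2)" using ch[OF aX] by blast
      then have "dist a x < e/2" "dist a y < e/2" using n unfolding G_def by auto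
      then show False using n(3) dist_triangle_half_r[of a x e y] by simp
    qed
    then obtain b H where b: "b \<in> bdry (Ux a)" "connected (insert b H)" "H \<subseteq> Ux a" "a \<in> H" "insert b H \<subseteq> G"
      using bead_image_reaches_boundary[OF B(1), of "Ux a" a n] ch[OF aX] a(2) unfolding G_def by blast
    have p: "(a, b) \<in> PP" unfolding PP_def using a b by blast
    have "insert b H \<subseteq> Dx a" using b(1,3) UD[OF aX] closure_subset[of "Ux a"] by blast
    then have "path_image (\<alpha> (a, b)) \<subseteq> insert b H" using \<alpha>[OF p] b(2,4) by auto
    then have "Q (a, b) \<delta>" unfolding Q_def using B b(3,5) unfolding G_def by (intro exI[of _ B] exI[of _ n]) auto
    then show ?thesis using p by blast
  qed
  \<comment> \<open>The property is monotone in the radius and there are only finitely many arcs.\<close>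
  have "\<exists>p\<in>PP. \<forall>\<delta>>0. Q p \<delta>"
  proof (rule ccontr)
    assume "\<not> ?thesis"
    then obtain d where d: "\<And>p. p \<in> PP \<Longrightarrow> d p > 0 \<and> \<not> Q p (d p)" by metis
    have ne: "PP \<noteq> {}" using exQ[of 1] by auto
    define \<delta> where "\<delta> = Min (d ` PP)"
    have "\<delta> > 0" unfolding \<delta>_def using d finPP ne by (subst Min_gr_iff) auto
    then obtain p where p: "p \<in> PP" "Q p \<delta>" using exQ by blast
    have "\<delta> \<le> d p" unfolding \<delta>_def using finPP p(1) by (intro Min_le) auto
    then have "Q p (d p)" using p(2) subset_ball[of \<delta> "d p" w] unfolding Q_def by (meson order_trans)
    then show False using d p(1) by blast
  qed
  then obtain p where p: "p \<in> PP" "\<And>\<delta>. \<delta> > 0 \<Longrightarrow> Q p \<delta>" by blast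
  obtain a b where pab: "p = (a, b)" by (cases p)
  note ab = abX[OF p(1)[unfolded pab]]
  define \<beta> where "\<beta> = \<alpha> p"
  have \<beta>: "arc \<beta>" "path_image \<beta> \<subseteq> Dx a" "\<beta> 0 = a" "\<beta> 1 = b" 
     "\<forall>A. connected A \<and> A \<subseteq> Dx a \<and> a \<in> A \<and> b \<in> A \<longrightarrow> path_image \<beta> \<subseteq> A"
    using \<alpha>[OF p(1)] unfolding \<beta>_def pab by auto
  have \<beta>U: "path_image \<beta> \<subseteq> insert b (Ux a)" using p(2)[of 1] unfolding Q_def \<beta>_def pab by auto
  have chA: "dendrite (Dx a)" "Dx a \<subseteq> X" "openin (top_of_set X) (Ox a)" "Ox a \<subseteq> Dx a" "Ux a \<subseteq> Ox a"
    using ch[of a] ab closure_subset[of "Ux a"] by blast+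
  have nper: "\<not> periodic c" if c: "c \<in> path_image \<beta>" for c
  proof
    assume pc: "periodic c"
    have cX: "c \<in> X" using c \<beta>(2) chA(2) by blast
    define Orb where "Orb = range (\<lambda>j. (f ^^ j) c)"
    have fin: "finite Orb" unfolding Orb_def by (rule periodic_orbit_finite[OF pc])
    have "w \<notin> Orb"
    proof
      assume "w \<in> Orb"
      then obtain j where j: "w = (f ^^ j) c" unfolding Orb_def by blast
      obtain m where m: "m \<ge> 1" "(f ^^ m) c = c" using pc unfolding periodic_def by blast
      have "(f ^^ m) w = (f ^^ j) ((f ^^ m) c)" unfolding j by (metis add.commute comp_apply funpow_add)
      then show False using m wper j unfolding periodic_def by auto
    qed
    then obtain \<delta> where \<delta>: "\<delta> > 0" "\<forall>x\<in>Orb. x \<noteq> w \<longrightarrow> \<delta> \<le> dist w x" using finite_set_avoid[OF fin, of w] by blast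
    obtain B n where B: "bead B" "B \<subseteq> ball w \<delta>" "path_image \<beta> \<subseteq> (f ^^ n) ` B" using p(2)[OF \<delta>(1)] unfolding Q_def \<beta>_def by blast
    obtain y where y: "y \<in> B" "(f ^^ n) y = c" using c B(3) by blast
    then have "y \<in> Orb" using periodic_preimage_in_orbit[OF pc cX _ y(2)] bead_subset[OF B(1)] unfolding Orb_def by blast
    moreover have "dist w y < \<delta>" using B(2) y(1) by auto
    ultimately show False using \<delta>(2) \<open>w \<notin> Orb\<close> by fastforce
  qed
  have im: "\<beta> s \<in> path_image \<beta>" if "0 < s" "s < 1" for s using that by (auto simp: path_image_def)
  have fa2: "free_arc (Dx a) (Ox a) \<beta>"
    unfolding free_arc_def using chA \<beta> nper im by auto
  define \<tau> where "\<tau> i = (real i + 1) / 4" for i :: nat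
  have \<tau>: "0 < \<tau> i" "\<tau> i < 1" if "i < 3" for i using that unfolding \<tau>_def by auto
  have inj: "inj_on \<beta> {0..1}" using \<beta>(1) by (simp add: arc_def)
  have \<beta>\<tau>: "\<beta> (\<tau> i) \<in> Ux a" if "i < 3" for i
  proof -
    have "\<beta> (\<tau> i) \<noteq> b" using inj \<tau>[OF that] unfolding \<beta>(4)[symmetric] by (auto dest: inj_onD)
    then show ?thesis using im[OF \<tau>[OF that]] \<beta>U by blast
  qed
  have distinct: "\<beta> (\<tau> i) \<noteq> \<beta> (\<tau> j)" if "i < 3" "j < 3" "i \<noteq> j" for i j
  proof
    assume "\<beta> (\<tau> i) = \<beta> (\<tau> j)"
    then have "\<tau> i = \<tau> j" using inj \<tau>[OF that(1)] \<tau>[OF that(2)] by (auto dest: inj_onD)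
    then show False using that(3) unfolding \<tau>_def by simp
  qed
  obtain \<rho> where \<rho>: "\<rho> > 0" "\<forall>s\<in>(\<lambda>i. \<beta> (\<tau> i)) ` {..<3}. \<forall>t\<in>(\<lambda>i. \<beta> (\<tau> i)) ` {..<3}. s \<noteq> t \<longrightarrow> ball s \<rho> \<inter> ball t \<rho> = {}"
    using finite_separating_radius[of "(\<lambda>i. \<beta> (\<tau> i)) ` {..<3}"] by auto
  have "\<exists>V. bead V \<and> V \<subseteq> ball (\<beta> (\<tau> i)) \<rho> \<and> V \<inter> path_image \<beta> \<noteq> {}" if i: "i < 3" for i
  proof -
    have "openin (top_of_set X) (X \<inter> ball (\<beta> (\<tau> i)) \<rho>)" by (intro openin_open_Int) auto
    moreover have "\<beta> (\<tau> i) \<in> X \<inter> ball (\<beta> (\<tau> i)) \<rho>" using \<beta>\<tau>[OF i] chA \<rho>(1) by auto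
    ultimately show ?thesis using bead_near_free_arc[OF fa2 \<tau>[OF i], of "X \<inter> ball (\<beta> (\<tau> i)) \<rho>"] \<beta>\<tau>[OF i] chA(5) by blast
  qed
  then obtain V where V: "\<And>i. i < 3 \<Longrightarrow> bead (V i) \<and> V i \<subseteq> ball (\<beta> (\<tau> i)) \<rho> \<and> V i \<inter> path_image \<beta> \<noteq> {}" by metis
  have Vdis: "V i \<inter> V j = {}" if "i < 3" "j < 3" "i \<noteq> j" for i j
  proof -
    have "ball (\<beta> (\<tau> i)) \<rho> \<inter> ball (\<beta> (\<tau> j)) \<rho> = {}" using \<rho>(2) distinct[OF that] that by blast
    then show ?thesis using V[OF that(1)] V[OF that(2)] by blast
  qed
  define N where "N i = (SOME N. X \<subseteq> (\<Union>n\<le>N. (f ^^ n) ` closure (V i)))" for i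
  have N: "X \<subseteq> (\<Union>n\<le>N i. (f ^^ n) ` closure (V i))" if "i < 3" for i
  proof -
    have "bead (V i)" using V[OF that] by blast
    then have "\<exists>N. X \<subseteq> (\<Union>n\<le>N. (f ^^ n) ` closure (V i))" by (rule finite_translates_cover)
    then show ?thesis unfolding N_def by (rule someI_ex)
  qed
  define M where "M = Max (N ` {..<3})"
  have NM: "N i \<le> M" if "i < 3" for i unfolding M_def using that by (intro Max_ge) auto
  show False
  proof (rule no_cover_by_shrinking_translates[OF wX wper])
    fix \<delta> :: real assume "\<delta> > 0"
    then obtain B n where B: "bead B" "B \<subseteq> ball w \<delta>" "path_image \<beta> \<subseteq> (f ^^ n) ` B"
      using p(2)[OF \<open>\<delta> > 0\<close>] unfolding Q_def \<beta>_def by blast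
    have "bead (V i) \<and> V i \<inter> (f ^^ n) ` B \<noteq> {}" if "i < 3" for i using V[OF that] B(3) by blast
    then obtain i where i: "i < 3" "V i \<subseteq> (f ^^ n) ` B"
      using one_of_three_disjoint_beads_inside[OF bead_image[OF B(1), of n], of V] Vdis by metis
    have BX: "B \<subseteq> X" using bead_subset B(1) by blast
    have clB: "closure B \<subseteq> X \<inter> cball w \<delta>"
      using closure_in_X[OF BX] closure_minimal[OF order_trans[OF B(2) ball_subset_cball] closed_cball] by blast
    have clV: "closure (V i) \<subseteq> (f ^^ n) ` closure B" using closure_mono[OF i(2)] funpow_closure[OF BX] by simp
    show "X \<subseteq> (\<Union>j\<le>M. (f ^^ j) ` (X \<inter> cball w \<delta>))"
    proof
      fix x assume x: "x \<in> X"
      then have "(f ^^ n) x \<in> (\<Union>j\<le>N i. (f ^^ j) ` closure (V i))" using N[OF i(1)] funpow_in by blast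
      then obtain j v where jv: "j \<le> N i" "v \<in> closure (V i)" "(f ^^ n) x = (f ^^ j) v" by blast
      obtain y where y: "y \<in> closure B" "v = (f ^^ n) y" using jv(2) clV by blast
      have "(f ^^ n) x = (f ^^ n) ((f ^^ j) y)" using jv(3) y(2) by (metis add.commute comp_apply funpow_add)
      then have "x = (f ^^ j) y" using funpow_inj x funpow_in y(1) clB by blast
      moreover have "j \<le> M" using jv(1) NM[OF i(1)] by simp
      ultimately show "x \<in> (\<Union>j\<le>M. (f ^^ j) ` (X \<inter> cball w \<delta>))" using y(1) clB by blast
    qed
  qed
qed

end

section \<open>Separated sets and polynomial entropy\<close>

lemma dyn_dist_le:
  assumes "n \<ge> 1" "\<And>k. k < n \<Longrightarrow> dist ((f ^^ k) x) ((f ^^ k) y) \<le> c"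
  shows "dyn_dist f n x y \<le> c"
  unfolding dyn_dist_def using assms by (subst Max_le_iff) (auto simp: lessThan_empty_iff)

lemma dyn_dist_ge: "k < n \<Longrightarrow> dist ((f ^^ k) x) ((f ^^ k) y) \<le> dyn_dist f n x y"
  unfolding dyn_dist_def by (intro Max_ge) auto

lemma dyn_dist_commute: "dyn_dist f n x y = dyn_dist f n y x"
  unfolding dyn_dist_def by (simp add: dist_commute)

context local_dendrite_homeo
begin

text \<open>
  Sending \<open>x\<close> to a point of \<open>G\<close> in the closure of its component is injective on a separated set.
\<close>

lemma separated_card_le:
  assumes F: "\<And>A x y. connected A \<Longrightarrow> A \<subseteq> X - F \<Longrightarrow> x \<in> A \<Longrightarrow> y \<in> A \<Longrightarrow> dist x y \<le> d"
    and G: "finite G" "G \<subseteq> X" "G \<noteq> {}" and FG: "\<And>k x. k < n \<Longrightarrow> x \<in> X - G \<Longrightarrow> (f ^^ k) x \<notin> F"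
    and d: "0 \<le> d" "2 * d < e" and n: "n \<ge> 1" and E: "dyn_separated X f n e E"
  shows "card E \<le> card G"
proof -
  have "\<exists>p\<in>G. \<forall>k<n. dist ((f ^^ k) x) ((f ^^ k) p) \<le> d" if x: "x \<in> X" for x
  proof -
    obtain p where p: "p \<in> G" "x = p \<or> (\<exists>A. connected A \<and> A \<subseteq> X - G \<and> x \<in> closure A \<and> p \<in> closure A)"
      using component_touches_finite_set[OF Xprops(2,5,4) G x] by blast
    have "dist ((f ^^ k) x) ((f ^^ k) p) \<le> d" if k: "k < n" for k
    proof (cases "x = p")
      case False
      then obtain A where A: "connected A" "A \<subseteq> X - G" "x \<in> closure A" "p \<in> closure A" using p by blast
      have AX: "A \<subseteq> X" using A by blast
      have con: "connected ((f ^^ k) ` A)"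
        using A(1) AX funpow_cont by (intro connected_continuous_image) (auto intro: continuous_on_subset)
      have sub: "(f ^^ k) ` A \<subseteq> X - F" using FG[OF k] A(2) AX funpow_in by blast
      have "(f ^^ k) x \<in> closure ((f ^^ k) ` A)" "(f ^^ k) p \<in> closure ((f ^^ k) ` A)"
        using A(3,4) funpow_closure[OF AX] by auto
      then show ?thesis using diam_closure_bound[of "(f ^^ k) ` A" d] F[OF con sub] by blast
    qed (simp add: d)
    then show ?thesis using p(1) by blast
  qed
  then obtain p where p: "\<And>x. x \<in> X \<Longrightarrow> p x \<in> G \<and> (\<forall>k<n. dist ((f ^^ k) x) ((f ^^ k) (p x)) \<le> d)" by metis
  have EX: "E \<subseteq> X" using E unfolding dyn_separated_def by blast
  have "inj_on p E"
  proof (rule inj_onI, rule ccontr)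
    fix x y assume xy: "x \<in> E" "y \<in> E" "p x = p y" "x \<noteq> y"
    have "dist ((f ^^ k) x) ((f ^^ k) y) \<le> 2 * d" if "k < n" for k
      using p[of x] p[of y] xy EX that dist_triangle2[of "(f ^^ k) x" "(f ^^ k) y" "(f ^^ k) (p x)"] by fastforce
    then have "dyn_dist f n x y \<le> 2 * d" using n by (intro dyn_dist_le) auto
    then show False using E xy d(2) unfolding dyn_separated_def by fastforce
  qed
  moreover have "p ` E \<subseteq> G" using p EX by blast
  ultimately show ?thesis using G(1) card_inj_on_le by blast
qed

text \<open>
  The set \<open>G\<close> consists of the preimages of \<open>F\<close> under the first \<open>n\<close> iterates, and of one more point that makes it
  nonempty.
\<close>

lemma separated_linear_bound:
  assumes "e > 0"
  shows "\<exists>C. \<forall>n\<ge>1. \<forall>E. dyn_separated X f n e E \<longrightarrow> card E \<le> C * n"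
proof -
  have nb: "\<exists>V. openin (top_of_set X) V \<and> x \<in> V \<and> V \<subseteq> ball x ((e/3)/2) \<and> finite (bdry V) \<and> bdry V \<subseteq> UNIV" if "x \<in> X" for x
    using connected_chart[OF that openin_subtopology_self that, of "(e/3)/2"] assms by (metis divide_pos_pos subset_UNIV zero_less_numeral)
  obtain F where F: "finite F" "F \<subseteq> X"
    and small: "\<forall>A x y. connected A \<and> A \<subseteq> X - F \<and> x \<in> A \<and> y \<in> A \<longrightarrow> dist x y \<le> e/3"
    by (rule exE[OF finite_cut_set[OF ld nb]]) (assumption, elim conjE, blast)
  obtain x0 where x0: "x0 \<in> X" using Xprops(3) by blast
  have "card E \<le> (card F + 1) * n" if n: "n \<ge> 1" and E: "dyn_separated X f n e E" for n E
  proof -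
    define G where "G = insert x0 (\<Union>k<n. (g ^^ k) ` F)"
    have gX: "(g ^^ k) x \<in> X" if "x \<in> X" for k x
      using funpow_homeo[of k] that unfolding homeomorphism_def by auto
    have "card E \<le> card G"
    proof (rule separated_card_le[OF _ _ _ _ _ _ _ n E])
      show "dist x y \<le> e/3" if "connected A" "A \<subseteq> X - F" "x \<in> A" "y \<in> A" for A x y using small that by blast
      show "finite G" "G \<noteq> {}" unfolding G_def using F(1) by auto
      show "G \<subseteq> X" unfolding G_def using x0 gX F(2) by auto
      show "(f ^^ k) x \<notin> F" if "k < n" "x \<in> X - G" for k x
      proof
        assume "(f ^^ k) x \<in> F"
        moreover have "(g ^^ k) ((f ^^ k) x) = x" using homeomorphism_apply1[OF funpow_homeo] that(2) by blast
        ultimately have "x \<in> (g ^^ k) ` F" by (metis imageI)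
        then show False using that unfolding G_def by blast
      qed
    qed (use assms in auto)
    also have "card G \<le> 1 + card (\<Union>k<n. (g ^^ k) ` F)" unfolding G_def using F(1) by (simp add: card_insert_if)
    also have "card (\<Union>k<n. (g ^^ k) ` F) \<le> (\<Sum>k<n. card ((g ^^ k) ` F))" by (rule card_UN_le) simp
    also have "\<dots> \<le> (\<Sum>k<n. card F)" by (intro sum_mono card_image_le F(1))
    finally show ?thesis using n by (simp add: algebra_simps)
  qed
  then show ?thesis by blast
qed

text \<open>
  For \<open>i < j\<close>, the points \<open>g\<^sup>i p\<close> and \<open>g\<^sup>j p\<close> are mapped by \<open>f\<^sup>j\<close> to a point outside the wandering neighbourhood
  and to \<open>p\<close>, respectively.
\<close>

lemma wandering_separated:
  assumes "wandering_point X f p"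
  shows "\<exists>e0>0. \<forall>n\<ge>1. \<forall>e\<le>e0. \<exists>E. dyn_separated X f n e E \<and> card E = n"
proof -
  obtain U V where pX: "p \<in> X" and U: "U \<subseteq> X" "wandering_set f U" and V: "openin (top_of_set X) V" "p \<in> V" "V \<subseteq> U"
    using assms unfolding wandering_point_def neighbourhood_in_def by blast
  obtain T where T: "open T" "V = X \<inter> T" using V(1) by (auto simp: openin_open)
  then obtain e0 where e0: "e0 > 0" "ball p e0 \<subseteq> T" using V(2) by (meson IntD2 openE)
  have out: "dist p ((f ^^ m) p) \<ge> e0" if "m \<ge> 1" for m
  proof (rule ccontr)
    assume "\<not> ?thesis"
    then have "(f ^^ m) p \<in> ball p e0" by simp
    then have "(f ^^ m) p \<in> U" using e0(2) T(2) V(3) funpow_in[OF pX] by blast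
    then show False using U(2) that V(2,3) unfolding wandering_set_def by blast
  qed
  define q where "q j = (g ^^ j) p" for j
  have gX: "q k \<in> X" for k using funpow_homeo[of k] pX unfolding homeomorphism_def q_def by auto
  have fq: "(f ^^ j) (q j) = p" for j using homeomorphism_apply2[OF funpow_homeo] pX unfolding q_def by blast
  have sep: "dyn_dist f n (q i) (q j) \<ge> e0" if ij: "i < j" "j < n" for n i j
  proof -
    have "(f ^^ j) (q i) = (f ^^ (j - i)) ((f ^^ i) (q i))"
      using funpow_add[of "j - i" i f] ij(1) by (simp add: o_def)
    then have "(f ^^ j) (q i) = (f ^^ (j - i)) p" using fq by simp
    then have "dist ((f ^^ j) (q i)) ((f ^^ j) (q j)) \<ge> e0"
      using out[of "j - i"] ij(1) fq by (simp add: dist_commute)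
    then show ?thesis using dyn_dist_ge[OF ij(2), of f "q i" "q j"] by linarith
  qed
  have sep': "dyn_dist f n (q i) (q j) \<ge> e0" if "i \<noteq> j" "i < n" "j < n" for n i j
    using sep[of i j n] sep[of j i n] that dyn_dist_commute[of f n "q i" "q j"] by (cases "i < j") auto
  have "dyn_separated X f n e (q ` {..<n}) \<and> card (q ` {..<n}) = n" if n: "n \<ge> 1" "e \<le> e0" for n e
  proof
    show "dyn_separated X f n e (q ` {..<n})"
      unfolding dyn_separated_def using gX by (auto intro!: order_trans[OF n(2)] sep')
    have "inj_on q {..<n}"
    proof (rule inj_onI, rule ccontr)
      fix i j assume ij: "i \<in> {..<n}" "j \<in> {..<n}" "q i = q j" "i \<noteq> j"
      have "dyn_dist f n (q i) (q i) \<le> 0" using n(1) by (intro dyn_dist_le) auto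
      then show False using sep'[of i j n] ij e0(1) by auto
    qed
    then show "card (q ` {..<n}) = n" by (simp add: card_image)
  qed
  then show ?thesis using e0(1) by blast
qed

lemma sep_num_bounds:
  assumes "\<And>E. dyn_separated X f n e E \<Longrightarrow> card E \<le> C"
  shows "sep_num X f n e \<le> C" and "dyn_separated X f n e E \<Longrightarrow> card E \<le> sep_num X f n e"
    and "1 \<le> sep_num X f n e"
proof -
  let ?S = "{card E |E. dyn_separated X f n e E}"
  have "?S \<subseteq> {..C}" using assms by auto
  then have fin: "finite ?S" using finite_subset by blast
  have "dyn_separated X f n e {}" unfolding dyn_separated_def by simp
  then have ne: "?S \<noteq> {}" by blast
  show "sep_num X f n e \<le> C" unfolding sep_num_def using fin ne assms by (subst Max_le_iff) auto
  show *: "card E \<le> sep_num X f n e" if "dyn_separated X f n e E" for E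
    unfolding sep_num_def using fin that by (intro Max_ge) auto
  obtain x0 where "x0 \<in> X" using Xprops(3) by blast
  then have "dyn_separated X f n e {x0}" unfolding dyn_separated_def by simp
  from *[OF this] show "1 \<le> sep_num X f n e" by simp
qed

lemma const_over_ln: "(\<lambda>n. c / ln (real n)) \<longlonglongrightarrow> 0"
proof -
  have "filterlim (\<lambda>n. ln (real n)) at_top sequentially"
    by (rule filterlim_compose[OF ln_at_top filterlim_real_sequentially])
  then show ?thesis by (intro tendsto_divide_0[OF tendsto_const] filterlim_at_top_imp_at_infinity)
qed

text \<open>
  Only small \<open>e\<close> matter for the outer limit, and a limit in \<open>n\<close> is an upper limit.
\<close>

lemma pol_entropyI:
  assumes "e0 > 0" "\<And>e. 0 < e \<Longrightarrow> e \<le> e0 \<Longrightarrow> (\<lambda>n. ln (real (sep_num X f n e)) / ln (real n)) \<longlonglongrightarrow> h"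
  shows "pol_entropy X f = ereal h"
proof -
  have "limsup (\<lambda>n. ereal (ln (real (sep_num X f n e)) / ln (real n))) = ereal h" if "0 < e" "e \<le> e0" for e
    using assms(2)[OF that] by (intro lim_imp_Limsup) auto
  moreover have "\<forall>\<^sub>F e in at_right 0. 0 < e \<and> e \<le> e0"
    using assms(1) by (auto simp: eventually_at_right_field intro: exI[of _ e0])
  ultimately have "\<forall>\<^sub>F e in at_right 0. limsup (\<lambda>n. ereal (ln (real (sep_num X f n e)) / ln (real n))) = ereal h"
    by (simp add: eventually_mono)
  then have "((\<lambda>e. limsup (\<lambda>n. ereal (ln (real (sep_num X f n e)) / ln (real n)))) \<longlongrightarrow> ereal h) (at_right (0::real))"
    by (rule tendsto_eventually)
  then show ?thesis unfolding pol_entropy_def by (intro tendsto_Lim) auto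
qed

lemma pol_entropy_bounded:
  assumes "\<And>e. e > 0 \<Longrightarrow> \<exists>C. \<forall>n\<ge>1. \<forall>E. dyn_separated X f n e E \<longrightarrow> card E \<le> C"
  shows "pol_entropy X f = 0"
proof -
  have "pol_entropy X f = ereal 0"
  proof (rule pol_entropyI[of 1])
    fix e :: real assume "0 < e" "e \<le> 1"
    then obtain C where C: "\<And>n E. n \<ge> 1 \<Longrightarrow> dyn_separated X f n e E \<Longrightarrow> card E \<le> C" using assms by blast
    have b: "0 \<le> ln (real (sep_num X f n e)) / ln (real n) \<and> ln (real (sep_num X f n e)) / ln (real n) \<le> ln (real C) / ln (real n)"
      if n: "n \<ge> 1" for n
    proof -
      have s: "1 \<le> sep_num X f n e" "sep_num X f n e \<le> C" using sep_num_bounds[OF C[OF n]] by blast+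
      then have "0 \<le> ln (real (sep_num X f n e))" "ln (real (sep_num X f n e)) \<le> ln (real C)" by auto
      moreover have "0 \<le> ln (real n)" using n by simp
      ultimately show ?thesis by (auto intro: divide_right_mono)
    qed
    show "(\<lambda>n. ln (real (sep_num X f n e)) / ln (real n)) \<longlonglongrightarrow> 0"
      by (rule tendsto_sandwich[OF _ _ tendsto_const const_over_ln[of "ln (real C)"]])
        (use b in \<open>auto simp: eventually_sequentially\<close>)
  qed simp
  then show ?thesis by (simp add: zero_ereal_def)
qed

lemma pol_entropy_wandering:
  assumes "wandering_point X f p"
  shows "pol_entropy X f = 1"
proof -
  obtain e0 where e0: "e0 > 0" and low: "\<And>n e. n \<ge> 1 \<Longrightarrow> e \<le> e0 \<Longrightarrow> \<exists>E. dyn_separated X f n e E \<and> card E = n"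
    using wandering_separated[OF assms] by blast
  have "pol_entropy X f = ereal 1"
  proof (rule pol_entropyI[OF e0])
    fix e :: real assume e: "0 < e" "e \<le> e0"
    then obtain C where C: "\<And>n E. n \<ge> 1 \<Longrightarrow> dyn_separated X f n e E \<Longrightarrow> card E \<le> C * n" using separated_linear_bound by blast
    have b: "1 \<le> ln (real (sep_num X f n e)) / ln (real n) \<and> ln (real (sep_num X f n e)) / ln (real n) \<le> ln (real C) / ln (real n) + 1"
      if n: "n \<ge> 2" for n
    proof -
      have n1: "n \<ge> 1" using n by simp
      obtain E where "dyn_separated X f n e E" "card E = n" using low[OF n1 e(2)] by blast
      then have s: "n \<le> sep_num X f n e" "sep_num X f n e \<le> C * n" using sep_num_bounds[OF C[OF n1]] by blast+
      then have C0: "C > 0" using n by (cases C) auto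
      have pos: "ln (real n) > 0" using n by simp
      have "ln (real n) \<le> ln (real (sep_num X f n e))" using s n by simp
      moreover have "real (sep_num X f n e) \<le> real (C * n)" "0 < real (sep_num X f n e)"
        using s n by (simp_all only: of_nat_le_iff)
      then have "ln (real (sep_num X f n e)) \<le> ln (real (C * n))" by (subst ln_le_cancel_iff) linarith+
      moreover have "ln (real (C * n)) = ln (real C) + ln (real n)" using C0 n by (simp add: ln_mult)
      ultimately show ?thesis using pos by (simp add: field_simps)
    qed
    have "(\<lambda>n. ln (real C) / ln (real n) + 1) \<longlonglongrightarrow> 0 + 1" by (intro tendsto_add const_over_ln tendsto_const)
    then have lim: "(\<lambda>n. ln (real C) / ln (real n) + 1) \<longlonglongrightarrow> 1" by simp
    show "(\<lambda>n. ln (real (sep_num X f n e)) / ln (real n)) \<longlonglongrightarrow> 1"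
      by (rule tendsto_sandwich[OF eventually_sequentiallyI[of 2] eventually_sequentiallyI[of 2] tendsto_const lim])
        (use b in blast)+
  qed
  then show ?thesis by (simp add: one_ereal_def)
qed

end

context nonwandering_local_dendrite
begin

text \<open>
  Two points in the same iterate of a stable closed bead stay close forever.
\<close>

lemma separated_bounded_if_free_arc:
  assumes fa: "free_arc D O' \<gamma>" and t: "0 < t" "t < 1" "\<gamma> t \<in> O'" and e: "e > 0"
  shows "\<exists>C. \<forall>n\<ge>1. \<forall>E. dyn_separated X f n e E \<longrightarrow> card E \<le> C"
proof -
  obtain B where B: "bead B" and small: "\<And>n x y. x \<in> (f ^^ n) ` B \<Longrightarrow> y \<in> (f ^^ n) ` B \<Longrightarrow> dist x y \<le> e/2"
    using exists_stable_bead[OF fa t, of "e/2"] e by auto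
  have BX: "B \<subseteq> X" by (rule bead_subset[OF B])
  obtain N where N: "X \<subseteq> (\<Union>n\<le>N. (f ^^ n) ` closure B)" using finite_translates_cover[OF B] by blast
  have "card E \<le> N + 1" if n: "n \<ge> 1" and E: "dyn_separated X f n e E" for n E
  proof -
    have EX: "E \<subseteq> X" using E unfolding dyn_separated_def by blast
    have "\<forall>x\<in>E. \<exists>j\<le>N. x \<in> (f ^^ j) ` closure B" using N EX by blast
    then obtain j where j: "\<And>x. x \<in> E \<Longrightarrow> j x \<le> N \<and> x \<in> (f ^^ j x) ` closure B" by metis
    have "inj_on j E"
    proof (rule inj_onI, rule ccontr)
      fix x y assume xy: "x \<in> E" "y \<in> E" "j x = j y" "x \<noteq> y"
      have "dist ((f ^^ k) x) ((f ^^ k) y) \<le> e/2" for k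
      proof -
        have "(f ^^ k) z \<in> closure ((f ^^ (k + j x)) ` B)" if "z \<in> (f ^^ j x) ` closure B" for z
          using that funpow_closure[OF BX, of "k + j x"] by (auto simp: funpow_add)
        then have "(f ^^ k) x \<in> closure ((f ^^ (k + j x)) ` B)" "(f ^^ k) y \<in> closure ((f ^^ (k + j x)) ` B)"
          using j[OF xy(1)] j[OF xy(2)] xy(3) by auto
        then show ?thesis
          using diam_closure_bound[of "(f ^^ (k + j x)) ` B" "e/2"] small[of _ "k + j x"] by blast
      qed
      then have "dyn_dist f n x y \<le> e/2" using n by (intro dyn_dist_le)
      then show False using E xy e unfolding dyn_separated_def by fastforce
    qed
    moreover have "j ` E \<subseteq> {..N}" using j by blast
    ultimately have "card E \<le> card {..N}" using card_inj_on_le by blast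
    then show ?thesis by simp
  qed
  then show ?thesis by blast
qed

text \<open>
  Without free arcs the small neighbourhoods can be bounded by periodic points. The union of the orbits of these points
  is finite and contains all their preimages.
\<close>

lemma separated_bounded_if_no_free_arc:
  assumes none: "\<not> (\<exists>D O' \<gamma> t. free_arc D O' \<gamma> \<and> 0 < t \<and> t < 1 \<and> \<gamma> t \<in> O')" and e: "e > 0"
  shows "\<exists>C. \<forall>n\<ge>1. \<forall>E. dyn_separated X f n e E \<longrightarrow> card E \<le> C"
proof -
  have nb: "\<exists>V. openin (top_of_set X) V \<and> x \<in> V \<and> V \<subseteq> ball x ((e/3)/2) \<and> finite (bdry V) \<and> bdry V \<subseteq> Collect periodic"
    if x: "x \<in> X" for x
  proof -
    obtain D O' where D: "dendrite D" "D \<subseteq> X" "openin (top_of_set X) O'" "x \<in> O'" "O' \<subseteq> D"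
      using local_dendrite_chart[OF ld x] by blast
    have sep: "\<exists>z\<in>Collect periodic. z \<in> D \<and> z \<noteq> x \<and> z \<noteq> y \<and> y \<notin> side D z x" if y: "y \<in> D" "y \<noteq> x" for y
    proof -
      have xD: "x \<in> D" using D by blast
      obtain \<gamma> where g: "arc \<gamma>" "path_image \<gamma> \<subseteq> D" "\<gamma> 0 = x" "\<gamma> 1 = y"
        "\<forall>A. connected A \<and> A \<subseteq> D \<and> x \<in> A \<and> y \<in> A \<longrightarrow> path_image \<gamma> \<subseteq> A"
        using dendrite_least_connected_arc[OF D(1) xD y(1)] y(2) unfolding pathstart_def pathfinish_def by metis
      have "\<exists>t. 0 < t \<and> t < 1 \<and> periodic (\<gamma> t)"
      proof (rule ccontr)
        assume "\<not> ?thesis"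
        then have fa: "free_arc D O' \<gamma>" unfolding free_arc_def using D g by auto
        obtain T where T: "open T" "O' = X \<inter> T" using D(3) by (auto simp: openin_open)
        then obtain r where r: "r > 0" "ball x r \<subseteq> T" using D(4) by (meson IntD2 openE)
        have "continuous_on {0..1} \<gamma>" using g(1) by (simp add: arc_def path_def)
        then obtain d where d: "d > 0" "\<forall>t\<in>{0..1}. dist t 0 < d \<longrightarrow> dist (\<gamma> t) (\<gamma> 0) < r"
          using r(1) unfolding continuous_on_iff by (metis atLeastAtMost_iff order_refl zero_le_one)
        define t where "t = min (1/2) (d/2)"
        have t: "0 < t" "t < 1" "t < d" unfolding t_def using d(1) by auto
        then have "dist (\<gamma> t) x < r" using d(2) g(3) by auto
        then have "\<gamma> t \<in> T" using r(2) by (auto simp: dist_commute)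
        moreover have "\<gamma> t \<in> X" using g(2) D(2) t by (auto simp: path_image_def subset_iff)
        ultimately show False using none fa t T(2) by blast
      qed
      then obtain t where t: "0 < t" "t < 1" "periodic (\<gamma> t)" by blast
      have inj: "inj_on \<gamma> {0..1}" using g(1) by (simp add: arc_def)
      have ne: "\<gamma> t \<noteq> x" "\<gamma> t \<noteq> y" using inj t unfolding g(3,4)[symmetric] by (auto dest: inj_onD)
      have im: "\<gamma> t \<in> path_image \<gamma>" using t by (auto simp: path_image_def)
      then show ?thesis using arc_interior_separates[OF g(5) im ne(1) xD] ne g(2) t(3) by blast
    qed
    show ?thesis using local_small_neighbourhood[OF D, of "(e/3)/2" "Collect periodic"] sep e by auto
  qed
  obtain F where F: "finite F" "F \<subseteq> Collect periodic" "F \<subseteq> X"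
    and small: "\<forall>A x y. connected A \<and> A \<subseteq> X - F \<and> x \<in> A \<and> y \<in> A \<longrightarrow> dist x y \<le> e/3"
    by (rule exE[OF finite_cut_set[OF ld nb]]) (assumption, elim conjE, blast)
  obtain x0 where x0: "x0 \<in> X" using Xprops(3) by blast
  define G where "G = insert x0 (\<Union>c\<in>F. range (\<lambda>j. (f ^^ j) c))"
  have "finite G" unfolding G_def using F periodic_orbit_finite by auto
  have "card E \<le> card G" if n: "n \<ge> 1" and E: "dyn_separated X f n e E" for n E
  proof (rule separated_card_le[OF _ \<open>finite G\<close> _ _ _ _ _ n E])
    show "dist x y \<le> e/3" if "connected A" "A \<subseteq> X - F" "x \<in> A" "y \<in> A" for A x y using small that by blast
    show "G \<noteq> {}" unfolding G_def by auto
    show "G \<subseteq> X" unfolding G_def using x0 funpow_in F(3) by auto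
    show "(f ^^ k) x \<notin> F" if "k < n" and x: "x \<in> X - G" for k x
    proof
      assume c: "(f ^^ k) x \<in> F"
      then obtain j where "x = (f ^^ j) ((f ^^ k) x)"
        using periodic_preimage_in_orbit[of "(f ^^ k) x" x k] F(2,3) x by blast
      then show False using c x unfolding G_def by blast
    qed
  qed (use e in auto)
  then show ?thesis by blast
qed

lemma pol_entropy_nonwandering: "pol_entropy X f = 0"
proof (rule pol_entropy_bounded)
  fix e :: real assume e: "e > 0"
  show "\<exists>C. \<forall>n\<ge>1. \<forall>E. dyn_separated X f n e E \<longrightarrow> card E \<le> C"
    using separated_bounded_if_free_arc[OF _ _ _ _ e] separated_bounded_if_no_free_arc[OF _ e] by blast
qed

end

theorem theorem12:
  fixes X :: "'a::metric_space set" and f g :: "'a \<Rightarrow> 'a"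
  assumes "local_dendrite X"
    and "homeomorphism X X f g"
  shows "pol_entropy X f \<in> {0, 1} \<and>
         (pol_entropy X f = 1 \<longleftrightarrow> (\<exists>p. wandering_point X f p))"
proof -
  interpret local_dendrite_homeo X f g by unfold_locales (rule assms)+
  show ?thesis
  proof (cases "\<exists>p. wandering_point X f p")
    case True
    then show ?thesis using pol_entropy_wandering by auto
  next
    case False
    have "nonwandering X f"
    proof (rule nonwanderingI[OF assms(2)])
      fix O' assume O': "openin (top_of_set X) O'" "O' \<noteq> {}"
      then obtain p where "p \<in> O'" by blast
      moreover have "O' \<subseteq> X" using O'(1) openin_imp_subset by blast
      ultimately have "\<not> wandering_set f O'"
        using False O'(1) unfolding wandering_point_def neighbourhood_in_def by blast
      then show "\<exists>n\<ge>1. (f ^^ n) ` O' \<inter> O' \<noteq> {}" unfolding wandering_set_def by blast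
    qed
    then interpret nonwandering_local_dendrite X f g by unfold_locales
    show ?thesis using pol_entropy_nonwandering False by simp
  qed
qed

end
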